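(* Let $X$ be an infinite-dimensional complex Banach space and $T\in L(X)$. Then $$\partial\sigma_{gDR}(T)\subset\partial\sigma_{\mathbf{gDR}\mathcal M}(T)\subset\partial\sigma_{\mathbf{gDR}\mathcal W_+}(T)\subset\partial\sigma_{\mathbf{gDR}\Phi_+}(T)\subset\partial\sigma_{gKR}(T),$$ $$\partial\sigma_{gDR}(T)\subset\partial\sigma_{\mathbf{gDR}\mathcal W}(T)\subset\partial\sigma_{\mathbf{gDR}\Phi}(T)\subset\partial\sigma_{gKR}(T),$$ $$\partial\sigma_{gDR}(T)\subset\partial\sigma_{\mathbf{gDR}\mathcal Q}(T)\subset\partial\sigma_{\mathbf{gDR}\mathcal W_-}(T)\subset\partial\sigma_{\mathbf{gDR}\Phi_-}(T)\subset\partial\sigma_{gKR}(T),$$ $$\partial\sigma_{\mathbf{gDR}\Phi}(T)\subset\partial\sigma_{\mathbf{gDR}\Phi_+}(T),\ \partial\sigma_{\mathbf{gDR}\Phi}(T)\subset\partial\sigma_{\mathbf{gDR}\Phi_-}(T),\ \partial\sigma_{\mathbf{gDR}\mathcal W}(T)\subset\partial\sigma_{\mathbf{gDR}\mathcal W_+}(T),\ \partial\sigma_{\mathbf{gDR}\mathcal W}(T)\subset\partial\sigma_{\mathbf{gDR}\mathcal W_-}(T),$$ and $$\eta\sigma_{gKR}(T)=\eta\sigma_{\mathbf{gDR}\Phi_+}(T)=\eta\sigma_{\mathbf{gDR}\mathcal W_+}(T)=\eta\sigma_{\mathbf{gDR}\mathcal M}(T)=\eta\sigma_{\mathbf{gDR}\Phi_-}(T)=\eta\sigma_{\mathbf{gDR}\mathcal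 W_-}(T)=\eta\sigma_{\mathbf{gDR}\mathcal Q}(T)=\eta\sigma_{\mathbf{gDR}\Phi}(T)=\eta\sigma_{\mathbf{gDR}\mathcal W}(T)=\eta\sigma_{gDR}(T).$$
   Context: $S$ is Kato if $R(S)$ is closed and $N(S)\subset R(S^n)$ for all $n$; $S$ is Riesz if $S-\lambda$ is Fredholm for all $\lambda\ne0$. $\sigma_{gKR}(T)$ is the set of $\lambda$ for which there are no closed $(T-\lambda)$-invariant $M,N$ with $X=M\oplus N$, $(T-\lambda)_M$ Kato and $(T-\lambda)_N$ Riesz. Classes: $\mathcal M$ bounded below; $\mathcal Q$ surjective; $\Phi_+$: finite-dimensional kernel and closed range; $\Phi_-$: finite-codimensional range; $\Phi=\Phi_+\cap\Phi_-$; $\mathcal W_+$, $\mathcal W_-$, $\mathcal W$: operators in $\Phi_+$, $\Phi_-$, $\Phi$ with index $\le0$, $\ge0$, $=0$. For a class $\mathbf R$, $\sigma_{\mathbf{gDR}\mathbf R}(T)$ is the set of $\lambda$ for which there are no closed $(T-\lambda)$-invariant $M,N$ with $X=M\oplus N$, $(T-\lambda)_M\in\mathbf R$ and $(T-\lambda)_N$ Riesz; $\sigma_{gDR}(T)$ is this set for $\mathbf R$ the invertible operators (equivalently, the set of $\lambda$ with $T-\lambda$ not generalized Drazin-Riesz invertible, i.e. no $S$ with $S(T-\lambda)=(T-\lambda)S$, $S(T-\lambda)S=S$, $(T-\lambda)S(T-\lambda)-(T-\lambda)$ Riesz). For compact $K\subset\mathbb C$, the connected hull $\eta K$ is the complement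 of the unbounded component of $\mathbb C\setminus K$; $\partial$ is the boundary. *)

theory Defs
  imports "HOL-Analysis.Analysis"
begin

class complex_banach = banach +
  fixes scaleC :: "complex \<Rightarrow> 'a \<Rightarrow> 'a"  (infixr \<open>*\<^sub>C\<close> 75)
  assumes scaleC_add_right: "a *\<^sub>C (x + y) = a *\<^sub>C x + a *\<^sub>C y"
    and scaleC_add_left: "(a + b) *\<^sub>C x = a *\<^sub>C x + b *\<^sub>C x"
    and scaleC_scaleC: "a *\<^sub>C (b *\<^sub>C x) = (a * b) *\<^sub>C x"
    and scaleC_one: "1 *\<^sub>C x = x"
    and scaleR_scaleC: "scaleR r x = complex_of_real r *\<^sub>C x"
    and norm_scaleC: "norm (a *\<^sub>C x) = cmod a * norm x"

instantiation complex :: complex_banach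
begin
definition scaleC_complex :: "complex \<Rightarrow> complex \<Rightarrow> complex" where
  "scaleC_complex a x = a * x"
instance
  by standard (auto simp: scaleC_complex_def algebra_simps norm_mult scaleR_conv_of_real)
end

definition cspan :: "'a::complex_banach set \<Rightarrow> 'a set" where
  "cspan B = {(\<Sum>b\<in>t. c b *\<^sub>C b) | t c. finite t \<and> t \<subseteq> B}"

definition csubspace :: "'a::complex_banach set \<Rightarrow> bool" where
  "csubspace M \<longleftrightarrow> 0 \<in> M \<and> (\<forall>x\<in>M. \<forall>y\<in>M. x + y \<in> M) \<and> (\<forall>a. \<forall>x\<in>M. a *\<^sub>C x \<in> M)"

definition cfindim :: "'a::complex_banach set \<Rightarrow> bool" where
  "cfindim V \<longleftrightarrow> (\<exists>B. finite B \<and> V \<subseteq> cspan B)"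

definition cdim :: "'a::complex_banach set \<Rightarrow> nat" where
  "cdim V = (LEAST n. \<exists>B. B \<subseteq> V \<and> finite B \<and> card B = n \<and> V \<subseteq> cspan B)"

definition ccomplement :: "'a::complex_banach set \<Rightarrow> 'a set \<Rightarrow> 'a set \<Rightarrow> bool" where
  "ccomplement M R C \<longleftrightarrow> csubspace C \<and> C \<subseteq> M \<and> C \<inter> R = {0} \<and>
     (\<forall>x\<in>M. \<exists>r\<in>R. \<exists>c\<in>C. x = r + c)"

definition cfincodim :: "'a::complex_banach set \<Rightarrow> 'a set \<Rightarrow> bool" where
  "cfincodim M R \<longleftrightarrow> (\<exists>C. ccomplement M R C \<and> cfindim C)"

definition ccodim :: "'a::complex_banach set \<Rightarrow> 'a set \<Rightarrow> nat" where
  "ccodim M R = (LEAST n. \<exists>C. ccomplement M R C \<and> cfindim C \<and> cdim C = n)"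

definition bounded_clinear :: "('a::complex_banach \<Rightarrow> 'a) \<Rightarrow> bool" where
  "bounded_clinear T \<longleftrightarrow> bounded_linear T \<and> (\<forall>a x. T (a *\<^sub>C x) = a *\<^sub>C T x)"

definition kerM :: "'a::complex_banach set \<Rightarrow> ('a \<Rightarrow> 'a) \<Rightarrow> 'a set" where
  "kerM M S = {x\<in>M. S x = 0}"

definition invertible_on :: "'a::complex_banach set \<Rightarrow> ('a \<Rightarrow> 'a) \<Rightarrow> bool" where
  "invertible_on M S \<longleftrightarrow> inj_on S M \<and> S ` M = M"

definition bounded_below_on :: "'a::complex_banach set \<Rightarrow> ('a \<Rightarrow> 'a) \<Rightarrow> bool" where
  "bounded_below_on M S \<longleftrightarrow> (\<exists>c>0. \<forall>x\<in>M. c * norm x \<le> norm (S x))"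

definition surjective_on :: "'a::complex_banach set \<Rightarrow> ('a \<Rightarrow> 'a) \<Rightarrow> bool" where
  "surjective_on M S \<longleftrightarrow> S ` M = M"

definition upper_semi_fredholm_on :: "'a::complex_banach set \<Rightarrow> ('a \<Rightarrow> 'a) \<Rightarrow> bool" where
  "upper_semi_fredholm_on M S \<longleftrightarrow> cfindim (kerM M S) \<and> closed (S ` M)"

definition lower_semi_fredholm_on :: "'a::complex_banach set \<Rightarrow> ('a \<Rightarrow> 'a) \<Rightarrow> bool" where
  "lower_semi_fredholm_on M S \<longleftrightarrow> cfincodim M (S ` M)"

definition fredholm_on :: "'a::complex_banach set \<Rightarrow> ('a \<Rightarrow> 'a) \<Rightarrow> bool" where
  "fredholm_on M S \<longleftrightarrow> upper_semi_fredholm_on M S \<and> lower_semi_fredholm_on M S"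

text \<open>Index conventions: for S in Phi_+ but not Phi_-, the index is -infinity;
for S in Phi_- but not Phi_+, it is +infinity.\<close>
definition weyl_plus_on :: "'a::complex_banach set \<Rightarrow> ('a \<Rightarrow> 'a) \<Rightarrow> bool" where
  "weyl_plus_on M S \<longleftrightarrow> upper_semi_fredholm_on M S \<and>
     (cfincodim M (S ` M) \<longrightarrow> cdim (kerM M S) \<le> ccodim M (S ` M))"

definition weyl_minus_on :: "'a::complex_banach set \<Rightarrow> ('a \<Rightarrow> 'a) \<Rightarrow> bool" where
  "weyl_minus_on M S \<longleftrightarrow> lower_semi_fredholm_on M S \<and>
     (cfindim (kerM M S) \<longrightarrow> cdim (kerM M S) \<ge> ccodim M (S ` M))"

definition weyl_on :: "'a::complex_banach set \<Rightarrow> ('a \<Rightarrow> 'a) \<Rightarrow> bool" where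
  "weyl_on M S \<longleftrightarrow> fredholm_on M S \<and> cdim (kerM M S) = ccodim M (S ` M)"

definition kato_on :: "'a::complex_banach set \<Rightarrow> ('a \<Rightarrow> 'a) \<Rightarrow> bool" where
  "kato_on M S \<longleftrightarrow> closed (S ` M) \<and> (\<forall>n. kerM M S \<subseteq> (S ^^ n) ` M)"

definition riesz_on :: "'a::complex_banach set \<Rightarrow> ('a \<Rightarrow> 'a) \<Rightarrow> bool" where
  "riesz_on M S \<longleftrightarrow> (\<forall>\<mu>. \<mu> \<noteq> 0 \<longrightarrow> fredholm_on M (\<lambda>x. S x - \<mu> *\<^sub>C x))"

definition sigma_gDR_cls ::
  "('a::complex_banach set \<Rightarrow> ('a \<Rightarrow> 'a) \<Rightarrow> bool) \<Rightarrow> ('a \<Rightarrow> 'a) \<Rightarrow> complex set" where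
  "sigma_gDR_cls cls T = {\<mu>. \<not> (\<exists>M N.
      csubspace M \<and> csubspace N \<and> closed M \<and> closed N \<and>
      M \<inter> N = {0} \<and> (\<forall>x. \<exists>m\<in>M. \<exists>n\<in>N. x = m + n) \<and>
      (\<lambda>x. T x - \<mu> *\<^sub>C x) ` M \<subseteq> M \<and> (\<lambda>x. T x - \<mu> *\<^sub>C x) ` N \<subseteq> N \<and>
      cls M (\<lambda>x. T x - \<mu> *\<^sub>C x) \<and> riesz_on N (\<lambda>x. T x - \<mu> *\<^sub>C x))}"

definition sigma_gKR :: "('a::complex_banach \<Rightarrow> 'a) \<Rightarrow> complex set" where
  "sigma_gKR T = sigma_gDR_cls kato_on T"

definition sigma_gDR :: "('a::complex_banach \<Rightarrow> 'a) \<Rightarrow> complex set" where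
  "sigma_gDR T = sigma_gDR_cls invertible_on T"

definition connected_hull :: "complex set \<Rightarrow> complex set" where
  "connected_hull K = - \<Union>{C \<in> components (- K). \<not> bounded C}"

end

theory Submission
  imports Defs
begin

text \<open>
  For an operator \<open>K\<close> with closed range, each of the nine classes is a condition on the pair
  (nullity, deficiency) of \<open>K\<close>. A semi-Fredholm operator is the direct sum of a Kato operator and
  a nilpotent operator on a finite-dimensional space, which has index \<open>0\<close>; so \<open>\<lambda>\<close> lies outside the
  spectrum of a class iff \<open>T - \<lambda>\<close> is the sum of a Riesz operator and a Kato operator whose pair satisfies
  the condition of the class. The kernel and the range of a Kato operator \<open>K\<close> move continuously
  (in the gap) under \<open>K \<mapsto> K - \<nu>\<close>, so its pair is stable, and \<open>R - \<nu>\<close> is bijective for most small \<open>\<nu>\<close>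
  if \<open>R\<close> is Riesz. Hence the pair of \<open>K\<close> is the pair of \<open>T - \<nu>\<close> for generic \<open>\<nu>\<close> near \<open>\<lambda>\<close>. It does not depend
  on the decomposition and is locally constant outside \<open>\<sigma>\<^sub>g\<^sub>K\<^sub>R(T)\<close>, so the boundary of
  each of the spectra is contained in \<open>\<sigma>\<^sub>g\<^sub>K\<^sub>R(T)\<close>, which is the smallest of them. The rest is plane topology.
\<close>

subsection \<open>Subspaces\<close>

text \<open>Nothing can be read off at \<open>\<lambda>\<close> itself: the spectrum of the Riesz
  summand may accumulate there. The pair is therefore taken at generic points near each point of a
  punctured neighbourhood, a nested eventuality that mentions no decomposition and is an open
  condition on \<open>\<lambda>\<close>. Nullity and deficiency are both dimensions of quotients, of
  the kernel by \<open>{0}\<close> and of \<open>M\<close> by the range, so one stability theorem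
  under small gaps covers both. Its finite case has a threshold that decays exponentially with the
  dimension; infinite dimension needs a compactness argument with a threshold that does not depend
  on the spaces. Splitting off the nilpotent part requires a complement of a Jordan chain that is
  closed and invariant at once. A single functional, composed with powers of the operator, cuts it
  out; this is the purpose of Hahn-Banach. For a Riesz operator no contour integral is used: the
  punctured plane is connected, the generic pair is locally constant on it and vanishes far out,
  hence vanishes throughout.\<close>

global_interpretation cvs: vector_space "scaleC :: complex \<Rightarrow> 'a::complex_banach \<Rightarrow> 'a"
  by standard (simp_all add: scaleC_add_right scaleC_add_left scaleC_scaleC scaleC_one)

abbreviation lincomb :: "nat \<Rightarrow> (nat \<Rightarrow> complex) \<Rightarrow> (nat \<Rightarrow> 'a::complex_banach) \<Rightarrow> 'a" where
  "lincomb k t c \<equiv> (\<Sum>i<k. t i *\<^sub>C c i)"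

definition lspan :: "nat \<Rightarrow> (nat \<Rightarrow> 'a::complex_banach) \<Rightarrow> 'a set" where
  "lspan k c = range (\<lambda>t. lincomb k t c)"

text \<open>Linear independence in the quotient by \<open>A\<close>, for a sequence rather than a
  set: repetitions count as dependence, and initial segments give the flags \<open>lspan i c\<close>
  used for Riesz sequences.\<close>

definition cindep :: "'a::complex_banach set \<Rightarrow> nat \<Rightarrow> (nat \<Rightarrow> 'a) \<Rightarrow> bool" where
  "cindep A k c \<longleftrightarrow> (\<forall>t. lincomb k t c \<in> A \<longrightarrow> (\<forall>i<k. t i = 0))"

definition ssum :: "'a::complex_banach set \<Rightarrow> 'a set \<Rightarrow> 'a set" where
  "ssum A B = {a + b | a b. a \<in> A \<and> b \<in> B}"

definition dim_ge :: "'a::complex_banach set \<Rightarrow> 'a set \<Rightarrow> nat \<Rightarrow> bool" where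
  "dim_ge B A k \<longleftrightarrow> (\<exists>c. (\<forall>i<k. c i \<in> B) \<and> cindep A k c)"

text \<open>The dimension of \<open>(A + B) / A\<close>. Values in \<open>enat\<close> turn the
  conventions for an infinite index into order relations.\<close>

definition qdim :: "'a::complex_banach set \<Rightarrow> 'a set \<Rightarrow> enat" where
  "qdim B A = (SUP k\<in>{k. dim_ge B A k}. enat k)"

lemma csubspace_0: "csubspace M \<Longrightarrow> 0 \<in> M"
  and csubspace_add: "csubspace M \<Longrightarrow> x \<in> M \<Longrightarrow> y \<in> M \<Longrightarrow> x + y \<in> M"
  and csubspace_scale: "csubspace M \<Longrightarrow> x \<in> M \<Longrightarrow> a *\<^sub>C x \<in> M"
  by (auto simp: csubspace_def)

lemma csubspace_minus: "csubspace M \<Longrightarrow> x \<in> M \<Longrightarrow> - x \<in> M"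
  using csubspace_scale[of M x "-1"] by (simp add: cvs.scale_minus_left scaleC_one)

lemma csubspace_diff: "csubspace M \<Longrightarrow> x \<in> M \<Longrightarrow> y \<in> M \<Longrightarrow> x - y \<in> M"
  using csubspace_add[of M x "-y"] csubspace_minus[of M y] by simp

lemma csubspace_sum: "csubspace M \<Longrightarrow> (\<And>i. i \<in> I \<Longrightarrow> f i \<in> M) \<Longrightarrow> sum f I \<in> M"
  by (induction I rule: infinite_finite_induct) (auto simp: csubspace_0 csubspace_add)

lemma csubspace_lincomb: "csubspace M \<Longrightarrow> (\<And>i. i < k \<Longrightarrow> c i \<in> M) \<Longrightarrow> lincomb k t c \<in> M"
  by (intro csubspace_sum csubspace_scale) auto

lemma csubspace_zero: "csubspace {0}"
  and csubspace_UNIV: "csubspace UNIV"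
  by (auto simp: csubspace_def)

lemma csubspace_add_iff: "csubspace M \<Longrightarrow> x \<in> M \<Longrightarrow> x + y \<in> M \<longleftrightarrow> y \<in> M"
  by (metis add_diff_cancel_left' csubspace_add csubspace_diff)

lemma csubspace_ssum:
  assumes "csubspace A" "csubspace B" shows "csubspace (ssum A B)"
  unfolding csubspace_def
proof (intro conjI ballI allI)
  show "0 \<in> ssum A B" using assms csubspace_0 unfolding ssum_def by force
next
  fix x y assume "x \<in> ssum A B" "y \<in> ssum A B"
  then obtain a b a' b' where "a \<in> A" "b \<in> B" "a' \<in> A" "b' \<in> B" "x = a + b" "y = a' + b'"
    by (auto simp: ssum_def)
  then have "a + a' \<in> A" "b + b' \<in> B" "x + y = (a + a') + (b + b')"
    using assms csubspace_add by (auto simp: algebra_simps)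
  then show "x + y \<in> ssum A B" unfolding ssum_def by blast
next
  fix a x assume "x \<in> ssum A B"
  then show "a *\<^sub>C x \<in> ssum A B" using assms csubspace_scale unfolding ssum_def
    by (fastforce simp: scaleC_add_right)
qed

lemma ssumI: "a \<in> A \<Longrightarrow> b \<in> B \<Longrightarrow> a + b \<in> ssum A B"
  by (auto simp: ssum_def)

lemma ssumE: assumes "x \<in> ssum A B" obtains a b where "a \<in> A" "b \<in> B" "x = a + b"
  using assms by (auto simp: ssum_def)

lemma subset_ssum_left: "0 \<in> B \<Longrightarrow> A \<subseteq> ssum A B"
  using ssumI[of _ A 0 B] by auto

lemma subset_ssum_right: "0 \<in> A \<Longrightarrow> B \<subseteq> ssum A B"
  using ssumI[of 0 A _ B] by auto

lemma ssum_subset: "csubspace M \<Longrightarrow> A \<subseteq> M \<Longrightarrow> B \<subseteq> M \<Longrightarrow> ssum A B \<subseteq> M"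
  using csubspace_add by (fastforce simp: ssum_def)

lemma ssum_mono: "A \<subseteq> A' \<Longrightarrow> B \<subseteq> B' \<Longrightarrow> ssum A B \<subseteq> ssum A' B'"
  by (auto simp: ssum_def)

lemma ssum_commute: "ssum A B = ssum B A"
  by (auto simp: ssum_def) (metis add.commute)+

lemma ssum_assoc: "ssum (ssum A B) C = ssum A (ssum B C)"
proof (intro set_eqI iffI)
  fix x assume "x \<in> ssum (ssum A B) C"
  then show "x \<in> ssum A (ssum B C)"
    by (elim ssumE) (simp add: add.assoc ssumI)
next
  fix x assume "x \<in> ssum A (ssum B C)"
  then show "x \<in> ssum (ssum A B) C"
    by (elim ssumE) (simp add: add.assoc[symmetric] ssumI)
qed

lemma ssum_zero: "ssum A {0} = A"
  by (auto simp: ssum_def)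

lemma csubspace_lspan: "csubspace (lspan k c)"
  unfolding csubspace_def lspan_def
proof (intro conjI ballI allI; (elim imageE)?)
  show "0 \<in> range (\<lambda>t. lincomb k t c)"
    by (rule range_eqI[where x = "\<lambda>_. 0"]) simp
next
  fix x y t s assume "x = lincomb k t c" "y = lincomb k s c"
  then show "x + y \<in> range (\<lambda>t. lincomb k t c)"
    by (intro range_eqI[where x = "\<lambda>i. t i + s i"]) (simp add: scaleC_add_left sum.distrib)
next
  fix a x t assume "x = lincomb k t c"
  then show "a *\<^sub>C x \<in> range (\<lambda>t. lincomb k t c)"
    by (intro range_eqI[where x = "\<lambda>i. a * t i"]) (simp add: cvs.scale_sum_right scaleC_scaleC)
qed

lemma lspan_subset: "csubspace M \<Longrightarrow> (\<And>i. i < k \<Longrightarrow> c i \<in> M) \<Longrightarrow> lspan k c \<subseteq> M"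
  unfolding lspan_def using csubspace_lincomb by blast

lemma lincomb_in_lspan: "lincomb k t c \<in> lspan k c"
  by (simp add: lspan_def)

lemma lincomb_delta:
  assumes "i < k" shows "lincomb k (\<lambda>j. if j = i then a else 0) c = a *\<^sub>C c i"
proof -
  have "lincomb k (\<lambda>j. if j = i then a else 0) c = (\<Sum>j<k. if j = i then a *\<^sub>C c j else 0)"
    by (rule sum.cong) auto
  then show ?thesis using assms by simp
qed

lemma in_lspan: "i < k \<Longrightarrow> c i \<in> lspan k c"
  using lincomb_in_lspan[of "\<lambda>j. if j = i then 1 else 0" c k]
  by (simp add: lincomb_delta scaleC_one del: if_split)

lemma lspan_0: "lspan 0 c = {0}"
  by (auto simp: lspan_def)

lemma lspan_Suc: "lspan (Suc k) c = ssum (lspan k c) (range (\<lambda>a. a *\<^sub>C c k))"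
proof (intro set_eqI iffI)
  fix x assume "x \<in> lspan (Suc k) c"
  then show "x \<in> ssum (lspan k c) (range (\<lambda>a. a *\<^sub>C c k))"
    unfolding lspan_def ssum_def by auto
next
  fix x assume "x \<in> ssum (lspan k c) (range (\<lambda>a. a *\<^sub>C c k))"
  then obtain t a where "x = lincomb k t c + a *\<^sub>C c k"
    unfolding lspan_def ssum_def by auto
  then have "x = lincomb (Suc k) (t(k := a)) c" by simp
  then show "x \<in> lspan (Suc k) c" unfolding lspan_def by blast
qed

lemma lspan_cong: "(\<And>i. i < k \<Longrightarrow> c i = d i) \<Longrightarrow> lspan k c = lspan k d"
  unfolding lspan_def by (intro image_cong refl sum.cong) auto

subsection \<open>Relative dimension\<close>

lemma cindepD: "cindep A k c \<Longrightarrow> lincomb k t c \<in> A \<Longrightarrow> i < k \<Longrightarrow> t i = 0"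
  by (simp add: cindep_def)

lemma cindep_inj:
  assumes "csubspace A" "cindep A k c" shows "inj_on c {..<k}"
proof (rule inj_onI, rule ccontr)
  fix i j assume ij: "i \<in> {..<k}" "j \<in> {..<k}" "c i = c j" "i \<noteq> j"
  let ?t = "\<lambda>l. (if l = i then 1 else 0) - (if l = j then 1 else (0::complex))"
  have "lincomb k ?t c = c i - c j"
    using ij by (simp add: cvs.scale_left_diff_distrib sum_subtractf lincomb_delta scaleC_one del: if_split)
  then have "lincomb k ?t c \<in> A" using ij csubspace_0[OF assms(1)] by simp
  from cindepD[OF assms(2) this, of i] ij show False by simp
qed

text \<open>The exchange bound modulo \<open>A\<close>: dropping the \<open>A\<close>-components
  leaves vectors \<open>w i\<close> in the span of \<open>d\<close>. A relation among them would put
  the same combination of \<open>c\<close> into \<open>A\<close>, so they are independent.\<close>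

lemma cindep_card_le:
  assumes A: "csubspace A" and c: "cindep A k c"
    and span: "\<And>i. i < k \<Longrightarrow> c i \<in> ssum A (lspan n d)"
  shows "k \<le> n"
proof -
  have "\<exists>a s. a \<in> A \<and> c i = a + lincomb n s d" if "i < k" for i
    using span[OF that] by (auto simp: ssum_def lspan_def)
  then obtain a s where as: "\<And>i. i < k \<Longrightarrow> a i \<in> A" "\<And>i. i < k \<Longrightarrow> c i = a i + lincomb n (s i) d"
    by metis
  define w where "w i = lincomb n (s i) d" for i
  have ind: "t i = 0" if "lincomb k t w = 0" "i < k" for t i
  proof -
    have "lincomb k t c = lincomb k t a + lincomb k t w"
      using as(2) by (simp add: w_def scaleC_add_right sum.distrib)
    then have "lincomb k t c \<in> A" using that(1) as(1) csubspace_lincomb[OF A, of k a] by simp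
    then show ?thesis using c that(2) by (auto simp: cindep_def)
  qed
  have inj: "inj_on w {..<k}"
    by (rule cindep_inj[OF csubspace_zero]) (use ind in \<open>auto simp: cindep_def\<close>)
  have indep: "cvs.independent (w ` {..<k})"
  proof (rule cvs.independent_if_scalars_zero)
    fix f x assume "(\<Sum>x\<in>w ` {..<k}. f x *\<^sub>C x) = 0" "x \<in> w ` {..<k}"
    then show "f x = 0" using ind[of "f \<circ> w"] by (auto simp: sum.reindex[OF inj])
  qed simp
  have "w ` {..<k} \<subseteq> cvs.span (d ` {..<n})"
    by (auto simp: w_def intro!: cvs.span_sum intro: cvs.span_scale cvs.span_base)
  from cvs.independent_span_bound[OF _ indep this] have "card (w ` {..<k}) \<le> card (d ` {..<n})"
    by simp
  also have "\<dots> \<le> n" using card_image_le[of "{..<n}" d] by simp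
  finally show ?thesis using card_image[OF inj] by simp
qed

lemma cindep_mono: "cindep A k c \<Longrightarrow> j \<le> k \<Longrightarrow> cindep A j c"
proof -
  assume c: "cindep A k c" and jk: "j \<le> k"
  show "cindep A j c"
    unfolding cindep_def
  proof (intro allI impI)
    fix t i assume t: "lincomb j t c \<in> A" and i: "i < j"
    have "lincomb k (\<lambda>i. if i < j then t i else 0) c = lincomb j t c"
      using jk by (intro sum.mono_neutral_cong_right) auto
    with t have "lincomb k (\<lambda>i. if i < j then t i else 0) c \<in> A" by simp
    from cindepD[OF c this, of i] i jk show "t i = 0" by simp
  qed
qed

lemma cindep_Suc:
  assumes A: "csubspace A" and c: "cindep A k c" and n: "c k \<notin> ssum A (lspan k c)"
  shows "cindep A (Suc k) c"
  unfolding cindep_def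
proof (intro allI impI)
  fix t i assume t: "lincomb (Suc k) t c \<in> A" and i: "i < Suc k"
  have tk: "t k = 0"
  proof (rule ccontr)
    assume nz: "t k \<noteq> 0"
    let ?a = "lincomb (Suc k) t c"
    have "c k = (1 / t k) *\<^sub>C (?a + (- lincomb k t c))"
      using nz by (simp add: scaleC_scaleC scaleC_one)
    moreover have "?a + (- lincomb k t c) \<in> ssum A (lspan k c)"
      using t csubspace_minus[OF csubspace_lspan lincomb_in_lspan] by (rule ssumI)
    ultimately show False
      using n csubspace_scale[OF csubspace_ssum[OF A csubspace_lspan], of _ k c "1 / t k"] by metis
  qed
  then have "lincomb k t c \<in> A" using t by simp
  with c tk i show "t i = 0" by (auto simp: cindep_def less_Suc_eq)
qed

lemma dim_ge_mono: "dim_ge B A k \<Longrightarrow> j \<le> k \<Longrightarrow> dim_ge B A j"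
  unfolding dim_ge_def by (meson cindep_mono order_less_le_trans)

lemma dim_ge_0: "dim_ge B A 0"
  by (simp add: dim_ge_def cindep_def)

lemma dim_ge_iff: "dim_ge B A k \<longleftrightarrow> enat k \<le> qdim B A"
proof
  assume "dim_ge B A k"
  then show "enat k \<le> qdim B A" unfolding qdim_def by (intro SUP_upper) simp
next
  assume le: "enat k \<le> qdim B A"
  show "dim_ge B A k"
  proof (rule ccontr)
    assume n: "\<not> dim_ge B A k"
    have "j \<le> k - 1" if "dim_ge B A j" for j
      using n that dim_ge_mono[OF that, of k] by linarith
    then have "qdim B A \<le> enat (k - 1)" unfolding qdim_def by (intro SUP_least) simp
    with le have "k \<le> k - 1" by (metis enat_ord_simps(1) order_trans)
    then show False using n dim_ge_0 by (cases k) auto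
  qed
qed

lemma enat_le_eqI: "(\<And>k. enat k \<le> a \<longleftrightarrow> enat k \<le> b) \<Longrightarrow> a = b"
proof (rule antisym)
  assume *: "\<And>k. enat k \<le> a \<longleftrightarrow> enat k \<le> b"
  have **: "x \<le> y" if "\<And>k. enat k \<le> x \<Longrightarrow> enat k \<le> y" for x y
  proof (cases x)
    case infinity
    then have "\<And>k. enat k \<le> y" using that by simp
    then have "y = \<infinity>" by (metis enat.exhaust enat_ord_simps(1) not_less_eq_eq order_refl)
    then show ?thesis by simp
  qed (use that in auto)
  show "a \<le> b" "b \<le> a" using * by (auto intro: **)
qed

lemma qdim_eqI: "(\<And>k. dim_ge B A k \<longleftrightarrow> dim_ge B' A' k) \<Longrightarrow> qdim B A = qdim B' A'"
  by (rule enat_le_eqI) (simp add: dim_ge_iff[symmetric])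

lemma qdim_le:
  assumes "csubspace A" "B \<subseteq> ssum A (lspan n d)" shows "qdim B A \<le> enat n"
  unfolding qdim_def
  by (rule SUP_least) (use assms in \<open>auto simp: dim_ge_def intro: cindep_card_le\<close>)

text \<open>A vector of \<open>B\<close> outside the sum would extend \<open>c\<close> to
  \<open>n + 1\<close> independent vectors, by \<open>cindep_Suc\<close>.\<close>

lemma cindep_spans:
  assumes "csubspace A" "csubspace B" "A \<subseteq> B" "qdim B A = enat n"
    and c: "\<And>i. i < n \<Longrightarrow> c i \<in> B" "cindep A n c"
  shows "B = ssum A (lspan n c)"
proof -
  have "x \<in> ssum A (lspan n c)" if x: "x \<in> B" for x
  proof (rule ccontr)
    assume n: "x \<notin> ssum A (lspan n c)"
    let ?c = "c(n := x)"
    have "lspan n ?c = lspan n c" by (rule lspan_cong) simp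
    moreover have "cindep A n ?c" using c(2) unfolding cindep_def by simp
    ultimately have "cindep A (Suc n) ?c" using n by (intro cindep_Suc assms) simp_all
    then have "dim_ge B A (Suc n)" unfolding dim_ge_def using c x
      by (intro exI[of _ ?c]) (auto simp: less_Suc_eq)
    then show False using assms(4) by (simp add: dim_ge_iff)
  qed
  moreover have "ssum A (lspan n c) \<subseteq> B"
    using assms c by (intro ssum_subset lspan_subset) auto
  ultimately show ?thesis by blast
qed

lemma qdim_eq_basis:
  assumes "csubspace A" "csubspace B" "A \<subseteq> B" "qdim B A = enat n"
  obtains c where "\<And>i. i < n \<Longrightarrow> c i \<in> B" "cindep A n c" "B = ssum A (lspan n c)"
proof -
  obtain c where "\<forall>i<n. c i \<in> B" "cindep A n c"
    using assms(4) dim_ge_iff[of B A n] by (auto simp: dim_ge_def)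
  with cindep_spans[OF assms, of c] that show ?thesis by blast
qed

lemma qdim_eq_of_basis:
  assumes "csubspace A" "cindep A n c" "B = ssum A (lspan n c)"
  shows "qdim B A = enat n"
proof (rule antisym)
  show "qdim B A \<le> enat n" using assms by (intro qdim_le) auto
  have "c i \<in> B" if "i < n" for i
    using subset_ssum_right[of A "lspan n c"] in_lspan[OF that] csubspace_0[OF assms(1)] assms(3) by blast
  then have "dim_ge B A n" using assms(2) by (auto simp: dim_ge_def)
  then show "enat n \<le> qdim B A" by (simp add: dim_ge_iff)
qed

lemma qdim_eq_0_iff:
  assumes "csubspace A" shows "qdim B A = 0 \<longleftrightarrow> B \<subseteq> A"
proof
  assume "B \<subseteq> A"
  then have "qdim B A \<le> enat 0" using assms by (intro qdim_le[where d = "\<lambda>_. 0"]) (auto simp: lspan_0 ssum_zero)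
  then show "qdim B A = 0" by (simp add: zero_enat_def[symmetric])
next
  assume 0: "qdim B A = 0"
  show "B \<subseteq> A"
  proof
    fix x assume x: "x \<in> B"
    show "x \<in> A"
    proof (rule ccontr)
      assume "x \<notin> A"
      then have "cindep A (Suc 0) (\<lambda>_. x)"
        using assms by (intro cindep_Suc) (auto simp: lspan_0 ssum_zero cindep_def)
      then have "dim_ge B A 1" using x by (auto simp: dim_ge_def)
      then show False using 0 by (simp add: dim_ge_iff zero_enat_def)
    qed
  qed
qed

section \<open>Linear maps, additivity of the relative dimension, rank and nullity\<close>

definition clinear_on :: "'a::complex_banach set \<Rightarrow> ('a \<Rightarrow> 'a) \<Rightarrow> bool" where
  "clinear_on M f \<longleftrightarrow> (\<forall>x\<in>M. \<forall>y\<in>M. f (x + y) = f x + f y) \<and> (\<forall>a. \<forall>x\<in>M. f (a *\<^sub>C x) = a *\<^sub>C f x)"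

lemma clinear_on_0: "csubspace M \<Longrightarrow> clinear_on M f \<Longrightarrow> f 0 = 0"
  using csubspace_0 unfolding clinear_on_def by (metis cvs.scale_zero_left)

lemma clinear_on_lincomb:
  assumes M: "csubspace M" and f: "clinear_on M f" and c: "\<And>i. i < k \<Longrightarrow> c i \<in> M"
  shows "f (lincomb k t c) = lincomb k t (\<lambda>i. f (c i))"
  using c
proof (induction k)
  case 0
  show ?case using clinear_on_0[OF M f] by simp
next
  case (Suc k)
  have "lincomb k t c \<in> M" "t k *\<^sub>C c k \<in> M"
    using Suc.prems M by (auto intro!: csubspace_lincomb csubspace_scale)
  then have "f (lincomb (Suc k) t c) = f (lincomb k t c) + f (t k *\<^sub>C c k)"
    using f by (simp add: clinear_on_def)
  also have "f (t k *\<^sub>C c k) = t k *\<^sub>C f (c k)" using f Suc.prems by (simp add: clinear_on_def)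
  finally show ?case using Suc by simp
qed

lemma clinear_on_id: "clinear_on M (\<lambda>x. x)"
  by (auto simp: clinear_on_def)

text \<open>The map from \<open>B / A\<close> to \<open>B' / A'\<close> induced by \<open>f\<close>
  is injective because \<open>A\<close> is the preimage of \<open>A'\<close> in \<open>B\<close>,
  and surjective by the last assumption. It is applied to inclusions as well as to
  operators.\<close>

lemma qdim_iso:
  assumes "csubspace B" "csubspace B'" "csubspace A'" "A' \<subseteq> B'" "clinear_on B f"
    and A: "\<And>x. x \<in> B \<Longrightarrow> f x \<in> A' \<longleftrightarrow> x \<in> A"
    and im: "f ` B \<subseteq> B'" "B' \<subseteq> ssum (f ` B) A'"
  shows "qdim B A = qdim B' A'"
proof (rule qdim_eqI)
  fix k
  show "dim_ge B A k \<longleftrightarrow> dim_ge B' A' k"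
  proof
    assume "dim_ge B A k"
    then obtain c where c: "\<And>i. i < k \<Longrightarrow> c i \<in> B" "cindep A k c" by (auto simp: dim_ge_def)
    have "cindep A' k (\<lambda>i. f (c i))"
      unfolding cindep_def
    proof (intro allI impI)
      fix t i assume "lincomb k t (\<lambda>i. f (c i)) \<in> A'" "i < k"
      then have "f (lincomb k t c) \<in> A'" using clinear_on_lincomb[OF assms(1,5), of k c t] c by simp
      then have "lincomb k t c \<in> A" using A csubspace_lincomb[OF assms(1), of k c t] c by blast
      then show "t i = 0" using c(2) \<open>i < k\<close> by (simp add: cindep_def)
    qed
    then show "dim_ge B' A' k" using c im(1) unfolding dim_ge_def by (intro exI[of _ "\<lambda>i. f (c i)"]) auto
  next
    assume "dim_ge B' A' k"
    then obtain c where c: "\<And>i. i < k \<Longrightarrow> c i \<in> B'" "cindep A' k c" by (auto simp: dim_ge_def)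
    have "\<exists>b a. b \<in> B \<and> a \<in> A' \<and> c i = f b + a" if "i < k" for i
      using c(1)[OF that] im(2) by (fastforce simp: ssum_def)
    then obtain b a where ba: "\<And>i. i < k \<Longrightarrow> b i \<in> B" "\<And>i. i < k \<Longrightarrow> a i \<in> A'"
        "\<And>i. i < k \<Longrightarrow> c i = f (b i) + a i" by metis
    have "cindep A k b"
      unfolding cindep_def
    proof (intro allI impI)
      fix t i assume t: "lincomb k t b \<in> A" and i: "i < k"
      have "lincomb k t c = f (lincomb k t b) + lincomb k t a"
        using clinear_on_lincomb[OF assms(1,5), of k b t] ba by (simp add: scaleC_add_right sum.distrib)
      moreover have "f (lincomb k t b) \<in> A'" using A csubspace_lincomb[OF assms(1), of k b t] ba t by blast
      moreover have "lincomb k t a \<in> A'" using csubspace_lincomb[OF assms(3)] ba by blast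
      ultimately have "lincomb k t c \<in> A'" using csubspace_add[OF assms(3)] by simp
      then show "t i = 0" using c(2) i by (simp add: cindep_def)
    qed
    then show "dim_ge B A k" using ba by (auto simp: dim_ge_def)
  qed
qed

lemma dim_ge_subset: "dim_ge B A k \<Longrightarrow> B \<subseteq> B' \<Longrightarrow> A' \<subseteq> A \<Longrightarrow> dim_ge B' A' k"
  unfolding dim_ge_def cindep_def by blast

lemma qdim_mono: "B \<subseteq> B' \<Longrightarrow> A' \<subseteq> A \<Longrightarrow> qdim B A \<le> qdim B' A'"
  unfolding qdim_def by (rule SUP_subset_mono) (auto intro: dim_ge_subset)

lemma lincomb_append:
  "lincomb (m + n) t (\<lambda>i. if i < m then c i else d (i - m)) = lincomb m t c + lincomb n (\<lambda>i. t (m + i)) d"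
  by (induction n) (simp_all add: add.assoc)

text \<open>In the finite case, a basis of \<open>B\<close> modulo \<open>A\<close> followed by a
  basis of \<open>C\<close> modulo \<open>B\<close> is a basis of \<open>C\<close> modulo
  \<open>A\<close>. If a summand is infinite, monotonicity suffices.\<close>

lemma qdim_tower:
  assumes "csubspace A" "csubspace B" "csubspace C" "A \<subseteq> B" "B \<subseteq> C"
  shows "qdim C A = qdim C B + qdim B A"
proof (cases "qdim C B = \<infinity> \<or> qdim B A = \<infinity>")
  case True
  moreover have "qdim C B \<le> qdim C A" "qdim B A \<le> qdim C A"
    using assms by (auto intro!: qdim_mono)
  ultimately show ?thesis by auto
next
  case False
  then obtain m n where mn: "qdim B A = enat m" "qdim C B = enat n" by auto
  obtain c where c: "\<And>i. i < m \<Longrightarrow> c i \<in> B" "cindep A m c" "B = ssum A (lspan m c)"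
    using qdim_eq_basis[OF assms(1,2,4) mn(1)] by blast
  obtain d where d: "\<And>i. i < n \<Longrightarrow> d i \<in> C" "cindep B n d" "C = ssum B (lspan n d)"
    using qdim_eq_basis[OF assms(2,3,5) mn(2)] by blast
  let ?e = "\<lambda>i. if i < m then c i else d (i - m)"
  have "cindep A (m + n) ?e"
    unfolding cindep_def
  proof (intro allI impI)
    fix t i assume t: "lincomb (m + n) t ?e \<in> A" and i: "i < m + n"
    have eq: "lincomb (m + n) t ?e = lincomb m t c + lincomb n (\<lambda>i. t (m + i)) d"
      by (rule lincomb_append)
    have "lincomb m t c \<in> B" using csubspace_lincomb[OF assms(2)] c(1) by blast
    then have "lincomb n (\<lambda>i. t (m + i)) d \<in> B"
      using t eq assms(4) csubspace_add_iff[OF assms(2)] by fastforce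
    then have *: "t (m + j) = 0" if "j < n" for j using cindepD[OF d(2), of "\<lambda>i. t (m + i)" j] that by simp
    then have "lincomb n (\<lambda>i. t (m + i)) d = 0" by simp
    then have "lincomb m t c \<in> A" using t eq by simp
    then have "t j = 0" if "j < m" for j using cindepD[OF c(2), of t j] that by simp
    with * show "t i = 0" using i by (metis add_less_cancel_left le_Suc_ex not_less)
  qed
  moreover have "lspan (m + n) ?e = ssum (lspan m c) (lspan n d)"
  proof (intro set_eqI iffI)
    fix x assume "x \<in> lspan (m + n) ?e"
    then obtain t where "x = lincomb (m + n) t ?e" unfolding lspan_def by blast
    then have "x = lincomb m t c + lincomb n (\<lambda>i. t (m + i)) d" by (simp only: lincomb_append)
    then show "x \<in> ssum (lspan m c) (lspan n d)" by (simp add: lincomb_in_lspan ssumI)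
  next
    fix x assume "x \<in> ssum (lspan m c) (lspan n d)"
    then obtain t s where x: "x = lincomb m t c + lincomb n s d" by (auto simp: ssum_def lspan_def)
    have "lincomb (m + n) (\<lambda>i. if i < m then t i else s (i - m)) ?e = x"
    proof -
      have "lincomb m (\<lambda>i. if i < m then t i else s (i - m)) c = lincomb m t c"
        by (rule sum.cong) auto
      then show ?thesis
        using lincomb_append[of "\<lambda>i. if i < m then t i else s (i - m)" m c d n] x by simp
    qed
    then show "x \<in> lspan (m + n) ?e" by (metis lincomb_in_lspan)
  qed
  then have "C = ssum A (lspan (m + n) ?e)" using c(3) d(3) by (simp add: ssum_assoc)
  ultimately have "qdim C A = enat (m + n)" by (intro qdim_eq_of_basis assms)
  then show ?thesis using mn by (simp add: add.commute)
qed

text \<open>The chain through \<open>ssum A B'\<close> splits the dimension in two. Since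
  \<open>A\<close> meets \<open>B\<close> only in \<open>0\<close>, the inclusions of
  \<open>B\<close> and of \<open>A\<close> induce isomorphisms onto the two quotients.\<close>

lemma qdim_ssum:
  assumes sub: "csubspace A" "csubspace B" "csubspace A'" "csubspace B'"
    and le: "A' \<subseteq> A" "B' \<subseteq> B" and int: "A \<inter> B = {0}"
  shows "qdim (ssum A B) (ssum A' B') = qdim A A' + qdim B B'"
proof -
  have "qdim (ssum A B) (ssum A' B') = qdim (ssum A B) (ssum A B') + qdim (ssum A B') (ssum A' B')"
    using assms by (intro qdim_tower csubspace_ssum ssum_mono) auto
  moreover have "qdim B B' = qdim (ssum A B) (ssum A B')"
  proof (rule qdim_iso[where f = "\<lambda>x. x"])
    fix x assume x: "x \<in> B"
    show "x \<in> ssum A B' \<longleftrightarrow> x \<in> B'"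
    proof
      assume "x \<in> ssum A B'"
      then obtain a b where ab: "a \<in> A" "b \<in> B'" "x = a + b" by (rule ssumE)
      then have "a = x - b" by simp
      then have "a \<in> B" using x ab le csubspace_diff[OF sub(2)] by blast
      then have "a = 0" using ab int by blast
      then show "x \<in> B'" using ab by simp
    next
      assume "x \<in> B'"
      then show "x \<in> ssum A B'" using subset_ssum_right csubspace_0[OF sub(1)] by blast
    qed
  next
    show "ssum A B \<subseteq> ssum ((\<lambda>x. x) ` B) (ssum A B')"
      using ssum_mono[OF order_refl subset_ssum_left[OF csubspace_0[OF sub(4)]], of B A]
      by (simp add: ssum_commute)
  next
    show "csubspace (ssum A B)" "csubspace (ssum A B')" "ssum A B' \<subseteq> ssum A B"
      using assms by (simp_all add: csubspace_ssum ssum_mono)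
    show "(\<lambda>x. x) ` B \<subseteq> ssum A B" using subset_ssum_right[OF csubspace_0[OF sub(1)]] by simp
  qed (use assms clinear_on_id in auto)
  moreover have "qdim A A' = qdim (ssum A B') (ssum A' B')"
  proof (rule qdim_iso[where f = "\<lambda>x. x"])
    fix x assume x: "x \<in> A"
    show "x \<in> ssum A' B' \<longleftrightarrow> x \<in> A'"
    proof
      assume "x \<in> ssum A' B'"
      then obtain a b where ab: "a \<in> A'" "b \<in> B'" "x = a + b" by (rule ssumE)
      then have "b = x - a" by simp
      then have "b \<in> A" using x ab le csubspace_diff[OF sub(1)] by blast
      then have "b = 0" using ab int le by blast
      then show "x \<in> A'" using ab by simp
    next
      assume "x \<in> A'"
      then show "x \<in> ssum A' B'" using subset_ssum_left csubspace_0[OF sub(4)] by blast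
    qed
  next
    show "ssum A B' \<subseteq> ssum ((\<lambda>x. x) ` A) (ssum A' B')"
      using ssum_mono[OF order_refl subset_ssum_right[OF csubspace_0[OF sub(3)]], of A B'] by simp
  next
    show "csubspace (ssum A B')" "csubspace (ssum A' B')" "ssum A' B' \<subseteq> ssum A B'"
      using assms by (simp_all add: csubspace_ssum ssum_mono)
    show "(\<lambda>x. x) ` A \<subseteq> ssum A B'" using subset_ssum_left[OF csubspace_0[OF sub(4)]] by simp
  qed (use assms clinear_on_id in auto)
  ultimately show ?thesis by (simp add: add.commute)
qed

lemma csubspace_image:
  assumes "csubspace M" "clinear_on M f" shows "csubspace (f ` M)"
  unfolding csubspace_def
proof (intro conjI ballI allI; (elim imageE)?)
  show "0 \<in> f ` M" using clinear_on_0[OF assms] csubspace_0[OF assms(1)] by force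
next
  fix x y u v assume "x = f u" "y = f v" "u \<in> M" "v \<in> M"
  then show "x + y \<in> f ` M" using assms csubspace_add[OF assms(1)] by (auto simp: clinear_on_def intro!: image_eqI[of _ _ "u + v"])
next
  fix a x u assume "x = f u" "u \<in> M"
  then show "a *\<^sub>C x \<in> f ` M" using assms csubspace_scale[OF assms(1)] by (auto simp: clinear_on_def intro!: image_eqI[of _ _ "a *\<^sub>C u"])
qed

lemma csubspace_ker:
  assumes "csubspace M" "clinear_on M f" shows "csubspace (kerM M f)"
  using assms clinear_on_0[OF assms] unfolding csubspace_def kerM_def clinear_on_def by auto

lemma rank_nullity:
  assumes F: "csubspace F" "clinear_on F f" "f ` F \<subseteq> F" and fin: "qdim F {0} \<noteq> \<infinity>"
  shows "qdim (kerM F f) {0} = qdim F (f ` F)"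
proof -
  have im: "csubspace (f ` F)" and ker: "csubspace (kerM F f)"
    using F by (auto intro: csubspace_image csubspace_ker)
  have 1: "qdim F {0} = qdim F (kerM F f) + qdim (kerM F f) {0}"
    using F ker by (intro qdim_tower csubspace_zero) (auto simp: kerM_def csubspace_0 clinear_on_0)
  have 2: "qdim F {0} = qdim F (f ` F) + qdim (f ` F) {0}"
    using F im by (intro qdim_tower csubspace_zero) (auto intro: csubspace_0)
  have 3: "qdim F (kerM F f) = qdim (f ` F) {0}"
    using F im by (intro qdim_iso[where f = f]) (auto simp: kerM_def csubspace_0 csubspace_zero ssum_zero)

  \<comment> \<open>Cancelling the common rank requires finite dimension: in \<open>enat\<close>,
    equality of \<open>\<infinity> + a\<close> and \<open>\<infinity> + c\<close> says
    nothing.\<close>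
  have *: "a = c" if "p = b + a" "p = c + d" "b = d" "p \<noteq> \<infinity>" for a b c d p :: enat
    using that by (cases a; cases b; cases c) auto
  from *[OF 1 2 3 fin] show ?thesis .
qed

text \<open>Preimages of vectors independent modulo the image of \<open>A\<close> are independent
  modulo \<open>A\<close>. This will bound the codimension lost from one power of an operator to the
  next.\<close>

lemma qdim_image_le:
  assumes B: "csubspace B" and f: "clinear_on B f" and AB: "A \<subseteq> B"
  shows "qdim (f ` B) (f ` A) \<le> qdim B A"
  unfolding qdim_def
proof (rule SUP_subset_mono)
  show "{k. dim_ge (f ` B) (f ` A) k} \<subseteq> {k. dim_ge B A k}"
  proof safe
    fix k assume "dim_ge (f ` B) (f ` A) k"
    then obtain c where c: "\<And>i. i < k \<Longrightarrow> c i \<in> f ` B" "cindep (f ` A) k c" by (auto simp: dim_ge_def)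
    then obtain b where b: "\<And>i. i < k \<Longrightarrow> b i \<in> B" "\<And>i. i < k \<Longrightarrow> c i = f (b i)"
      unfolding image_iff by metis
    have "cindep A k b"
      unfolding cindep_def
    proof (intro allI impI)
      fix t i assume "lincomb k t b \<in> A" and i: "i < k"
      then have "f (lincomb k t b) \<in> f ` A" by blast
      then have "lincomb k t c \<in> f ` A" using clinear_on_lincomb[OF B f, of k b t] b by simp
      then show "t i = 0" using c i by (simp add: cindep_def)
    qed
    then show "dim_ge B A k" using b by (auto simp: dim_ge_def)
  qed
qed simp

subsection \<open>Comparison with the absolute notions of dimension and codimension\<close>

lemma cspan_lspan:
  assumes "finite B" shows "\<exists>d. cspan B = lspan (card B) d"
proof -
  obtain d where d: "bij_betw d {..<card B} B"
    using ex_bij_betw_nat_finite[OF assms] atLeast0LessThan by metis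
  have "cspan B = lspan (card B) d"
  proof (intro set_eqI iffI)
    fix x assume "x \<in> cspan B"
    then obtain t c where t: "finite t" "t \<subseteq> B" "x = (\<Sum>b\<in>t. c b *\<^sub>C b)" by (auto simp: cspan_def)
    have "x = (\<Sum>b\<in>B. (if b \<in> t then c b else 0) *\<^sub>C b)"
      unfolding t(3) using t assms by (intro sum.mono_neutral_cong_left) auto
    also have "\<dots> = lincomb (card B) (\<lambda>i. if d i \<in> t then c (d i) else 0) d"
      by (rule sum.reindex_bij_betw[OF d, symmetric])
    finally show "x \<in> lspan (card B) d" by (simp add: lincomb_in_lspan)
  next
    fix x assume "x \<in> lspan (card B) d"
    then obtain t where x: "x = lincomb (card B) t d" by (auto simp: lspan_def)
    have "x = lincomb (card B) (\<lambda>i. t (inv_into {..<card B} d (d i))) d"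
      unfolding x using d by (intro sum.cong) (auto simp: bij_betw_def)
    also have "\<dots> = (\<Sum>b\<in>B. t (inv_into {..<card B} d b) *\<^sub>C b)"
      by (rule sum.reindex_bij_betw[OF d])
    finally show "x \<in> cspan B" using assms by (auto simp: cspan_def)
  qed
  then show "\<exists>d. cspan B = lspan (card B) d" by blast
qed

lemma lspan_subset_cspan: "lspan n c \<subseteq> cspan (c ` {..<n})" if "inj_on c {..<n}"
proof
  fix x assume "x \<in> lspan n c"
  then obtain t where x: "x = lincomb n t c" by (auto simp: lspan_def)
  have "x = (\<Sum>b\<in>c ` {..<n}. t (inv_into {..<n} c b) *\<^sub>C b)"
    unfolding x using that by (simp add: sum.reindex)
  then show "x \<in> cspan (c ` {..<n})" by (auto simp: cspan_def)
qed

lemma qdim_le_card: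
  assumes "finite B" "V \<subseteq> cspan B" shows "qdim V {0} \<le> enat (card B)"
proof -
  obtain d where d: "cspan B = lspan (card B) d" using cspan_lspan[OF assms(1)] by blast
  then show ?thesis
    using assms qdim_le[OF csubspace_zero, of V "card B" d] by (simp add: ssum_commute[of "{0}"] ssum_zero)
qed

lemma qdim_zero_basis:
  assumes "csubspace V" "qdim V {0} = enat n"
  obtains B where "finite B" "B \<subseteq> V" "card B = n" "V \<subseteq> cspan B"
proof -
  obtain c where c: "\<And>i. i < n \<Longrightarrow> c i \<in> V" "cindep {0} n c" "V = ssum {0} (lspan n c)"
    using qdim_eq_basis[OF csubspace_zero assms(1) _ assms(2)] csubspace_0[OF assms(1)] by blast
  have inj: "inj_on c {..<n}" by (rule cindep_inj[OF csubspace_zero c(2)])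
  have "V \<subseteq> cspan (c ` {..<n})"
    using c(3) lspan_subset_cspan[OF inj] by (simp add: ssum_commute[of "{0}"] ssum_zero)
  moreover have "card (c ` {..<n}) = n" using card_image[OF inj] by simp
  ultimately show ?thesis using c(1) by (intro that[of "c ` {..<n}"]) auto
qed

lemma cfindim_iff: assumes "csubspace V" shows "cfindim V \<longleftrightarrow> qdim V {0} \<noteq> \<infinity>"
proof
  assume "cfindim V"
  then obtain B where "finite B" "V \<subseteq> cspan B" by (auto simp: cfindim_def)
  from qdim_le_card[OF this] show "qdim V {0} \<noteq> \<infinity>" by (cases "qdim V {0}") simp_all
next
  assume "qdim V {0} \<noteq> \<infinity>"
  then show "cfindim V" unfolding cfindim_def using qdim_zero_basis[OF assms] by (metis enat.exhaust)
qed

lemma cdim_eq: assumes "csubspace V" "qdim V {0} = enat n" shows "cdim V = n"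
  unfolding cdim_def
proof (rule Least_equality)
  show "\<exists>B\<subseteq>V. finite B \<and> card B = n \<and> V \<subseteq> cspan B" using qdim_zero_basis[OF assms] by metis
next
  fix m assume "\<exists>B\<subseteq>V. finite B \<and> card B = m \<and> V \<subseteq> cspan B"
  then have "qdim V {0} \<le> enat m" using qdim_le_card by blast
  then show "n \<le> m" using assms by simp
qed

text \<open>The inclusion of a complement induces an isomorphism onto the quotient. So for finite
  codimension all complements have the same dimension, and the \<open>LEAST\<close> in
  \<open>ccodim\<close> ranges over a single value.\<close>

lemma ccomplement_qdim:
  assumes "csubspace M" "csubspace R" "R \<subseteq> M" "ccomplement M R C"
  shows "qdim C {0} = qdim M R"
proof (rule qdim_iso[where f = "\<lambda>x. x"])
  show "csubspace C" "(\<lambda>x. x) ` C \<subseteq> M" using assms by (auto simp: ccomplement_def)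
  show "M \<subseteq> ssum ((\<lambda>x. x) ` C) R" using assms unfolding ccomplement_def ssum_def by (fastforce simp: add.commute)
  show "x \<in> R \<longleftrightarrow> x \<in> {0}" if "x \<in> C" for x
    using assms that csubspace_0[OF assms(2)] by (auto simp: ccomplement_def)
qed (use assms clinear_on_id in auto)

lemma ex_ccomplement:
  assumes "csubspace M" "csubspace R" "R \<subseteq> M" "qdim M R \<noteq> \<infinity>"
  shows "\<exists>C. ccomplement M R C"
proof -
  obtain n where n: "qdim M R = enat n" using assms by auto
  obtain c where c: "\<And>i. i < n \<Longrightarrow> c i \<in> M" "cindep R n c" "M = ssum R (lspan n c)"
    using qdim_eq_basis[OF assms(2,1,3) n] by blast
  have "x = 0" if x: "x \<in> lspan n c" "x \<in> R" for x
  proof -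
    obtain t where t: "x = lincomb n t c" using x by (auto simp: lspan_def)
    then have "\<And>i. i < n \<Longrightarrow> t i = 0" using x c by (simp add: cindep_def)
    then show ?thesis using t by simp
  qed
  moreover have "lspan n c \<subseteq> M" using lspan_subset[OF assms(1) c(1)] .
  moreover have "\<forall>x\<in>M. \<exists>r\<in>R. \<exists>d\<in>lspan n c. x = r + d" using c(3) by (auto simp: ssum_def)
  ultimately have "ccomplement M R (lspan n c)"
    using csubspace_lspan csubspace_0[OF assms(2)] csubspace_0[OF csubspace_lspan]
    unfolding ccomplement_def by blast
  then show ?thesis ..
qed

lemma cfincodim_iff:
  assumes "csubspace M" "csubspace R" "R \<subseteq> M"
  shows "cfincodim M R \<longleftrightarrow> qdim M R \<noteq> \<infinity>"
  using ex_ccomplement[OF assms] ccomplement_qdim[OF assms] cfindim_iff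
  unfolding cfincodim_def by (metis ccomplement_def)

lemma ccodim_eq:
  assumes "csubspace M" "csubspace R" "R \<subseteq> M" "qdim M R = enat n"
  shows "ccodim M R = n"
proof -
  have *: "cfindim C \<and> cdim C = n" if "ccomplement M R C" for C
    using that ccomplement_qdim[OF assms(1-3) that] assms(4) cfindim_iff[of C] cdim_eq[of C n]
    by (auto simp: ccomplement_def)
  obtain C where C: "ccomplement M R C" using ex_ccomplement[OF assms(1-3)] assms(4) by auto
  show ?thesis unfolding ccodim_def
    by (rule Least_equality) (use * C in blast)+
qed

subsection \<open>Closed subspaces and the gap between them\<close>

lemma bounded_linear_scaleC_left: "bounded_linear (\<lambda>a. a *\<^sub>C (x :: 'a::complex_banach))"
proof (rule bounded_linear_intro[where K = "norm x"])
  show "(r *\<^sub>R a) *\<^sub>C x = r *\<^sub>R (a *\<^sub>C x)" for r a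
    by (subst scaleR_conv_of_real) (simp add: scaleR_scaleC scaleC_scaleC)
qed (simp_all add: scaleC_add_left norm_scaleC)

lemma bounded_linear_scaleC_right: "bounded_linear (\<lambda>x :: 'a::complex_banach. a *\<^sub>C x)"
proof (rule bounded_linear_intro[where K = "cmod a"])
  show "a *\<^sub>C (r *\<^sub>R x) = r *\<^sub>R (a *\<^sub>C x)" for r and x :: 'a
    by (simp add: scaleR_scaleC scaleC_scaleC mult.commute)
qed (simp_all add: scaleC_add_right norm_scaleC mult.commute)

text \<open>The bound makes the projection onto \<open>A\<close> along \<open>B\<close> continuous,
  so the two components of a convergent sequence converge separately. The factor
  \<open>\<bar>K\<bar> + 1\<close> spares a sign condition on \<open>K\<close>.\<close>

lemma closed_ssum_of_bound:
  fixes A B :: "'a::complex_banach set"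
  assumes A: "csubspace A" "closed A" and B: "csubspace B" "closed B"
    and K: "\<And>a b. a \<in> A \<Longrightarrow> b \<in> B \<Longrightarrow> norm a \<le> K * norm (a + b)"
  shows "closed (ssum A B)"
  unfolding closed_sequential_limits
proof (intro allI impI, elim conjE)
  fix y l assume y: "\<forall>n. y n \<in> ssum A B" and l: "y \<longlonglongrightarrow> l"
  have "\<exists>a b. a \<in> A \<and> b \<in> B \<and> y n = a + b" for n using y[rule_format, of n] by (auto simp: ssum_def)
  then obtain a b where ab: "\<And>n. a n \<in> A" "\<And>n. b n \<in> B" "\<And>n. y n = a n + b n" by metis
  have diff: "norm (a m - a n) \<le> (\<bar>K\<bar> + 1) * norm (y m - y n)" for m n
  proof -
    have "norm (a m - a n) \<le> K * norm ((a m - a n) + (b m - b n))"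
      using A(1) B(1) ab by (intro K csubspace_diff)
    also have "(a m - a n) + (b m - b n) = y m - y n" by (simp add: ab(3))
    also have "K * norm (y m - y n) \<le> (\<bar>K\<bar> + 1) * norm (y m - y n)" by (intro mult_right_mono) auto
    finally show ?thesis .
  qed
  have "Cauchy a"
  proof (rule metric_CauchyI)
    fix e :: real assume "e > 0"
    then have "e / (\<bar>K\<bar> + 1) > 0" by simp
    then obtain M where M: "\<And>m n. m \<ge> M \<Longrightarrow> n \<ge> M \<Longrightarrow> dist (y m) (y n) < e / (\<bar>K\<bar> + 1)"
      using LIMSEQ_imp_Cauchy[OF l] metric_CauchyD by metis
    have "dist (a m) (a n) < e" if "m \<ge> M" "n \<ge> M" for m n
    proof -
      have "(\<bar>K\<bar> + 1) * norm (y m - y n) < e" using M[OF that] by (simp add: dist_norm field_simps)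
      then show ?thesis using diff[of m n] by (simp add: dist_norm)
    qed
    then show "\<exists>M. \<forall>m\<ge>M. \<forall>n\<ge>M. dist (a m) (a n) < e" by blast
  qed
  then obtain s where s: "a \<longlonglongrightarrow> s" using Cauchy_convergent convergent_def by blast
  then have "(\<lambda>n. y n - a n) \<longlonglongrightarrow> l - s" using l by (intro tendsto_diff)
  then have "b \<longlonglongrightarrow> l - s" by (simp add: ab(3))
  then have "s \<in> A" "l - s \<in> B" using s A(2) B(2) ab closed_sequentially by blast+
  then have "s + (l - s) \<in> ssum A B" by (rule ssumI)
  then show "l \<in> ssum A B" by simp
qed

text \<open>For \<open>x\<close> outside \<open>A\<close>, the distance \<open>d\<close> from
  \<open>x\<close> to \<open>A\<close> is positive and controls the coefficient of \<open>x\<close>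
  in a sum; this yields the bound that \<open>closed_ssum_of_bound\<close> asks for.\<close>

lemma closed_ssum_line:
  assumes A: "csubspace A" and cl: "closed A"
  shows "closed (ssum A (range (\<lambda>a. a *\<^sub>C x)))"
proof (cases "x \<in> A")
  case True
  have "ssum A (range (\<lambda>a. a *\<^sub>C x)) = A"
  proof
    show "ssum A (range (\<lambda>a. a *\<^sub>C x)) \<subseteq> A" using True A by (intro ssum_subset) (auto intro: csubspace_scale)
    show "A \<subseteq> ssum A (range (\<lambda>a. a *\<^sub>C x))"
      by (rule subset_ssum_left) (metis cvs.scale_zero_left rangeI)
  qed
  then show ?thesis using cl by simp
next
  case False
  define d where "d = infdist x A"
  have d: "d > 0" unfolding d_def using infdist_pos_not_in_closed[OF cl _ False] csubspace_0[OF A] by blast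
  have bound: "cmod t * d \<le> norm (a + t *\<^sub>C x)" if a: "a \<in> A" for a t
  proof (cases "t = 0")
    case False
    have "a + t *\<^sub>C x = t *\<^sub>C (x - (-(1 / t)) *\<^sub>C a)"
      using False by (simp add: scaleC_add_right scaleC_scaleC scaleC_one cvs.scale_minus_left add.commute)
    then have "norm (a + t *\<^sub>C x) = cmod t * dist x ((-(1 / t)) *\<^sub>C a)"
      by (simp only: norm_scaleC dist_norm)
    moreover have "d \<le> dist x ((-(1 / t)) *\<^sub>C a)"
      unfolding d_def by (intro infdist_le csubspace_scale A a)
    ultimately show ?thesis by (simp add: mult_left_mono)
  qed simp
  let ?L = "range (\<lambda>a. a *\<^sub>C x)"
  have x: "norm x > 0" using False csubspace_0[OF A] by auto
  have L: "csubspace ?L"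
    using csubspace_lspan[of 1 "\<lambda>_. x"] lspan_Suc[of 0 "\<lambda>_. x"] by (simp add: lspan_0 ssum_commute[of "{0}"] ssum_zero)
  have "complete ?L"
  proof (rule complete_isometric_image[OF x _ bounded_linear_scaleC_left])
    show "subspace (UNIV :: complex set)" by simp
  qed (auto simp: norm_scaleC complete_UNIV)
  then have "closed ?L" by (simp add: complete_eq_closed)
  then show ?thesis
  proof (rule closed_ssum_of_bound[OF A cl L])
    fix a b assume a: "a \<in> A" and "b \<in> ?L"
    then obtain t where b: "b = t *\<^sub>C x" by blast
    have "norm a \<le> norm (a + b) + cmod t * norm x"
      using norm_triangle_ineq4[of "a + b" b] by (simp add: b norm_scaleC)
    also have "cmod t * norm x \<le> norm (a + b) / d * norm x"
      using bound[OF a, of t] d by (intro mult_right_mono) (simp_all add: b field_simps)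
    finally show "norm a \<le> (1 + norm x / d) * norm (a + b)" by (simp add: algebra_simps)
  qed
qed

lemma closed_ssum_lspan:
  assumes "csubspace A" "closed A" shows "closed (ssum A (lspan k c))"
proof (induction k)
  case 0
  then show ?case using assms by (simp add: lspan_0 ssum_zero)
next
  case (Suc k)
  then show ?case using closed_ssum_line[OF csubspace_ssum[OF assms(1) csubspace_lspan] Suc, of "c k"]
    by (simp add: lspan_Suc ssum_assoc)
qed

lemma closed_superspace_qdim_finite:
  assumes "csubspace A" "csubspace B" "A \<subseteq> B" "closed A" "qdim B A \<noteq> \<infinity>"
  shows "closed B"
proof -
  obtain n where "qdim B A = enat n" using assms(5) by auto
  then obtain c where "B = ssum A (lspan n c)" using qdim_eq_basis assms by metis
  then show ?thesis using closed_ssum_lspan assms by metis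
qed

lemma qdim_finite_lspan:
  assumes "csubspace F" "qdim F {0} \<noteq> \<infinity>"
  obtains n c where "F = lspan n c"
proof -
  obtain n where "qdim F {0} = enat n" using assms(2) by auto
  then obtain c where "F = ssum {0} (lspan n c)"
    using qdim_eq_basis[OF csubspace_zero assms(1)] csubspace_0[OF assms(1)] by blast
  then show ?thesis using that by (simp add: ssum_commute[of "{0}"] ssum_zero)
qed

lemma closed_qdim_finite:
  assumes "csubspace F" "qdim F {0} \<noteq> \<infinity>" shows "closed F"
  using closed_superspace_qdim_finite[OF csubspace_zero assms(1) _ _ assms(2)] csubspace_0[OF assms(1)] by auto

lemma closed_ssum_qdim_finite:
  assumes "csubspace A" "closed A" "csubspace F" "qdim F {0} \<noteq> \<infinity>" shows "closed (ssum A F)"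
  using qdim_finite_lspan[OF assms(3,4)] closed_ssum_lspan[OF assms(1,2)] by metis

section \<open>Riesz sequences: quantitative independence modulo a closed subspace\<close>

lemma Riesz_lemma:
  assumes W: "csubspace W" "closed W" and B: "csubspace B" "W \<subseteq> B" and x: "x \<in> B" "x \<notin> W"
  obtains e where "e \<in> B" "norm e = 1" "\<And>w. w \<in> W \<Longrightarrow> 1/2 \<le> norm (e - w)"
proof -
  define d where "d = infdist x W"
  have ne: "W \<noteq> {}" using csubspace_0[OF W(1)] by blast
  have d: "d > 0" unfolding d_def using infdist_pos_not_in_closed[OF W(2) ne x(2)] .
  \<comment> \<open>Near-best approximation up to the factor 2, which becomes the constant
    \<open>1/2\<close> of the conclusion.\<close>
  have "\<exists>w\<in>W. dist x w < 2 * d"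
  proof (rule ccontr)
    assume "\<not> ?thesis"
    then have "2 * d \<le> infdist x W"
      unfolding infdist_def using ne by (auto intro!: cINF_greatest simp: not_less)
    then show False using d by (simp add: d_def)
  qed
  then obtain w where w: "w \<in> W" "norm (x - w) < 2 * d" by (auto simp: dist_norm)
  define r where "r = norm (x - w)"
  have r: "r > 0" unfolding r_def using w x by auto
  define e where "e = complex_of_real (1 / r) *\<^sub>C (x - w)"
  show ?thesis
  proof (rule that)
    show "e \<in> B" unfolding e_def using x w B by (auto intro!: csubspace_scale csubspace_diff)
    show "norm e = 1" using r by (simp add: e_def norm_scaleC r_def norm_divide)
    fix v assume v: "v \<in> W"
    have "e - v = complex_of_real (1 / r) *\<^sub>C (x - (w + complex_of_real r *\<^sub>C v))"
      using r by (simp add: e_def cvs.scale_right_diff_distrib scaleC_add_right scaleC_scaleC scaleC_one)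
    then have "norm (e - v) = (1 / r) * dist x (w + complex_of_real r *\<^sub>C v)"
      using r by (simp only: norm_scaleC dist_norm norm_of_real) simp
    moreover have "d \<le> dist x (w + complex_of_real r *\<^sub>C v)"
      unfolding d_def by (intro infdist_le csubspace_add csubspace_scale W w v)
    moreover have "1/2 \<le> (1 / r) * d" using w(2) r by (simp add: r_def[symmetric] field_simps)
    ultimately show "1/2 \<le> norm (e - v)" using r
      by (smt (verit, best) mult_left_mono zero_less_divide_1_iff)
  qed
qed

text \<open>Independence alone gives no estimate. Iterating \<open>Riesz_lemma\<close> yields unit
  vectors, each at distance at least \<open>1/2\<close> from \<open>A\<close> plus the span of its
  predecessors, and such a sequence survives small perturbations of \<open>A\<close> and
  \<open>B\<close>.\<close>

lemma Riesz_sequence: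
  assumes A: "csubspace A" "closed A" and B: "csubspace B" "A \<subseteq> B"
  shows "dim_ge B A k \<Longrightarrow>
    \<exists>e. \<forall>i<k. e i \<in> B \<and> norm (e i) = 1 \<and> (\<forall>w\<in>ssum A (lspan i e). 1/2 \<le> norm (e i - w))"
proof (induction k)
  case (Suc k)
  then obtain e where e: "\<And>i. i < k \<Longrightarrow> e i \<in> B" "\<And>i. i < k \<Longrightarrow> norm (e i) = 1"
      "\<And>i w. i < k \<Longrightarrow> w \<in> ssum A (lspan i e) \<Longrightarrow> 1/2 \<le> norm (e i - w)"
    using dim_ge_mono[of B A "Suc k" k] by auto
  let ?W = "ssum A (lspan k e)"
  have W: "csubspace ?W" "closed ?W" "?W \<subseteq> B"
    using A B e(1) by (simp_all add: csubspace_ssum csubspace_lspan closed_ssum_lspan ssum_subset lspan_subset)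
  have "\<not> B \<subseteq> ?W"
  proof
    assume "B \<subseteq> ?W"
    then have "qdim B A \<le> enat k" using A by (intro qdim_le)
    moreover have "enat (Suc k) \<le> qdim B A" using Suc.prems dim_ge_iff by blast
    ultimately have "enat (Suc k) \<le> enat k" by (rule order_trans[rotated])
    then show False by simp
  qed
  then obtain x where "x \<in> B" "x \<notin> ?W" by blast
  then obtain f where f: "f \<in> B" "norm f = 1" "\<And>w. w \<in> ?W \<Longrightarrow> 1/2 \<le> norm (f - w)"
    using Riesz_lemma[OF W(1,2) B(1) W(3)] by metis
  have eq: "lspan i (e(k := f)) = lspan i e" if "i \<le> k" for i
    using that by (intro lspan_cong) auto
  show ?case
  proof (intro exI[of _ "e(k := f)"] allI impI)
    fix i assume "i < Suc k"
    then consider "i < k" | "i = k" by linarith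
    then show "(e(k := f)) i \<in> B \<and> norm ((e(k := f)) i) = 1 \<and>
        (\<forall>w\<in>ssum A (lspan i (e(k := f))). 1/2 \<le> norm ((e(k := f)) i - w))"
    proof cases
      case 1
      then show ?thesis using e eq[of i] by auto
    next
      case 2
      then show ?thesis using f eq[of i] by auto
    qed
  qed
qed simp

text \<open>Let \<open>s\<close> be the norm on the right. The last coefficient is at most
  \<open>2 * s\<close>, and deleting its term leaves a norm of at most \<open>3 * s\<close>. So the
  constants satisfy \<open>C (k + 1) = 3 * C k + 2\<close> with \<open>C 0 = 0\<close>, that is
  \<open>C k = 3 ^ k - 1\<close>.\<close>

lemma Riesz_sequence_coefficients:
  assumes A: "csubspace A"
    and e: "\<And>i. i < k \<Longrightarrow> norm (e i) = 1"
      "\<And>i w. i < k \<Longrightarrow> w \<in> ssum A (lspan i e) \<Longrightarrow> 1/2 \<le> norm (e i - w)"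
    and a: "a \<in> A"
  shows "(\<Sum>i<k. cmod (t i)) \<le> (3 ^ k - 1) * norm (lincomb k t e - a)"
  using e
proof (induction k)
  case (Suc k)
  let ?s = "norm (lincomb (Suc k) t e - a)"
  have tk: "cmod (t k) \<le> 2 * ?s"
  proof (cases "t k = 0")
    case False
    let ?w = "(1 / t k) *\<^sub>C (a - lincomb k t e)"
    have "a + (- lincomb k t e) \<in> ssum A (lspan k e)"
      using a csubspace_minus[OF csubspace_lspan lincomb_in_lspan] by (rule ssumI)
    then have "?w \<in> ssum A (lspan k e)"
      using csubspace_scale[OF csubspace_ssum[OF A csubspace_lspan]] by (metis diff_conv_add_uminus)
    then have w: "1/2 \<le> norm (e k - ?w)" using Suc.prems(2) by simp
    have "lincomb (Suc k) t e - a = t k *\<^sub>C (e k - ?w)"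
      using False by (simp add: cvs.scale_right_diff_distrib scaleC_scaleC scaleC_one)
    then have "?s = cmod (t k) * norm (e k - ?w)" by (simp only: norm_scaleC)
    then show ?thesis using mult_left_mono[OF w, of "cmod (t k)"] by simp
  qed simp
  have "lincomb k t e - a = (lincomb (Suc k) t e - a) - t k *\<^sub>C e k" by simp
  then have "norm (lincomb k t e - a) \<le> ?s + cmod (t k)"
    using norm_triangle_ineq4[of "lincomb (Suc k) t e - a" "t k *\<^sub>C e k"] Suc.prems(1)[of k]
    by (simp add: norm_scaleC)
  then have 3: "norm (lincomb k t e - a) \<le> 3 * ?s" using tk by linarith
  have "(\<Sum>i<k. cmod (t i)) \<le> (3 ^ k - 1) * norm (lincomb k t e - a)"
    using Suc.IH Suc.prems by simp
  also have "\<dots> \<le> (3 ^ k - 1) * (3 * ?s)" using 3 by (intro mult_left_mono) auto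
  finally have "(\<Sum>i<Suc k. cmod (t i)) \<le> (3 ^ k - 1) * (3 * ?s) + 2 * ?s" using tk by simp
  also have "\<dots> = (3 ^ Suc k - 1) * ?s" by (simp add: algebra_simps)
  finally show ?case .
qed simp

section \<open>One-sided gap estimates and the stability of relative dimension\<close>

definition gap_le :: "'a::complex_banach set \<Rightarrow> 'a set \<Rightarrow> real \<Rightarrow> bool" where
  "gap_le Y Z \<eta> \<longleftrightarrow> (\<forall>y\<in>Y. \<exists>z\<in>Z. norm (y - z) \<le> \<eta> * norm y)"

lemma gap_leD: "gap_le Y Z \<eta> \<Longrightarrow> y \<in> Y \<Longrightarrow> \<exists>z\<in>Z. norm (y - z) \<le> \<eta> * norm y"
  by (simp add: gap_le_def)

lemma gap_le_mono: "gap_le Y Z \<eta> \<Longrightarrow> \<eta> \<le> \<theta> \<Longrightarrow> gap_le Y Z \<theta>"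
  unfolding gap_le_def by (meson mult_right_mono norm_ge_zero order_trans)

lemma gap_le_refl: "0 \<le> \<eta> \<Longrightarrow> gap_le Y Y \<eta>"
  unfolding gap_le_def by (metis diff_self norm_ge_zero norm_zero zero_le_mult_iff)

lemma norm_lincomb_le:
  assumes "\<And>i. i < k \<Longrightarrow> norm (c i) \<le> r" "0 \<le> r"
  shows "norm (lincomb k t c) \<le> r * (\<Sum>i<k. cmod (t i))"
proof -
  have "norm (lincomb k t c) \<le> (\<Sum>i<k. cmod (t i) * r)"
    using assms by (intro sum_norm_le) (auto simp: norm_scaleC intro!: mult_left_mono)
  then show ?thesis by (simp only: sum_distrib_left mult.commute)
qed

text \<open>A Riesz sequence \<open>e\<close> of \<open>B\<close> modulo \<open>A\<close> is moved
  to \<open>f\<close> in \<open>B'\<close>. If a combination of \<open>f\<close> lies in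
  \<open>A'\<close> and its coefficients have moduli of sum \<open>s\<close>, it is within
  \<open>2 * \<eta> * s\<close> of some \<open>a\<close> in \<open>A\<close>; replacing
  \<open>f\<close> by \<open>e\<close> costs another \<open>\<eta> * s\<close>. The coefficient
  bound then forces \<open>s = 0\<close>.\<close>

lemma dim_ge_gap:
  assumes A: "csubspace A" "closed A" and B: "csubspace B" "A \<subseteq> B"
    and gap: "gap_le B B' \<eta>" "gap_le A' A \<eta>" and \<eta>: "0 \<le> \<eta>" "3 ^ Suc k * \<eta> < 1"
    and ge: "dim_ge B A k"
  shows "dim_ge B' A' k"
proof -
  obtain e where e: "\<And>i. i < k \<Longrightarrow> e i \<in> B" "\<And>i. i < k \<Longrightarrow> norm (e i) = 1"
      "\<And>i w. i < k \<Longrightarrow> w \<in> ssum A (lspan i e) \<Longrightarrow> 1/2 \<le> norm (e i - w)"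
    using Riesz_sequence[OF A B ge] by auto
  have "\<exists>z\<in>B'. norm (e i - z) \<le> \<eta>" if "i < k" for i
    using gap_leD[OF gap(1) e(1)[OF that]] e(2)[OF that] by simp
  then obtain f where f: "\<And>i. i < k \<Longrightarrow> f i \<in> B'" "\<And>i. i < k \<Longrightarrow> norm (e i - f i) \<le> \<eta>" by metis
  have "1 \<le> (3::real) ^ Suc k" by (rule one_le_power) simp
  then have "\<eta> \<le> 3 ^ Suc k * \<eta>" using mult_right_mono[of 1 "3 ^ Suc k" \<eta>] \<eta>(1) by simp
  then have \<eta>1: "\<eta> \<le> 1" using \<eta>(2) by linarith
  have "cindep A' k f"
    unfolding cindep_def
  proof (intro allI impI)
    fix t i assume z: "lincomb k t f \<in> A'" and i: "i < k"
    define s where "s = (\<Sum>i<k. cmod (t i))"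
    let ?z = "lincomb k t f"
    have s0: "0 \<le> s" unfolding s_def by (intro sum_nonneg) auto
    have "norm (f i) \<le> 2" if "i < k" for i
      using norm_triangle_ineq4[of "e i" "e i - f i"] e(2)[OF that] f(2)[OF that] \<eta>1 by simp
    then have "norm ?z \<le> 2 * s" unfolding s_def by (intro norm_lincomb_le) auto
    moreover obtain a where a: "a \<in> A" "norm (?z - a) \<le> \<eta> * norm ?z" using gap_leD[OF gap(2) z] by blast
    ultimately have 1: "norm (?z - a) \<le> \<eta> * (2 * s)" using \<eta>(1) by (meson mult_left_mono order_trans)
    have "lincomb k t e - ?z = lincomb k t (\<lambda>i. e i - f i)"
      by (simp add: cvs.scale_right_diff_distrib sum_subtractf)
    then have "norm (lincomb k t e - ?z) \<le> \<eta> * s"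
      unfolding s_def using f(2) \<eta>(1) norm_lincomb_le[of k "\<lambda>i. e i - f i" \<eta> t] by simp
    then have 2: "norm (lincomb k t e - a) \<le> 3 * \<eta> * s"
      using norm_triangle_ineq[of "lincomb k t e - ?z" "?z - a"] 1 by (simp add: algebra_simps)
    have "s \<le> (3 ^ k - 1) * norm (lincomb k t e - a)"
      unfolding s_def using A e a by (intro Riesz_sequence_coefficients) auto
    also have "\<dots> \<le> 3 ^ k * (3 * \<eta> * s)" using 2 by (intro mult_mono) auto
    finally have "s \<le> (3 ^ Suc k * \<eta>) * s" by (simp add: algebra_simps)
    then have "s = 0" using s0 \<eta>(2) by (smt (verit) mult_less_cancel_right2)
    then show "t i = 0" using i unfolding s_def
      by (subst (asm) sum_nonneg_eq_0_iff) auto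
  qed
  then show ?thesis using f(1) by (auto simp: dim_ge_def)
qed

lemma compact_lincomb_bounded: "compact {lincomb n t c | t. \<forall>i<n. cmod (t i) \<le> r}"
proof (induction n)
  case (Suc n)
  have "{lincomb (Suc n) t c | t. \<forall>i<Suc n. cmod (t i) \<le> r} =
     {x + y | x y. x \<in> {lincomb n t c | t. \<forall>i<n. cmod (t i) \<le> r} \<and> y \<in> (\<lambda>a. a *\<^sub>C c n) ` cball 0 r}"
    (is "?L = ?R")
  proof (intro set_eqI iffI)
    fix x assume "x \<in> ?L" then show "x \<in> ?R" by (fastforce simp: less_Suc_eq)
  next
    fix x assume "x \<in> ?R"
    then obtain t a where "\<forall>i<n. cmod (t i) \<le> r" "cmod a \<le> r" "x = lincomb n t c + a *\<^sub>C c n" by auto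
    then have "x = lincomb (Suc n) (t(n := a)) c" "\<forall>i<Suc n. cmod ((t(n := a)) i) \<le> r"
      by (auto simp: less_Suc_eq)
    then show "x \<in> ?L" by blast
  qed
  moreover have "compact ((\<lambda>a. a *\<^sub>C c n) ` cball 0 r)"
    by (intro compact_continuous_image linear_continuous_on bounded_linear_scaleC_left compact_cball)
  ultimately show ?case using compact_sums[OF Suc] by simp
qed simp

lemma norm_triangle_three:
  "norm (a + b + c) \<le> norm a + norm b + norm c"
  "norm (a - b - c) \<le> norm a + norm b + norm (c :: 'a::real_normed_vector)"
  using norm_triangle_ineq[of "a + b" c] norm_triangle_ineq[of a b]
    norm_triangle_ineq4[of "a - b" c] norm_triangle_ineq4[of a b] by linarith+

text \<open>The threshold of \<open>dim_ge_gap\<close> shrinks as \<open>k\<close> grows, so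
  infinite dimension needs another argument. Up to elements of \<open>A'\<close>, the approximants
  in \<open>B'\<close> of unit vectors of \<open>B\<close> lie in a compact set \<open>D\<close>. A
  Riesz sequence longer than a finite net of \<open>D\<close> has two members with the same net
  point; their difference is near \<open>A'\<close>, hence near \<open>A\<close>, against the
  separation \<open>1/2\<close>.\<close>

lemma qdim_finite_gap:
  assumes A: "csubspace A" "closed A" and B: "csubspace B" "A \<subseteq> B"
    and A': "csubspace A'" "closed A'" and B': "csubspace B'" "A' \<subseteq> B'"
    and gap: "gap_le B B' \<eta>" "gap_le A' A \<eta>" and \<eta>: "0 \<le> \<eta>" "\<eta> \<le> 1/16"
    and fin: "qdim B' A' \<noteq> \<infinity>"
  shows "qdim B A \<noteq> \<infinity>"
proof
  assume inf: "qdim B A = \<infinity>"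
  obtain n where n: "qdim B' A' = enat n" using fin by auto
  then have "dim_ge B' A' n" by (simp add: dim_ge_iff)
  then obtain b where b: "\<And>i. i < n \<Longrightarrow> b i \<in> B'" "\<And>i. i < n \<Longrightarrow> norm (b i) = 1"
      "\<And>i w. i < n \<Longrightarrow> w \<in> ssum A' (lspan i b) \<Longrightarrow> 1/2 \<le> norm (b i - w)"
    using Riesz_sequence[OF A' B'] by metis
  have coeff: "(\<Sum>i<n. cmod (t i)) \<le> (3 ^ n - 1) * norm (lincomb n t b - a)" if "a \<in> A'" for t a
    using A' b that by (intro Riesz_sequence_coefficients) auto
  have "cindep A' n b"
    unfolding cindep_def
  proof (intro allI impI)
    fix t i assume "lincomb n t b \<in> A'" "i < n"
    with coeff[OF this(1), of t] have "(\<Sum>i<n. cmod (t i)) \<le> 0" by simp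
    then have "(\<Sum>i<n. cmod (t i)) = 0" by (intro antisym sum_nonneg) auto
    then show "t i = 0" using \<open>i < n\<close> by (subst (asm) sum_nonneg_eq_0_iff) auto
  qed
  then have B'eq: "B' = ssum A' (lspan n b)" using cindep_spans[OF A'(1) B' n] b(1) by blast
  define D where "D = {lincomb n t b | t. \<forall>i<n. cmod (t i) \<le> 3 ^ n * 2}"
  have "compact D" unfolding D_def by (rule compact_lincomb_bounded)
  then obtain P where P: "finite P" "D \<subseteq> (\<Union>x\<in>P. ball x (1/16))"
    unfolding compact_eq_totally_bounded by (metis zero_less_divide_1_iff zero_less_numeral)
  define N where "N = Suc (card P)"
  have "dim_ge B A N" by (simp add: dim_ge_iff inf)
  then obtain e where e: "\<And>i. i < N \<Longrightarrow> e i \<in> B" "\<And>i. i < N \<Longrightarrow> norm (e i) = 1"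
      "\<And>i w. i < N \<Longrightarrow> w \<in> ssum A (lspan i e) \<Longrightarrow> 1/2 \<le> norm (e i - w)"
    using Riesz_sequence[OF A B] by metis
  have "\<exists>a d p. a \<in> A' \<and> p \<in> P \<and> dist p d < 1/16 \<and> norm (e i - (a + d)) \<le> \<eta>" if i: "i < N" for i
  proof -
    obtain y where y: "y \<in> B'" "norm (e i - y) \<le> \<eta>"
      using gap_leD[OF gap(1) e(1)[OF i]] e(2)[OF i] by auto
    have y2: "norm y \<le> 2" using norm_triangle_ineq4[of "e i" "e i - y"] e(2)[OF i] y \<eta> by simp
    obtain a t where at: "a \<in> A'" "y = a + lincomb n t b"
      using y(1) unfolding B'eq by (auto simp: ssum_def lspan_def)
    have "(\<Sum>i<n. cmod (t i)) \<le> (3 ^ n - 1) * norm (lincomb n t b - (- a))"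
      using at A' by (intro coeff csubspace_minus)
    also have "\<dots> \<le> 3 ^ n * 2" using y2 at by (intro mult_mono) (auto simp: add.commute)
    finally have le: "(\<Sum>i<n. cmod (t i)) \<le> 3 ^ n * 2" .
    have "cmod (t j) \<le> 3 ^ n * 2" if "j < n" for j
      using member_le_sum[of j "{..<n}" "\<lambda>i. cmod (t i)"] that le by simp
    then have "lincomb n t b \<in> D" by (auto simp: D_def)
    then obtain p where "p \<in> P" "dist p (lincomb n t b) < 1/16" using P(2) by auto
    then show ?thesis using at y by blast
  qed
  then obtain a d p where adp: "\<And>i. i < N \<Longrightarrow> a i \<in> A'" "\<And>i. i < N \<Longrightarrow> p i \<in> P"
      "\<And>i. i < N \<Longrightarrow> dist (p i) (d i) < 1/16" "\<And>i. i < N \<Longrightarrow> norm (e i - (a i + d i)) \<le> \<eta>"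
    by metis
  have "\<not> inj_on p {..<N}"
  proof
    assume "inj_on p {..<N}"
    then have "card {..<N} \<le> card P" using adp(2) P(1) by (intro card_inj_on_le) auto
    then show False by (simp add: N_def)
  qed
  then obtain i j where ij: "i < j" "j < N" "p i = p j"
    unfolding inj_on_def by (metis lessThan_iff linorder_neqE_nat)
  have iN: "i < N" using ij by simp
  have dd: "norm (d j - d i) < 1/8"
    using adp(3)[OF ij(2)] adp(3)[OF iN] ij(3) dist_triangle2[of "d j" "d i" "p j"]
    by (simp add: dist_norm norm_minus_commute)
  let ?z = "a j - a i"
  have E: "norm ((e j - e i) - (?z + (d j - d i))) \<le> 2 * \<eta>"
    using norm_triangle_ineq4[of "e j - (a j + d j)" "e i - (a i + d i)"] adp(4)[OF ij(2)] adp(4)[OF iN]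
    by (simp add: algebra_simps)
  have "norm (e j - e i) \<le> 2" using norm_triangle_ineq4[of "e j" "e i"] e(2)[OF ij(2)] e(2)[OF iN] by simp
  moreover have "?z = (e j - e i) - ((e j - e i) - (?z + (d j - d i))) - (d j - d i)" by simp
  then have "norm ?z \<le> norm (e j - e i) + norm ((e j - e i) - (?z + (d j - d i))) + norm (d j - d i)"
    using norm_triangle_three(2)[of "e j - e i" "(e j - e i) - (?z + (d j - d i))" "d j - d i"] by (simp only:)
  ultimately have z3: "norm ?z \<le> 3" using E dd \<eta> by linarith
  obtain w where w: "w \<in> A" "norm (?z - w) \<le> \<eta> * norm ?z"
    using gap_leD[OF gap(2) csubspace_diff[OF A'(1) adp(1)[OF ij(2)] adp(1)[OF iN]]] by blast
  then have zw: "norm (?z - w) \<le> \<eta> * 3" using z3 \<eta> by (meson mult_left_mono order_trans)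
  have "e j - (w + e i) = ((e j - e i) - (?z + (d j - d i))) + (?z - w) + (d j - d i)" by simp
  then have "norm (e j - (w + e i)) \<le> norm ((e j - e i) - (?z + (d j - d i))) + norm (?z - w) + norm (d j - d i)"
    using norm_triangle_three(1)[of "(e j - e i) - (?z + (d j - d i))" "?z - w" "d j - d i"] by (simp only:)
  \<comment> \<open>The errors are at most \<open>2 * \<eta>\<close>, at most
    \<open>3 * \<eta>\<close>, and below \<open>1/8\<close>: in total below
    \<open>5/16 + 1/8 = 7/16\<close>.\<close>
  then have "norm (e j - (w + e i)) < 1/2" using E zw dd \<eta> by linarith
  moreover have "w + e i \<in> ssum A (lspan j e)" using w(1) in_lspan[OF ij(1)] by (rule ssumI)
  ultimately show False using e(3)[OF ij(2)] by force
qed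

lemma qdim_stable:
  assumes A: "csubspace A" "closed A" and B: "csubspace B" "A \<subseteq> B"
  obtains \<epsilon> where "\<epsilon> > 0"
    "\<And>A' B'. \<lbrakk>csubspace A'; closed A'; csubspace B'; A' \<subseteq> B';
       gap_le B B' \<epsilon>; gap_le B' B \<epsilon>; gap_le A A' \<epsilon>; gap_le A' A \<epsilon>\<rbrakk> \<Longrightarrow> qdim B' A' = qdim B A"
proof (cases "qdim B A")
  case infinity
  have "qdim B' A' = qdim B A"
    if "csubspace A'" "closed A'" "csubspace B'" "A' \<subseteq> B'" "gap_le B B' (1/16)" "gap_le A' A (1/16)" for A' B'
    using qdim_finite_gap[OF A B that(1-6)] infinity by (cases "qdim B' A'") auto
  then show ?thesis using that[of "1/16"] by simp
next
  case (enat n)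
  \<comment> \<open>Small enough for \<open>dim_ge_gap\<close> at \<open>n\<close>, passing from
    \<open>B / A\<close> to \<open>B' / A'\<close>, and at \<open>n + 1\<close> in the opposite
    direction.\<close>
  define \<epsilon> :: real where "\<epsilon> = 1 / 3 ^ (n + 3)"
  have \<epsilon>: "\<epsilon> > 0" "3 ^ Suc n * \<epsilon> < 1" "3 ^ Suc (Suc n) * \<epsilon> < 1"
    unfolding \<epsilon>_def by (simp_all add: field_simps power_add)
  show ?thesis
  proof (rule that[OF \<epsilon>(1)])
    fix A' B' assume A': "csubspace A'" "closed A'" and B': "csubspace B'" "A' \<subseteq> B'"
      and gap: "gap_le B B' \<epsilon>" "gap_le B' B \<epsilon>" "gap_le A A' \<epsilon>" "gap_le A' A \<epsilon>"
    have "dim_ge B' A' n" using enat \<epsilon> by (intro dim_ge_gap[OF A B gap(1,4)]) (auto simp: dim_ge_iff)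
    moreover have "\<not> dim_ge B' A' (Suc n)"
    proof
      assume "dim_ge B' A' (Suc n)"
      then have "dim_ge B A (Suc n)" using \<epsilon> by (intro dim_ge_gap[OF A' B' gap(2,3)]) auto
      then show False using enat by (simp add: dim_ge_iff)
    qed
    ultimately have "enat n \<le> qdim B' A'" "\<not> enat (Suc n) \<le> qdim B' A'" by (simp_all add: dim_ge_iff)
    then show "qdim B' A' = qdim B A" using enat by (cases "qdim B' A'") auto
  qed
qed

subsection \<open>The open mapping theorem\<close>

text \<open>Solving approximately for the residual again and again halves it each time; the
  corrections are dominated by a geometric series with sum \<open>2 * C * norm y\<close>. The space
  \<open>Y\<close> of right-hand sides is left open so that it can be the range or its
  closure.\<close>

lemma approximate_preimage_imp_preimage:
  fixes f :: "'b::banach \<Rightarrow> 'c::real_normed_vector"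
  assumes f: "bounded_linear f" and M: "subspace M" "closed M" and C: "C \<ge> 0"
    and Y: "subspace Y" "f ` M \<subseteq> Y"
    and approx: "\<And>y. y \<in> Y \<Longrightarrow> \<exists>x\<in>M. norm x \<le> C * norm y \<and> norm (y - f x) \<le> norm y / 2"
    and y: "y \<in> Y"
  shows "\<exists>x\<in>M. f x = y \<and> norm x \<le> 2 * C * norm y"
proof -
  interpret f: bounded_linear f by (rule f)
  obtain g where g: "\<And>y. y \<in> Y \<Longrightarrow> g y \<in> M \<and> norm (g y) \<le> C * norm y \<and> norm (y - f (g y)) \<le> norm y / 2"
    using approx by metis
  define r where "r n = ((\<lambda>z. z - f (g z)) ^^ n) y" for n
  have r_Suc: "r (Suc n) = r n - f (g (r n))" for n by (simp add: r_def)
  have r: "r n \<in> Y \<and> norm (r n) \<le> norm y * (1/2) ^ n" for n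
  proof (induction n)
    case 0
    show ?case using y by (simp add: r_def)
  next
    case (Suc n)
    then have "r (Suc n) \<in> Y" unfolding r_Suc using g Y by (blast intro: subspace_diff)
    moreover have "norm (r (Suc n)) \<le> norm (r n) / 2" using g Suc by (simp add: r_Suc)
    ultimately show ?case using Suc by auto
  qed
  define x where "x n = g (r n)" for n
  have xM: "x n \<in> M" for n using g r by (simp add: x_def)
  have xle: "norm (x n) \<le> C * norm y * (1/2) ^ n" for n
  proof -
    have "norm (x n) \<le> C * norm (r n)" using g r by (simp add: x_def)
    also have "\<dots> \<le> C * (norm y * (1/2) ^ n)" using r C by (intro mult_left_mono) auto
    finally show ?thesis by (simp add: mult.assoc)
  qed
  have geo: "(\<lambda>n. C * norm y * (1/2) ^ n) sums (C * norm y * 2)"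
    using sums_mult[OF geometric_sums[of "1/2::real"], of "C * norm y"] by simp
  have sx: "summable x"
    by (rule summable_comparison_test[OF _ sums_summable[OF geo]]) (use xle in auto)
  have part: "f (\<Sum>i<n. x i) = y - r n" for n
    by (induction n) (simp_all add: f.zero f.add r_Suc x_def r_def[of 0])
  have "r \<longlonglongrightarrow> 0"
  proof (rule Lim_null_comparison)
    show "\<forall>\<^sub>F n in sequentially. norm (r n) \<le> norm y * (1/2) ^ n" using r by simp
    show "(\<lambda>n. norm y * (1/2) ^ n) \<longlonglongrightarrow> 0"
      using tendsto_mult[OF tendsto_const LIMSEQ_power_zero[of "1/2::real"], of "norm y"] by simp
  qed
  then have "(\<lambda>n. f (\<Sum>i<n. x i)) \<longlonglongrightarrow> y" unfolding part using tendsto_diff[OF tendsto_const, of r 0 sequentially y] by simp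
  moreover have "(\<lambda>n. f (\<Sum>i<n. x i)) \<longlonglongrightarrow> f (suminf x)"
    by (rule f.tendsto[OF summable_LIMSEQ[OF sx]])
  ultimately have "f (suminf x) = y" using LIMSEQ_unique by blast
  moreover have "suminf x \<in> M"
  proof (rule closed_sequentially[OF M(2) _ summable_LIMSEQ[OF sx]])
    show "(\<Sum>i<n. x i) \<in> M" for n by (rule subspace_sum[OF M(1) xM])
  qed
  moreover have "norm (suminf x) \<le> 2 * C * norm y"
    using norm_suminf_le[OF xle sums_summable[OF geo]] sums_unique[OF geo] by simp
  ultimately show ?thesis by blast
qed

text \<open>Baire category in the closed range, which is the union of the closures
  \<open>?K n\<close> of images of balls. One of them contains a relative ball around some
  \<open>y0\<close>; differences of approximate preimages carry it to the origin.\<close>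

theorem open_mapping_closed_range:
  fixes f :: "'b::banach \<Rightarrow> 'c::banach"
  assumes f: "bounded_linear f" and M: "subspace M" "closed M" and cl: "closed (f ` M)"
  obtains C where "C > 0" "\<And>y. y \<in> f ` M \<Longrightarrow> \<exists>x\<in>M. f x = y \<and> norm x \<le> C * norm y"
proof -
  interpret f: bounded_linear f by (rule f)
  let ?Y = "f ` M" and ?K = "\<lambda>n::nat. closure (f ` (M \<inter> cball 0 (real n)))"
  have Y: "subspace ?Y" using M(1) f.linear by (intro linear_subspace_image)
  have KY: "?K n \<subseteq> ?Y" for n using cl by (intro closure_minimal) auto
  have "?Y \<subseteq> (\<Union>n. ?K n)"
  proof
    fix y assume "y \<in> ?Y"
    then obtain x where x: "x \<in> M" "y = f x" by blast
    obtain n where "norm x \<le> real n" using real_arch_simple by blast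
    then have "y \<in> f ` (M \<inter> cball 0 (real n))" using x by auto
    then have "y \<in> ?K n" by (rule subsetD[OF closure_subset])
    then show "y \<in> (\<Union>n. ?K n)" by (rule UN_I[OF UNIV_I])
  qed
  then have Yeq: "?Y = \<Union>(range ?K)" using KY by blast
  have "\<exists>n. (top_of_set ?Y) interior_of ?K n \<noteq> {}"
  proof (rule ccontr)
    assume "\<not> ?thesis"
    then have *: "(top_of_set ?Y) interior_of T = {}" if "T \<in> range ?K" for T using that by auto
    have "closedin (top_of_set ?Y) T" if "T \<in> range ?K" for T
      using that KY by (auto intro: closed_subset)
    then have "(top_of_set ?Y) interior_of \<Union>(range ?K) = {}"
      using * completely_metrizable_space_closedin[OF completely_metrizable_space_euclidean] cl
      by (intro Baire_category_alt disjI1) (auto simp: closed_closedin[symmetric])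
    then have "?Y = {}" using Yeq interior_of_topspace[of "top_of_set ?Y"] by simp
    then show False using subspace_0[OF M(1)] by blast
  qed
  then obtain n y0 where "y0 \<in> (top_of_set ?Y) interior_of ?K n" by blast
  then obtain U where U: "openin (top_of_set ?Y) U" "y0 \<in> U" "U \<subseteq> ?K n" unfolding interior_of_def by blast
  then obtain V where "open V" "U = ?Y \<inter> V" unfolding openin_open by blast
  with U obtain r where r: "r > 0" "ball y0 r \<inter> ?Y \<subseteq> ?K n" and y0: "y0 \<in> ?Y"
    unfolding open_contains_ball by blast
  have approx0: "\<exists>x\<in>M. norm x \<le> 2 * real n \<and> norm (y - f x) < e"
    if y: "y \<in> ?Y" "norm y < r" and e: "e > 0" for y e
  proof -
    have "y0 + y \<in> ?K n" using r(2) y y0 Y by (auto simp: dist_norm intro!: subsetD[OF r(2)] intro: subspace_add)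
    then obtain x1 where x1: "x1 \<in> M" "norm x1 \<le> real n" "dist (f x1) (y0 + y) < e / 2"
      using e unfolding closure_approachable by (fastforce dest: spec[of _ "e / 2"])
    have "y0 \<in> ?K n" using r y0 by auto
    then obtain x2 where x2: "x2 \<in> M" "norm x2 \<le> real n" "dist (f x2) y0 < e / 2"
      using e unfolding closure_approachable by (fastforce dest: spec[of _ "e / 2"])
    have "y - f (x1 - x2) = (f x2 - y0) - (f x1 - (y0 + y))" by (simp add: f.diff)
    then have "norm (y - f (x1 - x2)) = norm ((f x2 - y0) - (f x1 - (y0 + y)))" by (simp only:)
    then have "norm (y - f (x1 - x2)) < e"
      using norm_triangle_ineq4[of "f x2 - y0" "f x1 - (y0 + y)"] x1(3) x2(3)
      unfolding dist_norm by linarith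
    moreover have "norm (x1 - x2) \<le> 2 * real n" using norm_triangle_ineq4[of x1 x2] x1 x2 by simp
    moreover have "x1 - x2 \<in> M" using x1 x2 M(1) subspace_diff by blast
    ultimately show ?thesis by blast
  qed
  \<comment> \<open>Scaled to norm \<open>r / 2\<close>, \<open>y\<close> is solved up to
    \<open>r / 4\<close>, half its norm, by a vector of norm at most \<open>2 * n\<close>; scaling
    back multiplies by \<open>2 * norm y / r\<close>.\<close>
  define C where "C = 4 * real n / r"
  have "\<exists>x\<in>M. norm x \<le> C * norm y \<and> norm (y - f x) \<le> norm y / 2" if y: "y \<in> ?Y" for y
  proof (cases "y = 0")
    case True
    then show ?thesis using subspace_0[OF M(1)] by (intro bexI[of _ 0]) (auto simp: f.zero)
  next
    case False
    define s where "s = r / (2 * norm y)"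
    have s: "s > 0" using r False by (simp add: s_def)
    have "norm (s *\<^sub>R y) < r" using s r False by (simp add: s_def)
    then obtain x where x: "x \<in> M" "norm x \<le> 2 * real n" "norm (s *\<^sub>R y - f x) < r / 4"
      using approx0[of "s *\<^sub>R y" "r / 4"] y Y r subspace_scale by (metis zero_less_divide_iff zero_less_numeral)
    have "y - f ((1 / s) *\<^sub>R x) = (1 / s) *\<^sub>R (s *\<^sub>R y - f x)" using s by (simp add: f.scaleR scaleR_diff_right)
    then have "norm (y - f ((1 / s) *\<^sub>R x)) = (1 / s) * norm (s *\<^sub>R y - f x)"
      using s by (simp only: norm_scaleR) simp
    also have "\<dots> \<le> (1 / s) * (r / 4)" using s x(3) by (intro mult_left_mono) auto
    also have "\<dots> = norm y / 2" using r False by (simp add: s_def field_simps)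
    finally have "norm (y - f ((1 / s) *\<^sub>R x)) \<le> norm y / 2" .
    moreover have "norm ((1 / s) *\<^sub>R x) \<le> (1 / s) * (2 * real n)" using x(2) s by (simp add: divide_right_mono)
    then have "norm ((1 / s) *\<^sub>R x) \<le> C * norm y" using r False by (simp add: s_def C_def field_simps)
    ultimately show ?thesis using x(1) M(1) subspace_scale by blast
  qed
  moreover have "C \<ge> 0" using r by (simp add: C_def)
  ultimately have *: "\<exists>x\<in>M. f x = y \<and> norm x \<le> 2 * C * norm y" if "y \<in> ?Y" for y
    using approximate_preimage_imp_preimage[OF f M _ Y order_refl] that by blast
  have "\<exists>x\<in>M. f x = y \<and> norm x \<le> (2 * C + 1) * norm y" if "y \<in> ?Y" for y
    using *[OF that] by (fastforce simp: algebra_simps intro: order_trans)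
  then show ?thesis using \<open>C \<ge> 0\<close> that[of "2 * C + 1"] by auto
qed

section \<open>Closed ranges and topological direct sums\<close>

lemma subspace_closure:
  fixes V :: "'b::real_normed_vector set"
  assumes "subspace V" shows "subspace (closure V)"
  unfolding subspace_def
proof (intro conjI ballI allI)
  show "0 \<in> closure V" using subspace_0[OF assms] closure_subset by blast
next
  fix x y assume "x \<in> closure V" "y \<in> closure V"
  then obtain s t where "\<And>n. s n \<in> V" "s \<longlonglongrightarrow> x" "\<And>n. t n \<in> V" "t \<longlonglongrightarrow> y"
    unfolding closure_sequential by blast
  then show "x + y \<in> closure V"
    unfolding closure_sequential using subspace_add[OF assms]
    by (intro exI[of _ "\<lambda>n. s n + t n"]) (auto intro: tendsto_add)
next
  fix c x assume "x \<in> closure V"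
  then obtain s where "\<And>n. s n \<in> V" "s \<longlonglongrightarrow> x" unfolding closure_sequential by blast
  then show "c *\<^sub>R x \<in> closure V"
    unfolding closure_sequential using subspace_scale[OF assms]
    by (intro exI[of _ "\<lambda>n. c *\<^sub>R s n"]) (auto intro: tendsto_scaleR)
qed

text \<open>A point of the closure is approximated by points of the range, whose bounded preimages
  are approximate preimages of it. The iteration makes them exact, so the closure is contained in
  the range.\<close>

lemma closed_range_of_bounded_preimages:
  fixes f :: "'b::banach \<Rightarrow> 'c::real_normed_vector"
  assumes f: "bounded_linear f" and M: "subspace M" "closed M" and C: "C \<ge> 0"
    and pre: "\<And>y. y \<in> f ` M \<Longrightarrow> \<exists>x\<in>M. f x = y \<and> norm x \<le> C * norm y"
  shows "closed (f ` M)"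
proof -
  interpret f: bounded_linear f by (rule f)
  have Y: "subspace (closure (f ` M))"
    using M(1) f.linear by (intro subspace_closure linear_subspace_image)
  have approx: "\<exists>x\<in>M. norm x \<le> C * 2 * norm y \<and> norm (y - f x) \<le> norm y / 2" if y: "y \<in> closure (f ` M)" for y
  proof (cases "y = 0")
    case True
    then show ?thesis using subspace_0[OF M(1)] by (intro bexI[of _ 0]) (auto simp: f.zero)
  next
    case False
    then obtain z where z: "z \<in> f ` M" "dist z y < norm y / 2"
      using y unfolding closure_approachable by (metis half_gt_zero zero_less_norm_iff)
    then obtain x where x: "x \<in> M" "f x = z" "norm x \<le> C * norm z" using pre by blast
    have "norm z \<le> 2 * norm y" using z(2) norm_triangle_ineq2[of z y] norm_ge_zero[of y]
      unfolding dist_norm by linarith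
    then have "C * norm z \<le> C * (2 * norm y)" using C by (rule mult_left_mono)
    then show ?thesis using x z(2) by (intro bexI[of _ x]) (auto simp: dist_norm norm_minus_commute)
  qed
  have "closure (f ` M) \<subseteq> f ` M"
  proof
    fix y assume "y \<in> closure (f ` M)"
    then obtain x where "x \<in> M" "f x = y"
      using approximate_preimage_imp_preimage[OF f M _ Y closure_subset approx, of y] C by auto
    then show "y \<in> f ` M" by blast
  qed
  then show ?thesis by (metis closed_closure closure_subset subset_antisym)
qed


lemma csubspace_imp_subspace: "csubspace M \<Longrightarrow> subspace M"
  unfolding subspace_def by (auto simp: csubspace_0 csubspace_add csubspace_scale scaleR_scaleC)

lemma csubspace_subspace_Times: "csubspace A \<Longrightarrow> csubspace B \<Longrightarrow> subspace (A \<times> B)"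
  unfolding subspace_def
  by (auto simp: zero_prod_def csubspace_0 csubspace_add csubspace_scale scaleR_scaleC)

text \<open>The open mapping theorem for addition on \<open>A \<times> B\<close>: as
  \<open>A\<close> meets \<open>B\<close> only in \<open>0\<close>, the preimage of controlled norm
  is the pair itself.\<close>

lemma direct_sum_bound:
  fixes A B :: "'a::complex_banach set"
  assumes A: "csubspace A" "closed A" and B: "csubspace B" "closed B"
    and int: "A \<inter> B = {0}" and cl: "closed (ssum A B)"
  obtains K where "K > 0" "\<And>a b. a \<in> A \<Longrightarrow> b \<in> B \<Longrightarrow> norm a \<le> K * norm (a + b)"
    "\<And>a b. a \<in> A \<Longrightarrow> b \<in> B \<Longrightarrow> norm b \<le> K * norm (a + b)"
proof -
  let ?f = "\<lambda>z :: 'a \<times> 'a. fst z + snd z"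
  have f: "bounded_linear ?f"
    by (intro bounded_linear_add bounded_linear_fst bounded_linear_snd)
  have im: "?f ` (A \<times> B) = ssum A B" unfolding ssum_def by force
  have "subspace (A \<times> B)" "closed (A \<times> B)"
    using A B by (auto intro: csubspace_subspace_Times closed_Times)
  from open_mapping_closed_range[OF f this] cl obtain K where K: "K > 0"
    "\<And>y. y \<in> ssum A B \<Longrightarrow> \<exists>z\<in>A \<times> B. ?f z = y \<and> norm z \<le> K * norm y"
    unfolding im by metis
  have *: "norm a \<le> K * norm (a + b) \<and> norm b \<le> K * norm (a + b)" if ab: "a \<in> A" "b \<in> B" for a b
  proof -
    obtain a' b' where z: "a' \<in> A" "b' \<in> B" "a' + b' = a + b" "norm (a', b') \<le> K * norm (a + b)"
      using K(2)[OF ssumI[OF ab]] by auto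
    have eq: "a' - a = b - b'" using z(3) by (simp add: algebra_simps)
    have "a' - a \<in> A" using A(1) z(1) ab(1) by (rule csubspace_diff)
    moreover have "b - b' \<in> B" using B(1) ab(2) z(2) by (rule csubspace_diff)
    ultimately have "a' - a \<in> A \<inter> B" using eq by simp
    then have "a' - a = 0" using int by simp
    then have "a' = a" "b' = b" using eq by simp_all
    then have "norm (a, b) \<le> K * norm (a + b)" using z(4) by simp
    then show ?thesis using norm_fst_le[of a b] norm_snd_le[of b a] by linarith
  qed
  show ?thesis by (rule that[OF K(1)]) (use * in simp_all)
qed

lemma closed_ssum_subspaces:
  fixes A B :: "'a::complex_banach set"
  assumes A: "csubspace A" "closed A" and B: "csubspace B" "closed B"
    and int: "A \<inter> B = {0}" and cl: "closed (ssum A B)"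
    and A': "csubspace A'" "closed A'" "A' \<subseteq> A" and B': "csubspace B'" "closed B'" "B' \<subseteq> B"
  shows "closed (ssum A' B')"
proof -
  obtain K where K: "\<And>a b. a \<in> A \<Longrightarrow> b \<in> B \<Longrightarrow> norm a \<le> K * norm (a + b)"
    using direct_sum_bound[OF A B int cl] by metis
  show ?thesis by (rule closed_ssum_of_bound[OF A'(1,2) B'(1,2), of K]) (use K A' B' in blast)
qed

lemma bounded_clinear_bl: "bounded_clinear S \<Longrightarrow> bounded_linear S"
  and bounded_clinear_on: "bounded_clinear S \<Longrightarrow> clinear_on M S"
  by (auto simp: bounded_clinear_def clinear_on_def linear_simps)

text \<open>With a finite-dimensional complement \<open>C\<close> of the range, the map from
  \<open>(x, c)\<close> to \<open>S x + c\<close> is onto \<open>M\<close> and has bounded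
  preimages. As \<open>y n\<close> is in the range, \<open>l\<close> and \<open>l - y n\<close> have
  the same \<open>C\<close>-component \<open>c\<close>, which is thus bounded by a multiple of
  \<open>norm (l - y n)\<close> and vanishes.\<close>

lemma closed_range_of_finite_codim:
  fixes S :: "'a::complex_banach \<Rightarrow> 'a"
  assumes S: "bounded_clinear S" and M: "csubspace M" "closed M" and inv: "S ` M \<subseteq> M"
    and fin: "qdim M (S ` M) \<noteq> \<infinity>"
  shows "closed (S ` M)"
proof -
  interpret S: bounded_linear S by (rule bounded_clinear_bl[OF S])
  have R: "csubspace (S ` M)" using csubspace_image[OF M(1) bounded_clinear_on[OF S]] .
  obtain C where "ccomplement M (S ` M) C" using ex_ccomplement[OF M(1) R inv fin] ..
  note C = this[unfolded ccomplement_def] and Cq = ccomplement_qdim[OF M(1) R inv this]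
  have clC: "closed C" using C Cq fin by (intro closed_qdim_finite) auto
  let ?f = "\<lambda>z :: 'a \<times> 'a. S (fst z) + snd z"
  have f: "bounded_linear ?f"
    by (intro bounded_linear_add bounded_linear_compose[OF S.bounded_linear_axioms] bounded_linear_fst bounded_linear_snd)
  have im: "?f ` (M \<times> C) = M"
  proof
    show "?f ` (M \<times> C) \<subseteq> M" using C inv M(1) by (auto intro!: csubspace_add)
    show "M \<subseteq> ?f ` (M \<times> C)"
    proof
      fix x assume "x \<in> M"
      then obtain r c where "r \<in> S ` M" "c \<in> C" "x = r + c" using C by blast
      then show "x \<in> ?f ` (M \<times> C)" by (auto intro!: image_eqI[of _ _ "(_, c)"])
    qed
  qed
  have "subspace (M \<times> C)" "closed (M \<times> C)"
    using M C clC by (auto intro: csubspace_subspace_Times closed_Times)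
  from open_mapping_closed_range[OF f this] M(2) obtain K where K: "K > 0"
    "\<And>y. y \<in> M \<Longrightarrow> \<exists>z\<in>M \<times> C. ?f z = y \<and> norm z \<le> K * norm y"
    unfolding im by metis
  show ?thesis
    unfolding closed_sequential_limits
  proof (intro allI impI, elim conjE)
    fix y l assume y: "\<forall>n. y n \<in> S ` M" and l: "y \<longlonglongrightarrow> l"
    have yM: "y n \<in> M" for n using y inv by blast
    then have lM: "l \<in> M" using M(2) l closed_sequentially by blast
    then obtain r c where rc: "r \<in> S ` M" "c \<in> C" "l = r + c" using C by blast
    have "norm c \<le> K * norm (l - y n)" for n
    proof -
      have "l - y n \<in> M" using lM yM M(1) csubspace_diff by blast
      then obtain x d where xd: "x \<in> M" "d \<in> C" "S x + d = l - y n" "norm (x, d) \<le> K * norm (l - y n)"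
        using K(2)[of "l - y n"] by auto
      have "c - d = y n + S x - r" using xd(3) rc(3) by (simp add: algebra_simps)
      moreover have "y n + S x - r \<in> S ` M"
        using y xd(1) rc(1) R by (intro csubspace_diff csubspace_add) auto
      moreover have "c - d \<in> C" using rc xd C csubspace_diff by blast
      ultimately have "c - d \<in> C \<inter> S ` M" by simp
      then have "c - d = 0" using C by simp
      then show ?thesis using xd(4) norm_snd_le[of d x] by simp
    qed
    moreover have "(\<lambda>n. K * norm (l - y n)) \<longlonglongrightarrow> 0"
    proof -
      have "(\<lambda>n. l - y n) \<longlonglongrightarrow> 0" using tendsto_diff[OF tendsto_const l, of l] by simp
      then show ?thesis using tendsto_mult_right_zero tendsto_norm_zero by blast
    qed
    ultimately have "norm c \<le> 0" by (intro tendsto_lowerbound) auto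
    then show "l \<in> S ` M" using rc by simp
  qed
qed

subsection \<open>The Hahn--Banach theorem\<close>

definition sublinear :: "('b::real_vector \<Rightarrow> real) \<Rightarrow> bool" where
  "sublinear q \<longleftrightarrow> (\<forall>x y. q (x + y) \<le> q x + q y) \<and> (\<forall>r\<ge>0. \<forall>x. q (r *\<^sub>R x) = r * q x)"

lemma sublinear_add: "sublinear q \<Longrightarrow> q (x + y) \<le> q x + q y"
  and sublinear_scale: "sublinear q \<Longrightarrow> r \<ge> 0 \<Longrightarrow> q (r *\<^sub>R x) = r * q x"
  by (auto simp: sublinear_def)

lemma sublinear_0: "sublinear q \<Longrightarrow> q 0 = 0"
  using sublinear_scale[of q 0 0] by simp

lemma sublinear_minus: "sublinear q \<Longrightarrow> - q (- x) \<le> q x"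
  using sublinear_add[of q x "- x"] sublinear_0[of q] by simp

lemma sublinearI:
  assumes "\<And>x y. q (x + y) \<le> q x + q y" "q 0 = 0" "\<And>r x. r > 0 \<Longrightarrow> q (r *\<^sub>R x) \<le> r * q x"
  shows "sublinear q"
  unfolding sublinear_def
proof (intro conjI allI impI assms(1))
  fix r :: real and x assume "r \<ge> 0"
  show "q (r *\<^sub>R x) = r * q x"
  proof (cases "r = 0")
    case False
    with \<open>r \<ge> 0\<close> have r: "r > 0" by simp
    have "q ((1 / r) *\<^sub>R (r *\<^sub>R x)) \<le> (1 / r) * q (r *\<^sub>R x)" using r by (intro assms(3)) simp
    then have "r * q x \<le> q (r *\<^sub>R x)" using r by (simp add: field_simps)
    then show ?thesis using assms(3)[OF r, of x] by simp
  qed (simp add: assms(2))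
qed

text \<open>\<open>q'\<close> is the largest sublinear functional below \<open>q\<close> with
  \<open>q' (- y) \<le> - q y\<close>. Lowering at \<open>u\<close> fixes the value at
  \<open>u\<close> in \<open>Hahn_Banach_sublinear\<close>; lowering at an arbitrary
  \<open>y\<close> shows that a minimal functional is additive.\<close>

lemma sublinear_lower:
  assumes q: "sublinear q"
  obtains q' where "sublinear q'" "\<And>x. q' x \<le> q x" "\<And>x. q' x \<le> q (x + y) - q y" "q' (- y) \<le> - q y"
proof -
  define q' where "q' x = (INF t\<in>{0..}. q (x + t *\<^sub>R y) - t * q y)" for x
  have lb: "- q (- x) \<le> q (x + t *\<^sub>R y) - t * q y" if "t \<in> {0..}" for x t
    using sublinear_add[OF q, of "x + t *\<^sub>R y" "- x"] sublinear_scale[OF q, of t y] that by simp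
  have bdd: "bdd_below ((\<lambda>t. q (x + t *\<^sub>R y) - t * q y) ` {0..})" for x
    using lb[of _ x] by (intro bdd_belowI2)
  have le: "q' x \<le> q (x + t *\<^sub>R y) - t * q y" if "t \<ge> 0" for x t
    unfolding q'_def using that by (intro cINF_lower bdd) auto
  have "sublinear q'"
  proof (rule sublinearI)
    fix x z
    have 1: "q' (x + z) \<le> (q (x + t *\<^sub>R y) - t * q y) + (q (z + s *\<^sub>R y) - s * q y)" if "t \<ge> 0" "s \<ge> 0" for t s
    proof -
      have "q' (x + z) \<le> q ((x + z) + (t + s) *\<^sub>R y) - (t + s) * q y" using that by (intro le) simp
      also have "(x + z) + (t + s) *\<^sub>R y = (x + t *\<^sub>R y) + (z + s *\<^sub>R y)" by (simp add: algebra_simps)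
      also have "q \<dots> \<le> q (x + t *\<^sub>R y) + q (z + s *\<^sub>R y)" by (rule sublinear_add[OF q])
      finally show ?thesis by (simp add: algebra_simps)
    qed
    have "q' (x + z) - (q (x + t *\<^sub>R y) - t * q y) \<le> q' z" if "t \<ge> 0" for t
      unfolding q'_def[of z] using 1[OF that] by (intro cINF_greatest) (auto simp: algebra_simps)
    then have "q' (x + z) - q' z \<le> q' x"
      unfolding q'_def[of x] by (intro cINF_greatest) (auto simp: algebra_simps)
    then show "q' (x + z) \<le> q' x + q' z" by simp
  next
    show "q' 0 = 0" unfolding q'_def using sublinear_scale[OF q] by simp
  next
    fix r :: real and x assume r: "r > 0"
    have "q' (r *\<^sub>R x) / r \<le> q (x + t *\<^sub>R y) - t * q y" if t: "t \<ge> 0" for t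
    proof -
      have "q' (r *\<^sub>R x) \<le> q (r *\<^sub>R x + (r * t) *\<^sub>R y) - (r * t) * q y" using r t by (intro le) simp
      also have "r *\<^sub>R x + (r * t) *\<^sub>R y = r *\<^sub>R (x + t *\<^sub>R y)" by (simp add: scaleR_add_right)
      also have "q \<dots> = r * q (x + t *\<^sub>R y)" using r by (intro sublinear_scale[OF q]) simp
      finally show ?thesis using r by (simp add: field_simps)
    qed
    then have "q' (r *\<^sub>R x) / r \<le> q' x" unfolding q'_def[of x] by (intro cINF_greatest) auto
    then show "q' (r *\<^sub>R x) \<le> r * q' x" using r by (simp add: field_simps)
  qed
  moreover have "q' x \<le> q x" for x using le[of 0 x] by simp
  moreover have "q' x \<le> q (x + y) - q y" for x using le[of 1 x] by simp
  moreover have "q' (- y) \<le> - q y" using le[of 1 "- y"] sublinear_0[OF q] by simp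
  ultimately show ?thesis using that by blast
qed

text \<open>Zorn's lemma in the reversed pointwise order. The infimum of a chain is finite because
  its members lie above \<open>- p (- x)\<close>, and subadditive because any two of them are
  comparable.\<close>

lemma minimal_sublinear:
  assumes p: "sublinear p"
  obtains q where "sublinear q" "\<And>x. q x \<le> p x" "\<And>q'. sublinear q' \<Longrightarrow> (\<And>x. q' x \<le> q x) \<Longrightarrow> q' = q"
proof -
  let ?A = "{q. sublinear q \<and> (\<forall>x. q x \<le> p x)}" and ?P = "\<lambda>q q' :: 'a \<Rightarrow> real. \<forall>x. q' x \<le> q x"
  have "\<exists>m\<in>?A. \<forall>a\<in>?A. ?P m a \<longrightarrow> a = m"
  proof (rule predicate_Zorn)
    show "partial_order_on ?A (relation_of ?P ?A)"
      by (rule partial_order_on_relation_ofI) (auto intro: order_trans intro!: ext antisym)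
  next
    fix C assume C: "C \<in> Chains (relation_of ?P ?A)"
    then have CA: "q \<in> ?A" if "q \<in> C" for q using that unfolding Chains_def relation_of_def by blast
    have chain: "?P q q' \<or> ?P q' q" if "q \<in> C" "q' \<in> C" for q q'
      using that C unfolding Chains_def relation_of_def by blast
    show "\<exists>u\<in>?A. \<forall>a\<in>C. ?P a u"
    proof (cases "C = {}")
      case True
      then show ?thesis using p by auto
    next
      case False
      define u where "u x = (INF q\<in>C. q x)" for x
      have lb: "- p (- x) \<le> q x" if "q \<in> C" for q x
        using CA[OF that] sublinear_minus[of q x] by (smt (verit) mem_Collect_eq)
      have bdd: "bdd_below ((\<lambda>q. q x) ` C)" for x using lb[of _ x] by (intro bdd_belowI2)
      have le: "u x \<le> q x" if "q \<in> C" for q x unfolding u_def using that by (intro cINF_lower bdd)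
      have "sublinear u"
      proof (rule sublinearI)
        fix x z
        have 1: "u (x + z) \<le> q x + q' z" if q: "q \<in> C" "q' \<in> C" for q q'
        proof -
          obtain q'' where "q'' \<in> C" "q'' x \<le> q x" "q'' z \<le> q' z" using chain[OF q] q by auto
          then show ?thesis using le[of q'' "x + z"] CA[of q''] sublinear_add[of q'' x z] by auto
        qed
        have "u (x + z) - q x \<le> u z" if "q \<in> C" for q
          unfolding u_def[of z] using 1[OF that] False by (intro cINF_greatest) (auto simp: algebra_simps)
        then have "u (x + z) - u z \<le> u x"
          unfolding u_def[of x] using False by (intro cINF_greatest) (auto simp: algebra_simps)
        then show "u (x + z) \<le> u x + u z" by simp
      next
        have "(\<lambda>q. q 0) ` C = {0}" using CA sublinear_0 False by force
        then show "u 0 = 0" by (simp add: u_def)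
      next
        fix r :: real and x assume r: "r > 0"
        have "u (r *\<^sub>R x) / r \<le> q x" if "q \<in> C" for q
          using le[OF that, of "r *\<^sub>R x"] CA[OF that] sublinear_scale[of q r x] r by (auto simp: field_simps)
        then have "u (r *\<^sub>R x) / r \<le> u x" unfolding u_def[of x] using False by (intro cINF_greatest) auto
        then show "u (r *\<^sub>R x) \<le> r * u x" using r by (simp add: field_simps)
      qed
      moreover have "u x \<le> p x" for x using False CA le[of _ x] by (force intro: order_trans)
      ultimately show ?thesis using le by blast
    qed
  qed
  then obtain q where q: "q \<in> ?A" "\<forall>a\<in>?A. ?P q a \<longrightarrow> a = q" by blast
  show ?thesis
  proof (rule that[of q])
    fix q' assume "sublinear q'" "\<And>x. q' x \<le> q x"
    moreover have "q' x \<le> p x" for x using calculation(2)[of x] q(1) by (force intro: order_trans)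
    ultimately show "q' = q" using q(2) by blast
  qed (use q in auto)
qed

text \<open>A minimal sublinear functional is linear, because otherwise the lemma
  \<open>sublinear_lower\<close> would lower it further.\<close>

theorem Hahn_Banach_sublinear:
  fixes p :: "'b::real_vector \<Rightarrow> real"
  assumes p: "sublinear p"
  obtains f where "linear f" "\<And>x. f x \<le> p x" "f u = p u"
proof -
  obtain p' where p': "sublinear p'" "\<And>x. p' x \<le> p x" "p' (- u) \<le> - p u"
    using sublinear_lower[OF p] by metis
  obtain q where q: "sublinear q" "\<And>x. q x \<le> p' x" "\<And>q'. sublinear q' \<Longrightarrow> (\<And>x. q' x \<le> q x) \<Longrightarrow> q' = q"
    using minimal_sublinear[OF p'(1)] by metis
  have add: "q (x + y) = q x + q y" for x y
  proof -
    obtain q' where "sublinear q'" "\<And>x. q' x \<le> q x" "q' x \<le> q (x + y) - q y"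
      using sublinear_lower[OF q(1)] by metis
    then have "q x \<le> q (x + y) - q y" using q(3) by metis
    then show ?thesis using sublinear_add[OF q(1), of x y] by simp
  qed
  have minus: "q (- x) = - q x" for x using add[of x "- x"] sublinear_0[OF q(1)] by simp
  have "linear q"
  proof (rule linearI)
    fix r x show "q (r *\<^sub>R x) = r *\<^sub>R q x"
    proof (cases "r \<ge> 0")
      case False
      then have "q ((- r) *\<^sub>R x) = (- r) * q x" using q(1) by (intro sublinear_scale) auto
      then show ?thesis using minus[of "r *\<^sub>R x"] by simp
    qed (simp add: sublinear_scale[OF q(1)])
  qed (rule add)
  moreover have "q x \<le> p x" for x using q(2)[of x] p'(2)[of x] by linarith
  moreover have "q u \<ge> p u" using q(2)[of "- u"] p'(3) minus[of u] by linarith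
  ultimately show ?thesis using that[of q] by (meson antisym)
qed

text \<open>This is the seminorm of the quotient by \<open>R\<close>: a linear functional below it
  vanishes on \<open>R\<close>, and it can still attain \<open>infdist u R\<close> at
  \<open>u\<close>.\<close>

lemma sublinear_infdist:
  assumes R: "csubspace (R :: 'a::complex_banach set)"
  shows "sublinear (\<lambda>x. infdist x R)"
proof -
  have ne: "R \<noteq> {}" using csubspace_0[OF R] by blast
  show ?thesis
  proof (rule sublinearI)
    fix x y :: 'a
    have *: "infdist (x + y) R \<le> norm (x - a) + norm (y - b)" if "a \<in> R" "b \<in> R" for a b
    proof -
      have "infdist (x + y) R \<le> norm ((x + y) - (a + b))"
        using infdist_le[OF csubspace_add[OF R that]] by (simp add: dist_norm)
      also have "(x + y) - (a + b) = (x - a) + (y - b)" by simp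
      finally show ?thesis using norm_triangle_ineq order_trans by blast
    qed
    have "infdist (x + y) R - norm (x - a) \<le> infdist y R" if "a \<in> R" for a
      unfolding infdist_notempty[OF ne, of y]
      by (rule cINF_greatest[OF ne]) (use *[OF that] in \<open>simp add: dist_norm diff_le_eq add.commute\<close>)
    then have "infdist (x + y) R - infdist y R \<le> infdist x R"
      unfolding infdist_notempty[OF ne, of x]
      by (intro cINF_greatest[OF ne]) (simp add: dist_norm algebra_simps)
    then show "infdist (x + y) R \<le> infdist x R + infdist y R" by simp
  next
    show "infdist 0 R = 0" using csubspace_0[OF R] by simp
  next
    fix r :: real and x :: 'a assume r: "r > 0"
    have "infdist (r *\<^sub>R x) R / r \<le> norm (x - a)" if "a \<in> R" for a
    proof -
      have "infdist (r *\<^sub>R x) R \<le> norm (r *\<^sub>R x - r *\<^sub>R a)"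
        using infdist_le[OF subspace_scale[OF csubspace_imp_subspace[OF R] that]] by (simp add: dist_norm)
      also have "\<dots> = r * norm (x - a)" using r by (simp only: scaleR_diff_right[symmetric] norm_scaleR abs_of_pos)
      finally show ?thesis using r by (simp add: divide_le_eq mult.commute)
    qed
    then have "infdist (r *\<^sub>R x) R / r \<le> infdist x R"
      unfolding infdist_notempty[OF ne, of x]
      by (intro cINF_greatest[OF ne]) (simp add: dist_norm)
    then show "infdist (r *\<^sub>R x) R \<le> r * infdist x R" using r by (simp add: field_simps)
  qed
qed

text \<open>A real functional \<open>g\<close> below the distance to \<open>R\<close> is
  complexified by \<open>F x = g x - \<i> g (\<i> x)\<close>. It vanishes on the complex subspace
  \<open>R\<close>, and its real part at \<open>u\<close> is the positive distance of
  \<open>u\<close> from \<open>R\<close>, so division by \<open>F u\<close> normalises it.\<close>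

theorem ex_separating_functional:
  fixes R :: "'a::complex_banach set"
  assumes R: "csubspace R" "closed R" and u: "u \<notin> R"
  obtains f :: "'a \<Rightarrow> complex" where "bounded_linear f" "\<And>a x. f (a *\<^sub>C x) = a * f x"
    "f u = 1" "\<And>x. x \<in> R \<Longrightarrow> f x = 0"
proof -
  have ne: "R \<noteq> {}" using csubspace_0[OF R(1)] by blast
  obtain g where g: "linear g" "\<And>x. g x \<le> infdist x R" "g u = infdist u R"
    using Hahn_Banach_sublinear[OF sublinear_infdist[OF R(1)]] by metis
  interpret g: linear g by (rule g(1))
  have abs0: "g x = 0" if "x \<in> R" for x
    using g(2)[of x] g(2)[of "- x"] that csubspace_minus[OF R(1) that] by (simp add: g.neg)
  have le: "g x \<le> norm x" for x
    using g(2)[of x] infdist_le[OF csubspace_0[OF R(1)], of x] by simp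
  have abs: "\<bar>g x\<bar> \<le> norm x" for x using le[of x] le[of "- x"] by (simp add: g.neg)
  define F where "F x = Complex (g x) (- g (\<i> *\<^sub>C x))" for x
  have ii: "\<i> *\<^sub>C (\<i> *\<^sub>C x) = - x" for x :: 'a by (simp add: scaleC_scaleC cvs.scale_minus_left scaleC_one)
  have Fadd: "F (x + y) = F x + F y" for x y
    by (simp add: F_def g.add scaleC_add_right complex_eq_iff)
  have Fi: "F (\<i> *\<^sub>C x) = \<i> * F x" for x
    by (simp add: F_def ii g.neg complex_eq_iff)
  have Fr: "F (complex_of_real r *\<^sub>C x) = complex_of_real r * F x" for r x
  proof -
    have "\<i> *\<^sub>C (complex_of_real r *\<^sub>C x) = r *\<^sub>R (\<i> *\<^sub>C x)"
      by (simp add: scaleR_scaleC scaleC_scaleC mult.commute)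
    then show ?thesis
      by (simp add: F_def scaleR_scaleC[symmetric] g.scale complex_eq_iff)
  qed
  have Fscale: "F (a *\<^sub>C x) = a * F x" for a x
  proof -
    have "a *\<^sub>C x = complex_of_real (Re a) *\<^sub>C x + \<i> *\<^sub>C (complex_of_real (Im a) *\<^sub>C x)"
      by (simp add: scaleC_scaleC scaleC_add_left[symmetric] complex_eq[symmetric])
    then have "F (a *\<^sub>C x) = complex_of_real (Re a) * F x + \<i> * (complex_of_real (Im a) * F x)"
      by (simp only: Fadd Fi Fr)
    then have "F (a *\<^sub>C x) = (complex_of_real (Re a) + \<i> * complex_of_real (Im a)) * F x"
      by (simp add: algebra_simps)
    then show ?thesis by (simp add: complex_eq[symmetric])
  qed
  have Fu: "F u \<noteq> 0"
    using infdist_pos_not_in_closed[OF R(2) ne u] g(3) by (auto simp: F_def complex_eq_iff)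
  have bl: "bounded_linear F"
  proof (rule bounded_linear_intro[where K = 2])
    fix r x show "F (r *\<^sub>R x) = r *\<^sub>R F x"
      using Fr[of r x] by (simp add: scaleR_scaleC[where 'a = 'a] scaleR_conv_of_real)
    show "norm (F x) \<le> norm x * 2"
      using cmod_le[of "F x"] abs[of x] abs[of "\<i> *\<^sub>C x"] by (simp add: F_def norm_scaleC)
  qed (rule Fadd)
  show ?thesis
  proof (rule that[of "\<lambda>x. F x / F u"])
    show "bounded_linear (\<lambda>x. F x / F u)"
      using bounded_linear_compose[OF bounded_linear_divide bl] .
    fix x assume "x \<in> R"
    then show "F x / F u = 0"
      using abs0[of x] abs0[OF csubspace_scale[OF R(1)], of x \<i>] by (simp add: F_def zero_complex.code[symmetric])
  qed (use Fscale Fu in auto)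
qed

subsection \<open>Stability of Kato operators\<close>

definition nullity :: "'a::complex_banach set \<Rightarrow> ('a \<Rightarrow> 'a) \<Rightarrow> enat" where
  "nullity M S = qdim (kerM M S) {0}"

definition deficiency :: "'a::complex_banach set \<Rightarrow> ('a \<Rightarrow> 'a) \<Rightarrow> enat" where
  "deficiency M S = qdim M (S ` M)"

abbreviation shift :: "('a::complex_banach \<Rightarrow> 'a) \<Rightarrow> complex \<Rightarrow> 'a \<Rightarrow> 'a" where
  "shift T \<mu> \<equiv> (\<lambda>x. T x - \<mu> *\<^sub>C x)"

lemma bounded_clinear_shift: assumes "bounded_clinear T" shows "bounded_clinear (shift T \<mu>)"
  using assms bounded_linear_scaleC_right unfolding bounded_clinear_def
  by (auto intro: bounded_linear_sub simp: cvs.scale_right_diff_distrib scaleC_scaleC mult.commute)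

lemma bounded_clinear_compose: "bounded_clinear S \<Longrightarrow> bounded_clinear T \<Longrightarrow> bounded_clinear (\<lambda>x. S (T x))"
  unfolding bounded_clinear_def by (auto intro: bounded_linear_compose)

lemma bounded_clinear_funpow: "bounded_clinear S \<Longrightarrow> bounded_clinear (S ^^ n)"
proof (induction n)
  case 0
  show ?case by (simp add: bounded_clinear_def id_def)
next
  case (Suc n)
  then show ?case using bounded_clinear_compose[of S "S ^^ n"] by (simp add: o_def)
qed

lemma bounded_clinear_simps:
  assumes "bounded_clinear S"
  shows "S (x + y) = S x + S y" "S (x - y) = S x - S y" "S 0 = 0" "S (- x) = - S x" "S (a *\<^sub>C x) = a *\<^sub>C S x"
  using assms linear_simps[OF bounded_clinear_bl[OF assms]] by (auto simp: bounded_clinear_def)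

lemma shift_invariant: "csubspace M \<Longrightarrow> S ` M \<subseteq> M \<Longrightarrow> shift S \<mu> ` M \<subseteq> M"
  by (auto intro!: csubspace_diff csubspace_scale)

lemma funpow_invariant: "S ` M \<subseteq> M \<Longrightarrow> (S ^^ n) ` M \<subseteq> M"
  by (induction n) auto

text \<open>If \<open>S ^^ Suc n\<close> kills \<open>x\<close>, then \<open>(S ^^ n) x\<close> is
  in the kernel of \<open>S\<close>, hence of the form \<open>(S ^^ (n + m)) z\<close>, and
  \<open>S ^^ n\<close> kills \<open>x - (S ^^ m) z\<close>. With \<open>m = 1\<close> this lets
  kernel vectors be lifted through \<open>S\<close> indefinitely.\<close>

lemma kato_funpow_kernel:
  assumes S: "bounded_clinear S" and M: "csubspace M" and inv: "S ` M \<subseteq> M" and kato: "kato_on M S"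
  shows "x \<in> M \<Longrightarrow> (S ^^ n) x = 0 \<Longrightarrow> x \<in> (S ^^ m) ` M"
proof (induction n arbitrary: x m)
  case 0
  then show ?case using csubspace_0[OF csubspace_image[OF M bounded_clinear_on[OF bounded_clinear_funpow[OF S]]]] by simp
next
  case (Suc n)
  have "(S ^^ n) x \<in> kerM M S" using Suc.prems funpow_invariant[OF inv, of n] by (auto simp: kerM_def)
  then have "(S ^^ n) x \<in> (S ^^ (n + m)) ` M" using kato by (auto simp: kato_on_def)
  then obtain z where z: "z \<in> M" "(S ^^ n) x = (S ^^ n) ((S ^^ m) z)" by (auto simp: funpow_add)
  let ?w = "x - (S ^^ m) z"
  have mz: "(S ^^ m) z \<in> M" using z funpow_invariant[OF inv] by blast
  have "(S ^^ n) ?w = 0" using z by (simp add: bounded_clinear_simps[OF bounded_clinear_funpow[OF S]])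
  then have "?w \<in> (S ^^ m) ` M" using Suc.IH csubspace_diff[OF M Suc.prems(1) mz] by blast
  then have "?w + (S ^^ m) z \<in> (S ^^ m) ` M"
    using z by (intro csubspace_add csubspace_image[OF M bounded_clinear_on] bounded_clinear_funpow S) auto
  then show ?case by simp
qed

text \<open>A kernel vector \<open>x 0\<close> of \<open>S\<close> is continued to the kernel vector
  \<open>\<Sum>n. l ^ n x n\<close> of \<open>S - l\<close>, where \<open>S (x (n + 1)) = x n\<close>.\<close>

lemma kato_kernel_gap:
  assumes S: "bounded_clinear S" and M: "csubspace M" "closed M" and inv: "S ` M \<subseteq> M" and kato: "kato_on M S"
    and C: "C > 0" "\<And>y. y \<in> S ` M \<Longrightarrow> \<exists>x\<in>M. S x = y \<and> norm x \<le> C * norm y"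
    and l: "C * cmod l \<le> 1/2"
  shows "gap_le (kerM M S) (kerM M (shift S l)) (2 * (C * cmod l))"
  unfolding gap_le_def
proof
  fix y assume y: "y \<in> kerM M S"
  interpret S: bounded_linear S by (rule bounded_clinear_bl[OF S])
  obtain g where g: "\<And>y. y \<in> S ` M \<Longrightarrow> g y \<in> M \<and> S (g y) = y \<and> norm (g y) \<le> C * norm y"
    using C(2) by metis
  \<comment> \<open>\<open>g\<close> need not be linear; it picks preimages of bounded norm. As
    \<open>S ^^ Suc n\<close> kills \<open>x n\<close>, \<open>kato_funpow_kernel\<close> puts
    \<open>x n\<close> into the range, so the chain never stops.\<close>
  define x where "x n = (g ^^ n) y" for n
  have x: "x n \<in> M \<and> (S ^^ Suc n) (x n) = 0 \<and> norm (x n) \<le> C ^ n * norm y" for n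
  proof (induction n)
    case 0
    then show ?case using y by (simp add: x_def kerM_def)
  next
    case (Suc n)
    then have "x n \<in> (S ^^ 1) ` M" using kato_funpow_kernel[OF S M(1) inv kato, of "x n" "Suc n" 1] by blast
    then have gx: "g (x n) \<in> M" "S (g (x n)) = x n" "norm (g (x n)) \<le> C * norm (x n)" using g by auto
    have "(S ^^ Suc (Suc n)) (x (Suc n)) = (S ^^ Suc n) (S (g (x n)))"
      by (subst funpow_Suc_right) (simp add: x_def)
    also have "\<dots> = 0" using Suc gx by simp
    finally have "(S ^^ Suc (Suc n)) (x (Suc n)) = 0" .
    moreover have "norm (x (Suc n)) \<le> C * (C ^ n * norm y)"
      using gx(3) Suc C(1) by (simp add: x_def) (meson mult_left_mono order_trans less_imp_le)
    ultimately show ?case using gx(1) by (simp add: x_def mult.assoc)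
  qed
  have Sx: "S (x (Suc n)) = x n" for n
  proof -
    have "x n \<in> (S ^^ 1) ` M" using kato_funpow_kernel[OF S M(1) inv kato, of "x n" "Suc n" 1] x by blast
    then show ?thesis using g by (simp add: x_def)
  qed
  define a where "a n = l ^ n *\<^sub>C x n" for n
  have Sa: "S (a (Suc n)) = l *\<^sub>C a n" for n
    by (simp add: a_def bounded_clinear_simps[OF S] Sx scaleC_scaleC)
  have q: "norm (a n) \<le> (C * cmod l) ^ n * norm y" for n
  proof -
    have "norm (a n) = cmod l ^ n * norm (x n)" by (simp add: a_def norm_scaleC norm_power)
    also have "\<dots> \<le> cmod l ^ n * (C ^ n * norm y)" using x by (intro mult_left_mono) auto
    finally show ?thesis by (simp add: power_mult_distrib mult_ac)
  qed
  \<comment> \<open>Only \<open>n\<close> of the \<open>n + 1\<close> factors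
    \<open>C * cmod l\<close> are replaced by \<open>1/2\<close>; the one that is kept makes the gap
    tend to \<open>0\<close> with \<open>l\<close>.\<close>
  have aSuc: "norm (a (Suc n)) \<le> (C * cmod l) * norm y * (1/2) ^ n" for n
  proof -
    have "(C * cmod l) ^ n \<le> (1/2) ^ n" using l C(1) by (intro power_mono) auto
    then have "(C * cmod l) * norm y * (C * cmod l) ^ n \<le> (C * cmod l) * norm y * (1/2) ^ n"
      using C(1) by (intro mult_left_mono) auto
    then show ?thesis using q[of "Suc n"] by (simp add: mult_ac)
  qed
  have geo: "(\<lambda>n. (C * cmod l) * norm y * (1/2) ^ n) sums ((C * cmod l) * norm y * 2)"
    using sums_mult[OF geometric_sums[of "1/2::real"], of "(C * cmod l) * norm y"] by simp
  have "summable (\<lambda>n. a (Suc n))"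
    by (rule summable_comparison_test[OF _ sums_summable[OF geo]]) (use aSuc in auto)
  then have sa: "summable a" by (simp add: summable_Suc_iff)
  let ?u = "suminf a"
  have uM: "?u \<in> M"
    by (rule closed_sequentially[OF M(2) _ summable_LIMSEQ[OF sa]])
      (use x M(1) in \<open>auto simp: a_def intro!: csubspace_sum csubspace_scale\<close>)
  have tail: "(\<Sum>n. a (Suc n)) = ?u - y"
    using suminf_split_head[OF sa] by (simp add: a_def x_def scaleC_one)
  have "S ?u = S (?u - y)" using y by (simp add: bounded_clinear_simps[OF S] kerM_def)
  also have "\<dots> = (\<Sum>n. S (a (Suc n)))"
    unfolding tail[symmetric] using sa by (intro S.suminf) (simp add: summable_Suc_iff)
  also have "\<dots> = l *\<^sub>C ?u"
    unfolding Sa using bounded_linear.suminf[OF bounded_linear_scaleC_right sa, of l] by simp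
  finally have "?u \<in> kerM M (shift S l)" using uM by (simp add: kerM_def)
  moreover have "norm (?u - y) \<le> 2 * (C * cmod l) * norm y"
    using norm_suminf_le[OF aSuc sums_summable[OF geo]] sums_unique[OF geo] unfolding tail by simp
  ultimately show "\<exists>z\<in>kerM M (shift S l). norm (y - z) \<le> 2 * (C * cmod l) * norm y"
    by (metis norm_minus_commute)
qed

text \<open>On the kernel of \<open>shift S l\<close>, \<open>S x = l *\<^sub>C x\<close> is small.
  Subtracting a bounded preimage of it moves \<open>x\<close> only slightly, into the kernel of
  \<open>S\<close>.\<close>

lemma gap_shift_kernel:
  assumes S: "bounded_clinear S" and M: "csubspace M"
    and C: "C > 0" "\<And>y. y \<in> S ` M \<Longrightarrow> \<exists>x\<in>M. S x = y \<and> norm x \<le> C * norm y"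
  shows "gap_le (kerM M (shift S l)) (kerM M S) (C * cmod l)"
  unfolding gap_le_def
proof
  fix x assume x: "x \<in> kerM M (shift S l)"
  then have xM: "x \<in> M" "S x = l *\<^sub>C x" by (auto simp: kerM_def)
  then obtain v where v: "v \<in> M" "S v = S x" "norm v \<le> C * norm (S x)" using C(2) by blast
  have "x - v \<in> kerM M S" using v xM csubspace_diff[OF M] by (simp add: kerM_def bounded_clinear_simps[OF S])
  moreover have "norm (x - (x - v)) \<le> C * cmod l * norm x" using v xM by (simp add: norm_scaleC mult.assoc)
  ultimately show "\<exists>z\<in>kerM M S. norm (x - z) \<le> C * cmod l * norm x" by blast
qed

text \<open>The constant is the same for all small \<open>l\<close>. Given a solution
  \<open>x\<close>, split off a bounded \<open>S\<close>-preimage \<open>v\<close> of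
  \<open>S x\<close>; the rest lies in the kernel of \<open>S\<close>, hence near a kernel vector
  \<open>u\<close> of \<open>shift S l\<close>. Replacing \<open>x\<close> by \<open>x - u\<close>
  halves the norm up to a multiple of \<open>norm y\<close>.\<close>

lemma kato_shift_bounded_preimages:
  assumes S: "bounded_clinear S" and M: "csubspace M" "closed M" and inv: "S ` M \<subseteq> M" and kato: "kato_on M S"
    and C: "C > 0" "\<And>y. y \<in> S ` M \<Longrightarrow> \<exists>x\<in>M. S x = y \<and> norm x \<le> C * norm y"
    and l: "C * cmod l \<le> 1/16" and y: "y \<in> shift S l ` M"
  shows "\<exists>x\<in>M. shift S l x = y \<and> norm x \<le> 5 * C * norm y"
proof (cases "y = 0")
  case True
  then show ?thesis using csubspace_0[OF M(1)] by (intro bexI[of _ 0]) (auto simp: bounded_clinear_simps[OF S])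
next
  case False
  have step: "\<exists>x'\<in>M. shift S l x' = y \<and> norm x' \<le> norm x / 2 + 2 * C * norm y"
    if x: "x \<in> M" "shift S l x = y" for x
  proof -

    have arith: "a \<le> p / 2 + 2 * w"
      if "a \<le> b + d" "0 \<le> w" "d \<le> (p + b) / 8" "b \<le> p / 16 + w" "0 \<le> p" for a b d w p :: real
    proof -
      have "8 * a \<le> 9 * b + p" using that(1,3) by (simp add: field_simps)
      moreover have "16 * b \<le> p + 16 * w" using that(4) by (simp add: field_simps)
      ultimately show ?thesis using that(2,5) by (simp add: field_simps)
    qed
    have Sx: "S x = l *\<^sub>C x + y" using x(2) by (simp add: algebra_simps)
    obtain v where v: "v \<in> M" "S v = S x" "norm v \<le> C * norm (S x)" using C(2) x(1) by blast
    have "norm (S x) \<le> cmod l * norm x + norm y" unfolding Sx by (metis norm_scaleC norm_triangle_ineq)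
    then have "norm v \<le> C * (cmod l * norm x + norm y)" using v(3) C(1) by (meson mult_left_mono order_trans less_imp_le)
    then have vle: "norm v \<le> norm x / 16 + C * norm y"
      using mult_right_mono[OF l norm_ge_zero[of x]] by (simp add: algebra_simps)
    let ?x0 = "x - v"
    have "?x0 \<in> kerM M S" using v x csubspace_diff[OF M(1)] by (simp add: kerM_def bounded_clinear_simps[OF S])
    then obtain u where u: "u \<in> kerM M (shift S l)" "norm (?x0 - u) \<le> 2 * (C * cmod l) * norm ?x0"
      using gap_leD[OF kato_kernel_gap[OF S M inv kato C, of l]] l by auto
    have "2 * (C * cmod l) * norm ?x0 \<le> 1/8 * (norm x + norm v)"
      using l norm_triangle_ineq4[of x v] by (intro mult_mono) auto
    then have d: "norm (?x0 - u) \<le> (norm x + norm v) / 8" using u(2) by simp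
    have "x - u = v + (?x0 - u)" by simp
    then have "norm (x - u) \<le> norm v + norm (?x0 - u)" by (metis norm_triangle_ineq)
    moreover have "0 \<le> C * norm y" using C(1) by simp
    ultimately have "norm (x - u) \<le> norm x / 2 + 2 * (C * norm y)"
      using d vle norm_ge_zero[of x] by (rule arith)
    then have "norm (x - u) \<le> norm x / 2 + 2 * C * norm y" by (simp add: mult.assoc)
    moreover have "x - u \<in> M" using x u csubspace_diff[OF M(1)] by (simp add: kerM_def)
    moreover have "shift S l (x - u) = y"
      using x(2) u(1) by (simp add: kerM_def bounded_clinear_simps[OF S] cvs.scale_right_diff_distrib algebra_simps)
    ultimately show ?thesis by blast
  qed
  obtain x where x: "x \<in> M" "shift S l x = y" using y by blast
  \<comment> \<open>\<open>4 * C * norm y\<close> is the fixed point of the map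
    \<open>t / 2 + 2 * C * norm y\<close> of \<open>t\<close>. Since \<open>y \<noteq> 0\<close>,
    finitely many rounds bring the excess below \<open>C * norm y\<close>, whence the constant
    5.\<close>
  have iter: "\<exists>x'\<in>M. shift S l x' = y \<and> norm x' \<le> norm x * (1/2) ^ n + 4 * C * norm y" for n
  proof (induction n)
    case 0
    then show ?case using x C(1) by (intro bexI[of _ x]) auto
  next
    case (Suc n)
    then obtain x1 where x1: "x1 \<in> M" "shift S l x1 = y" "norm x1 \<le> norm x * (1/2) ^ n + 4 * C * norm y" by blast
    then obtain x2 where x2: "x2 \<in> M" "shift S l x2 = y" "norm x2 \<le> norm x1 / 2 + 2 * C * norm y"
      using step by blast
    then have "norm x2 \<le> norm x * (1/2) ^ Suc n + 4 * C * norm y" using x1(3) by simp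
    then show ?case using x2 by blast
  qed
  have "(\<lambda>n. norm x * (1/2) ^ n) \<longlonglongrightarrow> norm x * 0"
    by (intro tendsto_mult tendsto_const LIMSEQ_power_zero) simp
  moreover have "0 < C * norm y" using C(1) False by simp
  ultimately have "\<forall>\<^sub>F n in sequentially. norm x * (1/2) ^ n < C * norm y" by (intro order_tendstoD(2)) auto
  then obtain n where n: "norm x * (1/2) ^ n < C * norm y" using eventually_happens' sequentially_bot by blast
  obtain x' where "x' \<in> M" "shift S l x' = y" "norm x' \<le> norm x * (1/2) ^ n + 4 * C * norm y" using iter by blast
  with n show ?thesis by (intro bexI[of _ x']) auto
qed

theorem kato_stable:
  assumes S: "bounded_clinear S" and M: "csubspace M" "closed M" and inv: "S ` M \<subseteq> M" and kato: "kato_on M S"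
  obtains \<epsilon> where "\<epsilon> > 0"
    "\<And>l. cmod l < \<epsilon> \<Longrightarrow> closed (shift S l ` M) \<and>
       nullity M (shift S l) = nullity M S \<and> deficiency M (shift S l) = deficiency M S"
proof -
  have cl: "closed (S ` M)" using kato by (simp add: kato_on_def)
  obtain C where C: "C > 0" "\<And>y. y \<in> S ` M \<Longrightarrow> \<exists>x\<in>M. S x = y \<and> norm x \<le> C * norm y"
    using open_mapping_closed_range[OF bounded_clinear_bl[OF S] csubspace_imp_subspace[OF M(1)] M(2) cl] by metis
  have lin: "bounded_clinear (shift S l)" for l by (rule bounded_clinear_shift[OF S])
  have ker: "csubspace (kerM M (shift S l))" "csubspace (kerM M S)" for l
    using csubspace_ker[OF M(1) bounded_clinear_on[OF lin]] csubspace_ker[OF M(1) bounded_clinear_on[OF S]] by auto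
  have im: "csubspace (shift S l ` M)" "csubspace (S ` M)" for l
    using csubspace_image[OF M(1) bounded_clinear_on[OF lin]] csubspace_image[OF M(1) bounded_clinear_on[OF S]] by auto
  obtain \<epsilon>1 where \<epsilon>1: "\<epsilon>1 > 0"
    "\<And>A' B'. \<lbrakk>csubspace A'; closed A'; csubspace B'; A' \<subseteq> B'; gap_le (kerM M S) B' \<epsilon>1; gap_le B' (kerM M S) \<epsilon>1;
       gap_le {0} A' \<epsilon>1; gap_le A' {0} \<epsilon>1\<rbrakk> \<Longrightarrow> qdim B' A' = qdim (kerM M S) {0}"
    using qdim_stable[OF csubspace_zero closed_singleton ker(2)] csubspace_0[OF ker(2)] by blast
  obtain \<epsilon>2 where \<epsilon>2: "\<epsilon>2 > 0"
    "\<And>A' B'. \<lbrakk>csubspace A'; closed A'; csubspace B'; A' \<subseteq> B'; gap_le M B' \<epsilon>2; gap_le B' M \<epsilon>2;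
       gap_le (S ` M) A' \<epsilon>2; gap_le A' (S ` M) \<epsilon>2\<rbrakk> \<Longrightarrow> qdim B' A' = qdim M (S ` M)"
    using qdim_stable[OF im(2) cl M(1) inv] by blast
  \<comment> \<open>\<open>1/16\<close> is the bound on \<open>C * cmod l\<close> in
    \<open>kato_shift_bounded_preimages\<close>. The gaps between kernels are at most
    \<open>2 * \<delta>\<close>, those between ranges at most \<open>5 * \<delta>\<close>, where 5
    is the constant of that lemma.\<close>
  define \<delta> where "\<delta> = min (1/16) (min (\<epsilon>1 / 2) (\<epsilon>2 / 5))"
  have \<delta>: "\<delta> > 0" "\<delta> \<le> 1/16" "2 * \<delta> \<le> \<epsilon>1" "5 * \<delta> \<le> \<epsilon>2" using \<epsilon>1(1) \<epsilon>2(1) by (auto simp: \<delta>_def)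
  show ?thesis
  proof (rule that[of "\<delta> / C"])
    show "\<delta> / C > 0" using \<delta> C by simp
    fix l assume "cmod l < \<delta> / C"
    then have l: "C * cmod l < \<delta>" using C(1) by (simp add: field_simps)
    have l0: "0 \<le> C * cmod l" using C(1) by simp
    have pre: "\<exists>x\<in>M. shift S l x = y \<and> norm x \<le> 5 * C * norm y" if "y \<in> shift S l ` M" for y
      using kato_shift_bounded_preimages[OF S M inv kato C _ that] l \<delta>(2) by simp
    have cl': "closed (shift S l ` M)"
      by (rule closed_range_of_bounded_preimages[OF bounded_clinear_bl[OF lin] csubspace_imp_subspace[OF M(1)] M(2) _ pre])
        (use C(1) in auto)
    have "gap_le (kerM M S) (kerM M (shift S l)) \<epsilon>1"
      by (rule gap_le_mono[OF kato_kernel_gap[OF S M inv kato C]]) (use l \<delta> in auto)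
    moreover have "gap_le (kerM M (shift S l)) (kerM M S) \<epsilon>1"
      by (rule gap_le_mono[OF gap_shift_kernel[OF S M(1) C]]) (use l \<delta> in auto)
    ultimately have n: "nullity M (shift S l) = nullity M S"
      unfolding nullity_def using ker(1)[of l] csubspace_0[OF ker(1)] \<epsilon>1(1)
      by (intro \<epsilon>1(2)) (auto simp: csubspace_zero intro: gap_le_refl)
    have "gap_le (S ` M) (shift S l ` M) \<epsilon>2"
      unfolding gap_le_def
    proof
      fix y assume "y \<in> S ` M"
      then obtain x where x: "x \<in> M" "S x = y" "norm x \<le> C * norm y" using C(2) by blast
      have "norm (y - shift S l x) = cmod l * norm x" using x by (simp add: norm_scaleC)
      also have "\<dots> \<le> cmod l * (C * norm y)" using x by (intro mult_left_mono) auto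
      also have "\<dots> = (C * cmod l) * norm y" by simp
      also have "\<dots> \<le> \<epsilon>2 * norm y" using l \<delta> by (intro mult_right_mono) auto
      finally show "\<exists>z\<in>shift S l ` M. norm (y - z) \<le> \<epsilon>2 * norm y" using x(1) by blast
    qed
    moreover have "gap_le (shift S l ` M) (S ` M) \<epsilon>2"
      unfolding gap_le_def
    proof
      fix y assume "y \<in> shift S l ` M"
      then obtain x where x: "x \<in> M" "shift S l x = y" "norm x \<le> 5 * C * norm y" using pre by blast
      have "y - S x = - (l *\<^sub>C x)" using x by auto
      then have "norm (y - S x) = cmod l * norm x" by (simp only: norm_minus_cancel norm_scaleC)
      also have "\<dots> \<le> cmod l * (5 * C * norm y)" using x by (intro mult_left_mono) auto
      also have "\<dots> = 5 * (C * cmod l) * norm y" by simp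
      also have "\<dots> \<le> \<epsilon>2 * norm y" using l \<delta> by (intro mult_right_mono) auto
      finally show "\<exists>z\<in>S ` M. norm (y - z) \<le> \<epsilon>2 * norm y" using x(1) by blast
    qed
    ultimately have "deficiency M (shift S l) = deficiency M S"
      unfolding deficiency_def using im(1)[of l] cl' M(1) shift_invariant[OF M(1) inv, of l] \<epsilon>2(1)
      by (intro \<epsilon>2(2)) (auto intro: gap_le_refl)
    with n cl' show "closed (shift S l ` M) \<and>
       nullity M (shift S l) = nullity M S \<and> deficiency M (shift S l) = deficiency M S" by blast
  qed
qed

subsection \<open>Invariant direct sums\<close>

definition direct_sum :: "'a::complex_banach set \<Rightarrow> 'a set \<Rightarrow> 'a set \<Rightarrow> bool" where
  "direct_sum M A B \<longleftrightarrow> csubspace A \<and> csubspace B \<and> A \<inter> B = {0} \<and> M = ssum A B"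

lemma direct_sum_csubspace: "direct_sum M A B \<Longrightarrow> csubspace M"
  by (auto simp: direct_sum_def csubspace_ssum)

lemma direct_sum_subset: "direct_sum M A B \<Longrightarrow> A \<subseteq> M \<and> B \<subseteq> M"
  unfolding direct_sum_def using subset_ssum_left subset_ssum_right csubspace_0 by metis

lemma direct_sum_commute: "direct_sum M A B \<Longrightarrow> direct_sum M B A"
  unfolding direct_sum_def using ssum_commute by blast

text \<open>This regrouping moves a summand from one side of a decomposition to the other.\<close>

lemma direct_sum_assoc:
  assumes "direct_sum M A B" "direct_sum A A1 A2" shows "direct_sum M A1 (ssum A2 B)" "direct_sum (ssum A2 B) A2 B"
proof -
  have sub: "csubspace A" "csubspace A1" "csubspace A2" "csubspace B" "A1 \<subseteq> A" "A2 \<subseteq> A"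
    using assms direct_sum_subset[OF assms(2)] by (auto simp: direct_sum_def csubspace_ssum)
  have int: "A \<inter> B = {0}" "A1 \<inter> A2 = {0}" using assms by (auto simp: direct_sum_def)
  have "x = 0" if x: "x \<in> A1" "x \<in> ssum A2 B" for x
  proof -
    obtain a b where ab: "a \<in> A2" "b \<in> B" "x = a + b" using x(2) by (rule ssumE)
    have "b = x - a" using ab by simp
    then have "b \<in> A" using x ab sub csubspace_diff[OF sub(1)] by blast
    then have "b = 0" using ab int by blast
    then show ?thesis using x ab int by auto
  qed
  moreover have "0 \<in> A1" "0 \<in> ssum A2 B" using csubspace_0 csubspace_ssum sub by blast+
  ultimately have "A1 \<inter> ssum A2 B = {0}" by blast
  moreover have "M = ssum A1 (ssum A2 B)" using assms by (simp add: direct_sum_def ssum_assoc)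
  ultimately show "direct_sum M A1 (ssum A2 B)" using sub by (simp add: direct_sum_def csubspace_ssum)
  have "A2 \<inter> B = {0}" using int sub csubspace_0[OF sub(3)] by blast
  then show "direct_sum (ssum A2 B) A2 B" using sub by (simp add: direct_sum_def)
qed

lemma direct_sum_decomp:
  assumes "direct_sum M A B" "a \<in> A" "b \<in> B" "a + b \<in> A" shows "b = 0"
proof -
  have "b \<in> A" using assms csubspace_add_iff unfolding direct_sum_def by blast
  then show ?thesis using assms unfolding direct_sum_def by blast
qed

lemma direct_sum_kernel:
  assumes S: "bounded_clinear S" and d: "direct_sum M A B" and inv: "S ` A \<subseteq> A" "S ` B \<subseteq> B"
  shows "kerM M S = ssum (kerM A S) (kerM B S)"
proof (intro set_eqI iffI)
  fix x assume x: "x \<in> kerM M S"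
  then obtain a b where ab: "a \<in> A" "b \<in> B" "x = a + b" using d unfolding kerM_def direct_sum_def ssum_def by blast
  have "S a + S b = 0" using x ab by (simp add: kerM_def bounded_clinear_simps[OF S])
  then have "S b = 0" using direct_sum_decomp[OF d, of "S a" "S b"] ab inv csubspace_0[of A] d
    by (auto simp: direct_sum_def)
  then have "S a = 0" using \<open>S a + S b = 0\<close> by simp
  with \<open>S b = 0\<close> ab show "x \<in> ssum (kerM A S) (kerM B S)" by (auto simp: ssum_def kerM_def)
next
  fix x assume "x \<in> ssum (kerM A S) (kerM B S)"
  then obtain a b where ab: "a \<in> A" "S a = 0" "b \<in> B" "S b = 0" "x = a + b"
    unfolding ssum_def kerM_def by blast
  then have "x \<in> M" using d ssumI unfolding direct_sum_def by metis
  then show "x \<in> kerM M S" using ab by (simp add: kerM_def bounded_clinear_simps[OF S])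
qed

lemma direct_sum_image:
  assumes S: "bounded_clinear S" and d: "direct_sum M A B"
  shows "S ` M = ssum (S ` A) (S ` B)"
proof (intro set_eqI iffI)
  fix y assume "y \<in> S ` M"
  then obtain a b where "a \<in> A" "b \<in> B" "y = S (a + b)" using d unfolding direct_sum_def ssum_def by blast
  then show "y \<in> ssum (S ` A) (S ` B)" by (simp add: bounded_clinear_simps[OF S] ssumI)
next
  fix y assume "y \<in> ssum (S ` A) (S ` B)"
  then obtain a b where "a \<in> A" "b \<in> B" "y = S (a + b)" by (auto simp: ssum_def bounded_clinear_simps[OF S])
  then show "y \<in> S ` M" using d by (auto simp: direct_sum_def ssum_def)
qed

lemma direct_sum_invariant:
  assumes S: "bounded_clinear S" and d: "direct_sum M A B" and inv: "S ` A \<subseteq> A" "S ` B \<subseteq> B"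
  shows "S ` M \<subseteq> M"
  using direct_sum_image[OF S d] ssum_mono[OF inv] d by (simp add: direct_sum_def)

lemma csubspace_kernel: "bounded_clinear S \<Longrightarrow> csubspace M \<Longrightarrow> csubspace (kerM M S)"
  by (rule csubspace_ker[OF _ bounded_clinear_on])

lemma csubspace_range: "bounded_clinear S \<Longrightarrow> csubspace M \<Longrightarrow> csubspace (S ` M)"
  by (rule csubspace_image[OF _ bounded_clinear_on])

lemma direct_sum_nullity:
  assumes S: "bounded_clinear S" and d: "direct_sum M A B" and inv: "S ` A \<subseteq> A" "S ` B \<subseteq> B"
  shows "nullity M S = nullity A S + nullity B S"
proof -
  have sub: "csubspace A" "csubspace B" "A \<inter> B = {0}" using d by (auto simp: direct_sum_def)
  have k: "csubspace (kerM A S)" "csubspace (kerM B S)" using csubspace_kernel[OF S] sub by auto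
  have "qdim (ssum (kerM A S) (kerM B S)) (ssum {0} {0}) = qdim (kerM A S) {0} + qdim (kerM B S) {0}"
    using sub k csubspace_0[OF k(1)] csubspace_0[OF k(2)]
    by (intro qdim_ssum csubspace_zero) (auto simp: kerM_def)
  then show ?thesis unfolding nullity_def direct_sum_kernel[OF assms] by (simp add: ssum_zero)
qed

lemma direct_sum_deficiency:
  assumes S: "bounded_clinear S" and d: "direct_sum M A B" and inv: "S ` A \<subseteq> A" "S ` B \<subseteq> B"
  shows "deficiency M S = deficiency A S + deficiency B S"
proof -
  have sub: "csubspace A" "csubspace B" "A \<inter> B = {0}" using d by (auto simp: direct_sum_def)
  have "qdim (ssum A B) (ssum (S ` A) (S ` B)) = qdim A (S ` A) + qdim B (S ` B)"
    using sub inv csubspace_range[OF S] by (intro qdim_ssum) auto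
  then show ?thesis unfolding deficiency_def direct_sum_image[OF S d] using d by (simp add: direct_sum_def)
qed

lemma direct_sum_closed_parts:
  assumes S: "bounded_clinear S" and d: "direct_sum M A B" and cl: "closed A" "closed B" "closed M"
    and inv: "S ` A \<subseteq> A" "S ` B \<subseteq> B" and im: "closed (S ` A)" "closed (S ` B)"
  shows "closed (S ` M)"
proof -
  have sub: "csubspace A" "csubspace B" "A \<inter> B = {0}" "M = ssum A B" using d by (auto simp: direct_sum_def)
  show ?thesis
    unfolding direct_sum_image[OF S d]
    by (rule closed_ssum_subspaces[OF sub(1) cl(1) sub(2) cl(2) sub(3) cl(3)[unfolded sub(4)]
          csubspace_range[OF S sub(1)] im(1) inv(1) csubspace_range[OF S sub(2)] im(2) inv(2)])
qed

lemma nullity_eq_0_iff: "nullity M S = 0 \<longleftrightarrow> kerM M S \<subseteq> {0}"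
  unfolding nullity_def by (rule qdim_eq_0_iff[OF csubspace_zero])

lemma deficiency_eq_0_iff:
  "bounded_clinear S \<Longrightarrow> csubspace M \<Longrightarrow> deficiency M S = 0 \<longleftrightarrow> M \<subseteq> S ` M"
  unfolding deficiency_def by (rule qdim_eq_0_iff[OF csubspace_range])

subsection \<open>Kato decomposition of semi-Fredholm operators\<close>

text \<open>\<open>W\<close> plus the finite-dimensional kernel is closed and has the same image as
  \<open>W\<close>. Bounded preimages \<open>z n\<close> of \<open>y n - l\<close> tend to
  \<open>0\<close>, so \<open>x + z n\<close> is a sequence in this sum that converges to a preimage
  \<open>x\<close> of the limit.\<close>

lemma closed_image_of_closed_subspace:
  assumes S: "bounded_clinear S" and M: "csubspace M" "closed M" and cl: "closed (S ` M)"
    and fin: "nullity M S \<noteq> \<infinity>" and W: "csubspace W" "closed W" "W \<subseteq> M"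
  shows "closed (S ` W)"
proof -
  interpret S: bounded_linear S by (rule bounded_clinear_bl[OF S])
  obtain C where C: "C > 0" "\<And>y. y \<in> S ` M \<Longrightarrow> \<exists>x\<in>M. S x = y \<and> norm x \<le> C * norm y"
    using open_mapping_closed_range[OF bounded_clinear_bl[OF S] csubspace_imp_subspace[OF M(1)] M(2) cl] by metis
  have ker: "csubspace (kerM M S)" using csubspace_kernel[OF S M(1)] .
  have clWk: "closed (ssum W (kerM M S))"
    using closed_ssum_qdim_finite[OF W(1,2) ker] fin by (simp add: nullity_def)
  show ?thesis
    unfolding closed_sequential_limits
  proof (intro allI impI, elim conjE)
    fix y l assume y: "\<forall>n. y n \<in> S ` W" and l: "y \<longlonglongrightarrow> l"
    have "\<forall>n. y n \<in> S ` M" using y W(3) by blast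
    then have "l \<in> S ` M" using closed_sequentially[OF cl _ l] by blast
    then obtain x where x: "x \<in> M" "S x = l" by blast
    have "\<exists>w. w \<in> W \<and> S w = y n" for n using y[rule_format, of n] by auto
    then obtain w where w: "\<And>n. w n \<in> W" "\<And>n. S (w n) = y n" by metis
    have "y n - l \<in> S ` M" for n
      using w x W(3) csubspace_range[OF S M(1)] by (metis csubspace_diff image_eqI subsetD)
    then have "\<exists>z. z \<in> M \<and> S z = y n - l \<and> norm z \<le> C * norm (y n - l)" for n
      using C(2)[of "y n - l"] by blast
    then obtain z where z: "\<And>n. z n \<in> M" "\<And>n. S (z n) = y n - l" "\<And>n. norm (z n) \<le> C * norm (y n - l)"
      by metis
    have "(\<lambda>n. C * norm (y n - l)) \<longlonglongrightarrow> 0"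
      using l by (intro tendsto_mult_right_zero tendsto_norm_zero) (simp add: LIM_zero)
    then have z0: "z \<longlonglongrightarrow> 0" by (rule Lim_null_comparison[rotated]) (simp add: z(3))
    have "x + z n \<in> ssum W (kerM M S)" for n
    proof -
      have "x + z n - w n \<in> M" using x z w W(3) M(1) by (blast intro: csubspace_add csubspace_diff)
      then have "x + z n - w n \<in> kerM M S" by (simp add: kerM_def S.add S.diff x z w)
      then have "w n + (x + z n - w n) \<in> ssum W (kerM M S)" using w(1) by (intro ssumI)
      then show ?thesis by simp
    qed
    moreover have "(\<lambda>n. x + z n) \<longlonglongrightarrow> x" using tendsto_add[OF tendsto_const z0, of x] by simp
    ultimately have "x \<in> ssum W (kerM M S)" by (rule closed_sequentially[OF clWk])
    then obtain v k where "v \<in> W" "k \<in> kerM M S" "x = v + k" by (rule ssumE)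
    then show "l \<in> S ` W" using x by (auto simp: kerM_def S.add)
  qed
qed

text \<open>With finite nullity, each range is the image of the previous closed one. Otherwise the
  deficiency is finite, each further power loses at most that much codimension, and a range of
  finite codimension is closed.\<close>

lemma closed_range_funpow:
  assumes S: "bounded_clinear S" and M: "csubspace M" "closed M" and inv: "S ` M \<subseteq> M" and cl: "closed (S ` M)"
    and fin: "nullity M S \<noteq> \<infinity> \<or> deficiency M S \<noteq> \<infinity>"
  shows "closed ((S ^^ k) ` M)"
proof (cases "nullity M S = \<infinity>")
  case False
  have "csubspace ((S ^^ k) ` M)" for k by (rule csubspace_range[OF bounded_clinear_funpow[OF S] M(1)])
  then show ?thesis
  proof (induction k)
    case (Suc k)
    have "closed (S ` (S ^^ k) ` M)"
      using False Suc funpow_invariant[OF inv] by (intro closed_image_of_closed_subspace[OF S M cl]) auto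
    then show ?case by (simp add: image_comp)
  qed (simp add: M)
next
  case True
  then have fin: "qdim M (S ` M) \<noteq> \<infinity>" using fin by (simp add: deficiency_def)
  have sub: "csubspace ((S ^^ k) ` M)" for k by (rule csubspace_range[OF bounded_clinear_funpow[OF S] M(1)])
  have "qdim M ((S ^^ k) ` M) \<noteq> \<infinity>" for k
  proof (induction k)
    case 0
    have "qdim M M = 0" using qdim_eq_0_iff[OF M(1)] by blast
    then show ?case by simp
  next
    case (Suc k)
    have eq: "(S ^^ Suc k) ` M = (S ^^ k) ` S ` M" by (simp add: image_comp funpow_Suc_right del: funpow.simps)
    have le: "(S ^^ Suc k) ` M \<subseteq> (S ^^ k) ` M" unfolding eq using inv by blast
    have "qdim M ((S ^^ Suc k) ` M) = qdim M ((S ^^ k) ` M) + qdim ((S ^^ k) ` M) ((S ^^ Suc k) ` M)"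
      using funpow_invariant[OF inv] by (intro qdim_tower sub M le) auto
    moreover have "qdim ((S ^^ k) ` M) ((S ^^ Suc k) ` M) \<le> qdim M (S ` M)"
      unfolding eq by (rule qdim_image_le[OF M(1) bounded_clinear_on[OF bounded_clinear_funpow[OF S]] inv])
    ultimately show ?case using Suc fin by (metis enat_ord_simps(5) plus_eq_infty_iff_enat)
  qed
  then show ?thesis
    by (intro closed_range_of_finite_codim bounded_clinear_funpow S M funpow_invariant inv)
qed

text \<open>If \<open>u = S ^ (k - 1) v\<close> lies in the kernel but not in the closed range of \<open>S ^ k\<close>, and \<open>f\<close>
  is a functional which vanishes on that range with \<open>f u = 1\<close>, then the Jordan chain of \<open>v\<close> spans an
  invariant subspace whose complement, the common kernel of the functionals \<open>f \<circ> S ^ j\<close>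
  with \<open>j < k\<close>, is invariant as well.\<close>

lemma split_Jordan_block:
  assumes S: "bounded_clinear S" and M: "csubspace M" "closed M" and inv: "S ` M \<subseteq> M"
    and cl: "\<And>k. closed ((S ^^ k) ` M)" and nk: "\<not> kato_on M S"
  obtains Z Y where "direct_sum M Z Y" "closed Z" "S ` Z \<subseteq> Z" "S ` Y \<subseteq> Y" "qdim Y {0} \<noteq> \<infinity>"
    "nullity Y S \<noteq> 0" "\<And>\<mu>. \<mu> \<noteq> 0 \<Longrightarrow> nullity Y (shift S \<mu>) = 0"
proof -
  have "\<exists>k. \<not> kerM M S \<subseteq> (S ^^ k) ` M" using nk cl[of 1] by (simp add: kato_on_def)
  \<comment> \<open>Minimality puts the kernel into the range of \<open>S ^^ (k - 1)\<close>, which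
    supplies the first vector \<open>v\<close> of the chain.\<close>
  define k where "k = (LEAST k. \<not> kerM M S \<subseteq> (S ^^ k) ` M)"
  have k: "\<not> kerM M S \<subseteq> (S ^^ k) ` M" unfolding k_def by (rule LeastI_ex) fact
  have least: "kerM M S \<subseteq> (S ^^ j) ` M" if "j < k" for j using not_less_Least[of j] that unfolding k_def by blast
  have "k \<noteq> 0" using k by (intro notI) (simp add: kerM_def)
  then obtain m where m: "k = Suc m" by (cases k) auto
  obtain u where u: "u \<in> M" "S u = 0" "u \<notin> (S ^^ k) ` M" using k by (auto simp: kerM_def)
  then have "u \<in> (S ^^ m) ` M" using least[of m] m by (auto simp: kerM_def)
  then obtain v where v: "v \<in> M" "u = (S ^^ m) v" by blast
  have pow: "bounded_clinear (S ^^ j)" for j by (rule bounded_clinear_funpow[OF S])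
  note ps = bounded_clinear_simps[OF pow]
  have inv': "(S ^^ j) x \<in> M" if "x \<in> M" for j x using funpow_invariant[OF inv] that by blast
  obtain f :: "'a \<Rightarrow> complex" where f: "bounded_linear f" "\<And>a x. f (a *\<^sub>C x) = a * f x"
    "f u = 1" "\<And>x. x \<in> (S ^^ k) ` M \<Longrightarrow> f x = 0"
    using ex_separating_functional[OF csubspace_range[OF pow M(1)] cl u(3)] by metis
  interpret f: bounded_linear f by (rule f(1))
  have fhigh: "f ((S ^^ j) x) = 0" if "x \<in> M" "k \<le> j" for x j
  proof -
    have "(S ^^ j) x = (S ^^ k) ((S ^^ (j - k)) x)" using that(2) by (simp flip: comp_apply[of "S ^^ k"] funpow_add)
    then show ?thesis using f(4) inv'[OF that(1)] by auto
  qed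
  define c where "c i = (S ^^ i) v" for i
  define Y where "Y = lspan k c"
  define Z where "Z = {x \<in> M. \<forall>j<k. f ((S ^^ j) x) = 0}"
  have cM: "c i \<in> M" for i unfolding c_def by (rule inv'[OF v(1)])
  have YM: "Y \<subseteq> M" unfolding Y_def by (rule lspan_subset[OF M(1) cM])
  have Y: "csubspace Y" unfolding Y_def by (rule csubspace_lspan)
  have Z: "csubspace Z"
    unfolding csubspace_def Z_def using M(1)
    by (auto simp: csubspace_0 csubspace_add csubspace_scale ps f f.add f.zero)
  have ck: "c j = 0" if "k \<le> j" for j
  proof -
    have "(S ^^ j) v = (S ^^ (j - k)) (S u)"
    proof -
      have "S u = (S ^^ k) v" using v m by simp
      moreover have "(S ^^ j) v = (S ^^ ((j - k) + k)) v" using that by simp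
      ultimately show ?thesis by (simp only: funpow_add o_apply)
    qed
    then show ?thesis by (simp add: c_def u ps)
  qed
  have Spow: "(S ^^ j) (c i) = c (j + i)" for i j by (simp add: c_def funpow_add)
  have fc: "f (c m) = 1" using f(3) v by (simp add: c_def)
  have fc0: "f (c j) = 0" if "j > m" for j using ck[of j] that m by (simp add: f.zero)
  have int: "x = 0" if x: "x \<in> Z" "x \<in> Y" for x
  proof -
    obtain t where t: "x = lincomb k t c" using x(2) by (auto simp: Y_def lspan_def)
    have ft: "f ((S ^^ j) x) = (\<Sum>i<k. t i * f (c (j + i)))" for j
      unfolding t by (subst clinear_on_lincomb[OF M(1) bounded_clinear_on[OF pow] cM]) (simp add: f.sum f(2) Spow)
    \<comment> \<open>The matrix \<open>f (c (j + i))\<close> is \<open>1\<close> for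
      \<open>i + j = m\<close> and \<open>0\<close> for \<open>i + j > m\<close>. Taking
      \<open>j = m - i\<close> isolates \<open>t i\<close>: smaller indices are settled by
      induction, larger ones contribute \<open>0\<close>.\<close>
    have "t i = 0" if "i < k" for i
      using that
    proof (induction i rule: less_induct)
      case (less i)
      have "(\<Sum>l<k. t l * f (c (m - i + l))) = t i * f (c (m - i + i))"
      proof (rule sum.remove[of "{..<k}" i, THEN trans])
        have "(\<Sum>l\<in>{..<k} - {i}. t l * f (c (m - i + l))) = 0"
        proof (rule sum.neutral, intro ballI)
          fix l assume "l \<in> {..<k} - {i}"
          then consider "l < i" | "l > i" by force
          then show "t l * f (c (m - i + l)) = 0"
          proof cases
            case 1
            then show ?thesis using less by simp
          next
            case 2
            then show ?thesis using fc0[of "m - i + l"] less.prems m by simp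
          qed
        qed
        then show "t i * f (c (m - i + i)) + (\<Sum>l\<in>{..<k} - {i}. t l * f (c (m - i + l))) = t i * f (c (m - i + i))"
          by simp
      qed (use less.prems in auto)
      moreover have "f ((S ^^ (m - i)) x) = 0" using x(1) m by (auto simp: Z_def)
      ultimately show ?case using fc less.prems m ft[of "m - i"] by simp
    qed
    then show ?thesis by (simp add: t)
  qed
  \<comment> \<open>The conditions are met from \<open>j = m\<close> downwards: a multiple of
    \<open>c n\<close> corrects the one at \<open>j = m - n\<close> and does not disturb those at
    larger \<open>j\<close>, where \<open>f (c (j + n)) = 0\<close>.\<close>
  have ex: "\<exists>y\<in>Y. \<forall>j<k. k - n \<le> j \<longrightarrow> f ((S ^^ j) (x - y)) = 0" if x: "x \<in> M" and n: "n \<le> k" for x n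
    using n
  proof (induction n)
    case 0
    then show ?case using csubspace_0[OF Y] by (intro bexI[of _ 0]) auto
  next
    case (Suc n)
    then obtain y where y: "y \<in> Y" "\<And>j. j < k \<Longrightarrow> k - n \<le> j \<Longrightarrow> f ((S ^^ j) (x - y)) = 0" by auto
    define a where "a = f ((S ^^ (k - Suc n)) (x - y))"
    have "c n \<in> Y" unfolding Y_def using Suc.prems by (intro in_lspan) simp
    then have "y + a *\<^sub>C c n \<in> Y" using y Y by (intro csubspace_add csubspace_scale)
    moreover have "f ((S ^^ j) (x - (y + a *\<^sub>C c n))) = 0" if j: "j < k" "k - Suc n \<le> j" for j
    proof -
      have eq: "f ((S ^^ j) (x - (y + a *\<^sub>C c n))) = f ((S ^^ j) (x - y)) - a * f (c (j + n))"
        by (simp add: ps f.diff f.add f Spow)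
      show ?thesis
      proof (cases "j = k - Suc n")
        case True
        then have "j + n = m" using Suc.prems m by simp
        then show ?thesis using eq fc True by (simp add: a_def)
      next
        case False
        then have "k - n \<le> j" "j + n > m" using j Suc.prems m by auto
        then show ?thesis using eq y(2) j fc0 by simp
      qed
    qed
    ultimately show ?case by blast
  qed
  have "M = ssum Z Y"
  proof
    show "M \<subseteq> ssum Z Y"
    proof
      fix x assume x: "x \<in> M"
      obtain y where y: "y \<in> Y" "\<forall>j<k. f ((S ^^ j) (x - y)) = 0" using ex[OF x order_refl] by auto
      then have "x - y \<in> Z" using x YM csubspace_diff[OF M(1)] by (auto simp: Z_def)
      then have "(x - y) + y \<in> ssum Z Y" using y(1) by (rule ssumI)
      then show "x \<in> ssum Z Y" by simp
    qed
    show "ssum Z Y \<subseteq> M" using YM M(1) by (intro ssum_subset) (auto simp: Z_def)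
  qed
  then have "direct_sum M Z Y"
    using Y Z int csubspace_0[OF Y] csubspace_0[OF Z] by (auto simp: direct_sum_def)
  moreover have "closed Z"
  proof -
    have "Z = M \<inter> (\<Inter>j\<in>{..<k}. {x. f ((S ^^ j) x) = 0})" by (auto simp: Z_def)
    moreover have "closed {x. f ((S ^^ j) x) = 0}" for j
      using bounded_linear_compose[OF f(1) bounded_clinear_bl[OF pow]]
      by (intro closed_Collect_eq continuous_on_const linear_continuous_on)
    ultimately show ?thesis using M(2) by (simp add: closed_INT closed_Int)
  qed
  moreover have "S ` Z \<subseteq> Z"
  proof
    fix y assume "y \<in> S ` Z"
    then obtain x where x: "x \<in> M" "\<And>j. j < k \<Longrightarrow> f ((S ^^ j) x) = 0" "y = S x" by (auto simp: Z_def)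
    \<comment> \<open>Applying \<open>S\<close> shifts the conditions by one; the last becomes
      \<open>f ((S ^^ k) x) = 0\<close>, which holds on all of \<open>M\<close>.\<close>
    have "f ((S ^^ Suc j) x) = 0" if "j < k" for j
      using x(2)[of "Suc j"] fhigh[OF x(1), of "Suc j"] that by (cases "Suc j < k") auto
    then have "f ((S ^^ j) (S x)) = 0" if "j < k" for j using that by (simp add: funpow_swap1)
    then show "y \<in> Z" using x inv by (auto simp: Z_def)
  qed
  moreover have "S ` Y \<subseteq> Y"
  proof
    fix y assume "y \<in> S ` Y"
    then obtain t where "y = S (lincomb k t c)" by (auto simp: Y_def lspan_def)
    then have "y = lincomb k t (\<lambda>i. S (c i))" using clinear_on_lincomb[OF M(1) bounded_clinear_on[OF S] cM] by simp
    moreover have "S (c i) \<in> Y" if "i < k" for i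
    proof -
      have "S (c i) = c (Suc i)" by (simp add: c_def)
      then show ?thesis using ck[of "Suc i"] csubspace_0[OF Y] in_lspan[of "Suc i" k c] unfolding Y_def
        by (cases "Suc i < k") auto
    qed
    ultimately show "y \<in> Y" using csubspace_lincomb[OF Y] by simp
  qed
  moreover have "qdim Y {0} \<noteq> \<infinity>"
  proof -
    have "qdim Y {0} \<le> enat k" unfolding Y_def
      by (rule qdim_le[OF csubspace_zero, of _ _ c]) (simp add: ssum_commute[of "{0}"] ssum_zero)
    then show ?thesis by (cases "qdim Y {0}") auto
  qed
  moreover have "nullity Y S \<noteq> 0"
  proof -
    have "u \<in> Y" unfolding Y_def using in_lspan[of m k c] m v by (simp add: c_def)
    moreover have "u \<noteq> 0" using u(3) csubspace_0[OF csubspace_range[OF pow M(1)]] by blast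
    ultimately show ?thesis using u(2) by (auto simp: nullity_eq_0_iff kerM_def)
  qed
  moreover have "nullity Y (shift S \<mu>) = 0" if \<mu>: "\<mu> \<noteq> 0" for \<mu>
    unfolding nullity_eq_0_iff
  proof
    fix x assume "x \<in> kerM Y (shift S \<mu>)"
    then have x: "x \<in> Y" "S x = \<mu> *\<^sub>C x" by (auto simp: kerM_def)
    have "(S ^^ j) x = \<mu> ^ j *\<^sub>C x" for j
      by (induction j) (simp_all add: scaleC_one bounded_clinear_simps[OF S] x scaleC_scaleC mult.commute)
    moreover obtain t where "x = lincomb k t c" using x(1) by (auto simp: Y_def lspan_def)
    then have "(S ^^ k) x = lincomb k t (\<lambda>i. (S ^^ k) (c i))"
      using clinear_on_lincomb[OF M(1) bounded_clinear_on[OF pow] cM] by simp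
    then have "(S ^^ k) x = 0" by (simp add: Spow ck)
    ultimately have "\<mu> ^ k *\<^sub>C x = 0" by simp
    then show "x \<in> {0}" using \<mu> by simp
  qed
  ultimately show ?thesis using that by blast
qed

lemma rank_nullity_deficiency:
  assumes "bounded_clinear S" "csubspace F" "S ` F \<subseteq> F" "qdim F {0} \<noteq> \<infinity>"
  shows "nullity F S = deficiency F S" "nullity F S \<noteq> \<infinity>"
proof -
  show "nullity F S = deficiency F S"
    unfolding nullity_def deficiency_def using assms by (intro rank_nullity bounded_clinear_on)
  have "qdim (kerM F S) {0} \<le> qdim F {0}" by (intro qdim_mono) (auto simp: kerM_def)
  then show "nullity F S \<noteq> \<infinity>" using assms(4) unfolding nullity_def by (metis enat_ord_simps(5))
qed

text \<open>Induction on whichever of nullity and deficiency is finite. A Jordan block has equal,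
  finite, nonzero nullity and deficiency, so splitting it off lowers that number until a Kato
  operator remains. The last clause says that \<open>S\<close> has no nonzero eigenvalue on
  \<open>F\<close>.\<close>

theorem Kato_decomposition:
  assumes S: "bounded_clinear S"
  shows "\<lbrakk>csubspace M; closed M; S ` M \<subseteq> M; closed (S ` M); nullity M S = enat n \<or> deficiency M S = enat n\<rbrakk> \<Longrightarrow>
    \<exists>K F. direct_sum M K F \<and> closed K \<and> S ` K \<subseteq> K \<and> S ` F \<subseteq> F \<and> qdim F {0} \<noteq> \<infinity> \<and> kato_on K S \<and>
      (\<forall>\<mu>. \<mu> \<noteq> 0 \<longrightarrow> nullity F (shift S \<mu>) = 0)"
proof (induction n arbitrary: M rule: less_induct)
  case (less n)
  note M = less.prems(1,2) and inv = less.prems(3) and cl = less.prems(4) and fin = less.prems(5)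
  show ?case
  proof (cases "kato_on M S")
    case True
    have "direct_sum M M {0}" using M csubspace_0[OF M(1)] by (auto simp: direct_sum_def csubspace_zero ssum_zero)
    moreover have "qdim {0::'a} {0} = 0" by (simp add: qdim_eq_0_iff[OF csubspace_zero])
    moreover have "nullity {0} (shift S \<mu>) = 0" for \<mu> by (auto simp: nullity_eq_0_iff kerM_def)
    moreover have "S ` {0} \<subseteq> {0}" by (simp add: bounded_clinear_simps[OF S])
    ultimately show ?thesis using True M inv
      by (intro exI[of _ M] exI[of _ "{0}"]) (auto simp: zero_enat_def)
  next
    case False
    have clk: "closed ((S ^^ k) ` M)" for k by (rule closed_range_funpow[OF S M inv cl]) (use fin in auto)
    obtain Z Y where ZY: "direct_sum M Z Y" "closed Z" "S ` Z \<subseteq> Z" "S ` Y \<subseteq> Y" "qdim Y {0} \<noteq> \<infinity>"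
      "nullity Y S \<noteq> 0" "\<And>\<mu>. \<mu> \<noteq> 0 \<Longrightarrow> nullity Y (shift S \<mu>) = 0"
      using split_Jordan_block[OF S M inv clk False] by blast
    have Z: "csubspace Z" and Y: "csubspace Y" and ZM: "Z \<subseteq> M"
      using ZY(1) direct_sum_subset[OF ZY(1)] by (auto simp: direct_sum_def)
    \<comment> \<open>A vector of the range that lies in \<open>Z\<close> has no
      \<open>Y\<close>-component, so its preimage can be taken in \<open>Z\<close>. Hence the
      restriction to \<open>Z\<close> inherits a closed range.\<close>
    have "S ` Z = S ` M \<inter> Z"
    proof
      show "S ` Z \<subseteq> S ` M \<inter> Z" using ZM ZY(3) by blast
      show "S ` M \<inter> Z \<subseteq> S ` Z"
      proof
        fix x assume x: "x \<in> S ` M \<inter> Z"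
        then obtain z y where zy: "z \<in> Z" "y \<in> Y" "x = S z + S y"
          unfolding direct_sum_image[OF S ZY(1)] by (auto simp: ssum_def)
        then have "S y = 0" using x ZY direct_sum_decomp[OF ZY(1), of "S z" "S y"] by blast
        then show "x \<in> S ` Z" using zy by simp
      qed
    qed
    then have clZ: "closed (S ` Z)" using cl ZY(2) by (simp add: closed_Int)
    note rn = rank_nullity_deficiency[OF S Y ZY(4,5)]
    have "\<exists>n'<n. nullity Z S = enat n' \<or> deficiency Z S = enat n'"
    proof -
      have *: "\<exists>n'<n. a = enat n'" if "enat n = a + b" "b \<noteq> 0" for a b
        using that by (cases a; cases b) (auto simp: zero_enat_def)
      show ?thesis using fin *[of "nullity Z S" "nullity Y S"] *[of "deficiency Z S" "deficiency Y S"]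
          direct_sum_nullity[OF S ZY(1,3,4)] direct_sum_deficiency[OF S ZY(1,3,4)] rn ZY(6) by metis
    qed
    then obtain n' where n': "n' < n" "nullity Z S = enat n' \<or> deficiency Z S = enat n'" by blast
    obtain K F where KF: "direct_sum Z K F" "closed K" "S ` K \<subseteq> K" "S ` F \<subseteq> F" "qdim F {0} \<noteq> \<infinity>" "kato_on K S"
      "\<And>\<mu>. \<mu> \<noteq> 0 \<Longrightarrow> nullity F (shift S \<mu>) = 0"
      using less.IH[OF n'(1) Z ZY(2,3) clZ n'(2)] by blast
    note d = direct_sum_assoc[OF ZY(1) KF(1)]
    have F: "csubspace F" using KF(1) by (simp add: direct_sum_def)
    have "qdim (ssum F Y) (ssum {0} {0}) = qdim F {0} + qdim Y {0}"
      using F Y d(2) csubspace_0[OF F] csubspace_0[OF Y] by (intro qdim_ssum csubspace_zero) (auto simp: direct_sum_def)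
    then have "qdim (ssum F Y) {0} \<noteq> \<infinity>" using KF(5) ZY(5) by (auto simp: ssum_zero)
    moreover have "nullity (ssum F Y) (shift S \<mu>) = 0" if "\<mu> \<noteq> 0" for \<mu>
      using direct_sum_nullity[OF bounded_clinear_shift[OF S] d(2) shift_invariant[OF F KF(4)] shift_invariant[OF Y ZY(4)], of \<mu>]
        KF(7)[OF that] ZY(7)[OF that] by simp
    moreover have "S ` ssum F Y \<subseteq> ssum F Y" by (rule direct_sum_invariant[OF S d(2) KF(4) ZY(4)])
    ultimately show ?thesis using d(1) KF by blast
  qed
qed

subsection \<open>Riesz operators\<close>

lemma upper_semi_fredholm_on_iff:
  assumes "bounded_clinear S" "csubspace M"
  shows "upper_semi_fredholm_on M S \<longleftrightarrow> nullity M S \<noteq> \<infinity> \<and> closed (S ` M)"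
  using cfindim_iff[OF csubspace_kernel[OF assms]] by (simp add: upper_semi_fredholm_on_def nullity_def)

lemma lower_semi_fredholm_on_iff:
  assumes "bounded_clinear S" "csubspace M" "S ` M \<subseteq> M"
  shows "lower_semi_fredholm_on M S \<longleftrightarrow> deficiency M S \<noteq> \<infinity>"
  using cfincodim_iff[OF assms(2) csubspace_range[OF assms(1,2)] assms(3)]
  by (simp add: lower_semi_fredholm_on_def deficiency_def)

lemma fredholm_on_iff:
  assumes "bounded_clinear S" "csubspace M" "S ` M \<subseteq> M"
  shows "fredholm_on M S \<longleftrightarrow> closed (S ` M) \<and> nullity M S \<noteq> \<infinity> \<and> deficiency M S \<noteq> \<infinity>"
  using upper_semi_fredholm_on_iff[OF assms(1,2)] lower_semi_fredholm_on_iff[OF assms]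
  by (auto simp: fredholm_on_def)

lemma shift_shift: "shift (shift T \<mu>) \<nu> = shift T (\<mu> + \<nu>)"
  by (simp add: scaleC_add_left algebra_simps)

lemma shift_invariant_iff:
  assumes "csubspace M" shows "shift S \<mu> ` M \<subseteq> M \<longleftrightarrow> S ` M \<subseteq> M"
proof
  assume "shift S \<mu> ` M \<subseteq> M"
  then have "shift (shift S \<mu>) (- \<mu>) ` M \<subseteq> M" by (rule shift_invariant[OF assms])
  then show "S ` M \<subseteq> M" by (simp only: shift_shift) simp
qed (rule shift_invariant[OF assms])

lemma riesz_on_finite_dim:
  assumes S: "bounded_clinear S" and F: "csubspace F" "S ` F \<subseteq> F" "qdim F {0} \<noteq> \<infinity>"
  shows "riesz_on F S"
  unfolding riesz_on_def
proof (intro allI impI)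
  fix \<mu> :: complex
  have S': "bounded_clinear (shift S \<mu>)" by (rule bounded_clinear_shift[OF S])
  have inv: "shift S \<mu> ` F \<subseteq> F" by (rule shift_invariant[OF F(1,2)])
  have "qdim (shift S \<mu> ` F) {0} \<le> qdim F {0}" using inv by (intro qdim_mono) auto
  then have "qdim (shift S \<mu> ` F) {0} \<noteq> \<infinity>" using F(3) by (metis enat_ord_simps(5))
  then have "closed (shift S \<mu> ` F)" by (rule closed_qdim_finite[OF csubspace_range[OF S' F(1)]])
  then show "fredholm_on F (shift S \<mu>)"
    using fredholm_on_iff[OF S' F(1) inv] rank_nullity_deficiency[OF S' F(1) inv F(3)] by simp
qed

lemma riesz_on_direct_sum:
  assumes S: "bounded_clinear S" and d: "direct_sum N A B" and cl: "closed A" "closed B" "closed N"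
    and inv: "S ` A \<subseteq> A" "S ` B \<subseteq> B" and r: "riesz_on A S" "riesz_on B S"
  shows "riesz_on N S"
  unfolding riesz_on_def
proof (intro allI impI)
  fix \<mu> :: complex assume \<mu>: "\<mu> \<noteq> 0"
  have S': "bounded_clinear (shift S \<mu>)" by (rule bounded_clinear_shift[OF S])
  have sub: "csubspace A" "csubspace B" using d by (auto simp: direct_sum_def)
  note i = shift_invariant[OF sub(1) inv(1), of \<mu>] shift_invariant[OF sub(2) inv(2), of \<mu>]
  have "fredholm_on A (shift S \<mu>)" "fredholm_on B (shift S \<mu>)" using r \<mu> by (auto simp: riesz_on_def)
  then have f: "closed (shift S \<mu> ` A)" "nullity A (shift S \<mu>) \<noteq> \<infinity>" "deficiency A (shift S \<mu>) \<noteq> \<infinity>"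
    "closed (shift S \<mu> ` B)" "nullity B (shift S \<mu>) \<noteq> \<infinity>" "deficiency B (shift S \<mu>) \<noteq> \<infinity>"
    using fredholm_on_iff[OF S' sub(1) i(1)] fredholm_on_iff[OF S' sub(2) i(2)] by blast+
  then show "fredholm_on N (shift S \<mu>)"
    using fredholm_on_iff[OF S' direct_sum_csubspace[OF d] direct_sum_invariant[OF S' d i]]
      direct_sum_closed_parts[OF S' d cl i] direct_sum_nullity[OF S' d i] direct_sum_deficiency[OF S' d i]
    by (auto simp: plus_eq_infty_iff_enat)
qed

text \<open>For \<open>\<mu>\<close> of large modulus, \<open>T x - \<mu> x = y\<close> is the fixed point equation of a contraction.\<close>

lemma shift_bijective_large:
  assumes T: "bounded_clinear T" and K: "\<And>x. norm (T x) \<le> K * norm x" "0 \<le> K"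
    and M: "csubspace M" "closed M" and inv: "T ` M \<subseteq> M" and \<mu>: "K < cmod \<mu>"
  shows "nullity M (shift T \<mu>) = 0" "deficiency M (shift T \<mu>) = 0"
proof -
  have \<mu>0: "\<mu> \<noteq> 0" using \<mu> K(2) by auto
  have c: "0 \<le> K / cmod \<mu>" "K / cmod \<mu> < 1" using \<mu> K(2) by (auto simp: divide_less_eq)
  have ex1: "\<exists>!x\<in>M. (1 / \<mu>) *\<^sub>C (T x - y) = x" if y: "y \<in> M" for y
  proof (rule Banach_fix[OF _ _ c])
    show "complete M" using M(2) by (simp add: complete_eq_closed)
    show "M \<noteq> {}" using csubspace_0[OF M(1)] by blast
    show "(\<lambda>x. (1 / \<mu>) *\<^sub>C (T x - y)) ` M \<subseteq> M"
      using inv y M(1) by (auto intro!: csubspace_scale csubspace_diff)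
    fix x z assume "x \<in> M" "z \<in> M"
    have "dist ((1 / \<mu>) *\<^sub>C (T x - y)) ((1 / \<mu>) *\<^sub>C (T z - y)) = norm (T (x - z)) / cmod \<mu>"
      unfolding dist_norm cvs.scale_right_diff_distrib[symmetric] norm_scaleC
      by (simp add: bounded_clinear_simps[OF T] norm_divide)
    also have "\<dots> \<le> K * norm (x - z) / cmod \<mu>" by (intro divide_right_mono K(1)) simp
    finally show "dist ((1 / \<mu>) *\<^sub>C (T x - y)) ((1 / \<mu>) *\<^sub>C (T z - y)) \<le> K / cmod \<mu> * dist x z"
      by (simp add: dist_norm)
  qed
  have eq: "(1 / \<mu>) *\<^sub>C (T x - y) = x \<longleftrightarrow> shift T \<mu> x = y" for x y
  proof
    assume *: "(1 / \<mu>) *\<^sub>C (T x - y) = x"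
    have "\<mu> *\<^sub>C x = \<mu> *\<^sub>C ((1 / \<mu>) *\<^sub>C (T x - y))" by (simp only: *)
    also have "\<dots> = T x - y" using \<mu>0 by (simp add: scaleC_scaleC scaleC_one)
    finally show "shift T \<mu> x = y" by simp
  next
    assume "shift T \<mu> x = y"
    then have "T x - y = \<mu> *\<^sub>C x" by auto
    then show "(1 / \<mu>) *\<^sub>C (T x - y) = x" using \<mu>0 by (simp add: scaleC_scaleC scaleC_one)
  qed
  have ex1': "\<exists>!x. x \<in> M \<and> shift T \<mu> x = y" if "y \<in> M" for y using ex1[OF that] unfolding eq .
  have "shift T \<mu> 0 = 0" by (simp add: bounded_clinear_simps[OF T])
  then show "nullity M (shift T \<mu>) = 0"
    unfolding nullity_eq_0_iff kerM_def using ex1'[OF csubspace_0[OF M(1)]] csubspace_0[OF M(1)] by blast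
  show "deficiency M (shift T \<mu>) = 0"
    unfolding deficiency_eq_0_iff[OF bounded_clinear_shift[OF T] M(1)] using ex1' by blast
qed

lemma kato_eventually_stable:
  assumes T: "bounded_clinear T" and K: "csubspace K" "closed K" "shift T \<mu> ` K \<subseteq> K"
    and kato: "kato_on K (shift T \<mu>)"
  shows "\<forall>\<^sub>F \<nu> in nhds \<mu>. closed (shift T \<nu> ` K) \<and> nullity K (shift T \<nu>) = nullity K (shift T \<mu>) \<and>
    deficiency K (shift T \<nu>) = deficiency K (shift T \<mu>)"
proof -
  let ?S = "shift T \<mu>"
  obtain \<epsilon> where \<epsilon>: "\<epsilon> > 0" "\<And>l. cmod l < \<epsilon> \<Longrightarrow> closed (shift ?S l ` K) \<and>
      nullity K (shift ?S l) = nullity K ?S \<and> deficiency K (shift ?S l) = deficiency K ?S"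
    by (rule kato_stable[OF bounded_clinear_shift[OF T, of \<mu>] K kato]) blast
  have "closed (shift T \<nu> ` K) \<and> nullity K (shift T \<nu>) = nullity K ?S \<and> deficiency K (shift T \<nu>) = deficiency K ?S"
    if "dist \<nu> \<mu> < \<epsilon>" for \<nu>
    using \<epsilon>(2)[of "\<nu> - \<mu>"] that unfolding shift_shift by (simp add: dist_norm)
  then show ?thesis using \<epsilon>(1) unfolding eventually_nhds_metric by blast
qed

lemma nullity_deficiency_near_decomposition:
  assumes T: "bounded_clinear T" and d: "direct_sum N K F" and K: "closed K" "shift T \<mu> ` K \<subseteq> K"
    and F: "shift T \<mu> ` F \<subseteq> F" and kato: "kato_on K (shift T \<mu>)"
    and Fl: "\<forall>\<^sub>F \<nu> in at \<mu>. nullity F (shift T \<nu>) = 0 \<and> deficiency F (shift T \<nu>) = 0"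
  shows "\<forall>\<^sub>F \<nu> in at \<mu>. nullity N (shift T \<nu>) = nullity K (shift T \<mu>) \<and>
    deficiency N (shift T \<nu>) = deficiency K (shift T \<mu>)"
proof -
  have sub: "csubspace K" "csubspace F" using d by (auto simp: direct_sum_def)
  have S: "bounded_clinear (shift T \<nu>)" for \<nu> by (rule bounded_clinear_shift[OF T])
  have "\<forall>\<^sub>F \<nu> in at \<mu>. nullity K (shift T \<nu>) = nullity K (shift T \<mu>) \<and>
      deficiency K (shift T \<nu>) = deficiency K (shift T \<mu>)"
    using kato_eventually_stable[OF T sub(1) K kato] by (auto simp: eventually_at_filter elim: eventually_mono)
  with Fl show ?thesis
  proof eventually_elim
    case (elim \<nu>)
    have i: "shift T \<nu> ` K \<subseteq> K" "shift T \<nu> ` F \<subseteq> F"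
      using K(2) F shift_invariant_iff[OF sub(1), of T] shift_invariant_iff[OF sub(2), of T] by simp_all
    show ?case using elim direct_sum_nullity[OF S d i] direct_sum_deficiency[OF S d i] by simp
  qed
qed

text \<open>\<open>shift S \<mu>\<close> is Fredholm, so its Kato part \<open>K\<close> has a stable
  pair. On the finite-dimensional \<open>F\<close> the only possible eigenvalue of \<open>S\<close>
  is \<open>\<mu>\<close>, so \<open>F\<close> contributes nothing at other points.\<close>

lemma riesz_local:
  assumes S: "bounded_clinear S" and N: "csubspace N" "closed N" "S ` N \<subseteq> N" and r: "riesz_on N S" and \<mu>: "\<mu> \<noteq> 0"
  obtains K F where "direct_sum N K F" "closed K" "S ` K \<subseteq> K" "S ` F \<subseteq> F" "qdim F {0} \<noteq> \<infinity>"
    "closed (shift S \<mu> ` K)"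
    "\<forall>\<^sub>F \<nu> in at \<mu>. nullity N (shift S \<nu>) = nullity K (shift S \<mu>) \<and>
      deficiency N (shift S \<nu>) = deficiency K (shift S \<mu>)"
proof -
  let ?S = "shift S \<mu>"
  have S': "bounded_clinear (shift S \<nu>)" for \<nu> by (rule bounded_clinear_shift[OF S])
  have inv: "?S ` N \<subseteq> N" by (rule shift_invariant[OF N(1,3)])
  have "fredholm_on N ?S" using r \<mu> by (simp add: riesz_on_def)
  then have f: "closed (?S ` N)" "nullity N ?S \<noteq> \<infinity>" using fredholm_on_iff[OF S' N(1) inv] by blast+
  then obtain n where "nullity N ?S = enat n" by auto
  then obtain K F where KF: "direct_sum N K F" "closed K" "?S ` K \<subseteq> K" "?S ` F \<subseteq> F" "qdim F {0} \<noteq> \<infinity>"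
    "kato_on K ?S" "\<And>\<nu>. \<nu> \<noteq> 0 \<Longrightarrow> nullity F (shift ?S \<nu>) = 0"
    using Kato_decomposition[OF S'[of \<mu>] N(1,2) inv f(1), of n] by blast
  have sub: "csubspace K" "csubspace F" using KF(1) by (auto simp: direct_sum_def)
  have invS: "S ` K \<subseteq> K" "S ` F \<subseteq> F"
    using KF(3,4) shift_invariant_iff[OF sub(1), of S \<mu>] shift_invariant_iff[OF sub(2), of S \<mu>] by simp_all
  have "nullity F (shift S \<nu>) = 0 \<and> deficiency F (shift S \<nu>) = 0" if "\<nu> \<noteq> \<mu>" for \<nu>
  proof -
    have "nullity F (shift ?S (\<nu> - \<mu>)) = 0" using that by (intro KF(7)) simp
    then have "nullity F (shift S \<nu>) = 0" by (simp only: shift_shift) simp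
    then show ?thesis
      using rank_nullity_deficiency(1)[OF S' sub(2) shift_invariant[OF sub(2) invS(2)] KF(5)] by simp
  qed
  then have "\<forall>\<^sub>F \<nu> in at \<mu>. nullity F (shift S \<nu>) = 0 \<and> deficiency F (shift S \<nu>) = 0"
    by (simp add: eventually_at_filter)
  from nullity_deficiency_near_decomposition[OF S KF(1,2,3,4,6) this]
  show ?thesis using that KF(1,2,5,6) invS by (simp add: kato_on_def)
qed

text \<open>In a T1 space, each point of a punctured neighbourhood has a neighbourhood avoiding the
  centre. This makes statements about punctured neighbourhoods usable in connectedness and closure
  arguments.\<close>

lemma open_eventually_at:
  fixes P :: "'b::t1_space \<Rightarrow> bool"
  shows "open {x. \<forall>\<^sub>F y in at x. P y}"
proof (subst open_subopen, intro ballI)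
  fix x assume "x \<in> {x. \<forall>\<^sub>F y in at x. P y}"
  then obtain U where U: "open U" "x \<in> U" "\<And>y. y \<in> U \<Longrightarrow> y \<noteq> x \<Longrightarrow> P y"
    by (auto simp: eventually_at_topological)
  have "\<forall>\<^sub>F y in at z. P y" if z: "z \<in> U" for z
  proof (cases "z = x")
    case True
    then show ?thesis using U by (auto simp: eventually_at_topological)
  next
    case False
    then have "open (U - {x})" "z \<in> U - {x}" using U z by auto
    then show ?thesis using U(3) unfolding eventually_at_topological by (metis Diff_iff singletonI)
  qed
  then show "\<exists>T. open T \<and> x \<in> T \<and> T \<subseteq> {x. \<forall>\<^sub>F y in at x. P y}" using U by blast
qed

text \<open>The nullity and deficiency near a point, excluding the point itself, are locally constant on the
  connected set \<open>- {0}\<close>, and they vanish far away from the origin.\<close>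

lemma riesz_eventually_bijective:
  assumes S: "bounded_clinear S" and N: "csubspace N" "closed N" "S ` N \<subseteq> N" and r: "riesz_on N S" and \<mu>: "\<mu> \<noteq> 0"
  shows "\<forall>\<^sub>F \<nu> in at \<mu>. nullity N (shift S \<nu>) = 0 \<and> deficiency N (shift S \<nu>) = 0"
proof -
  define P where "P \<nu> \<longleftrightarrow> nullity N (shift S \<nu>) = 0 \<and> deficiency N (shift S \<nu>) = 0" for \<nu>
  let ?U = "{\<mu>. \<forall>\<^sub>F \<nu> in at \<mu>. P \<nu>}" and ?V = "{\<mu>. \<forall>\<^sub>F \<nu> in at \<mu>. \<not> P \<nu>}"
  obtain K where K: "K > 0" "\<And>x. norm (S x) \<le> norm x * K"
    using bounded_linear.pos_bounded[OF bounded_clinear_bl[OF S]] by blast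
  have "-{0} \<subseteq> ?U \<union> ?V"
  proof
    fix \<mu> :: complex assume "\<mu> \<in> - {0}"
    then have "\<mu> \<noteq> 0" by simp
    then obtain K where ev: "\<forall>\<^sub>F \<nu> in at \<mu>. nullity N (shift S \<nu>) = nullity K (shift S \<mu>) \<and>
      deficiency N (shift S \<nu>) = deficiency K (shift S \<mu>)" by (rule riesz_local[OF S N r])
    show "\<mu> \<in> ?U \<union> ?V"
    proof (cases "nullity K (shift S \<mu>) = 0 \<and> deficiency K (shift S \<mu>) = 0")
      case True
      from ev have "\<forall>\<^sub>F \<nu> in at \<mu>. P \<nu>" by eventually_elim (use True in \<open>simp add: P_def\<close>)
      then show ?thesis by simp
    next
      case False
      from ev have "\<forall>\<^sub>F \<nu> in at \<mu>. \<not> P \<nu>" by eventually_elim (use False in \<open>simp add: P_def\<close>)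
      then show ?thesis by simp
    qed
  qed
  moreover have "?U \<inter> ?V \<inter> - {0} = {}"
  proof -
    have False if "\<forall>\<^sub>F \<nu> in at \<mu>. P \<nu>" "\<forall>\<^sub>F \<nu> in at \<mu>. \<not> P \<nu>" for \<mu> :: complex
    proof -
      have "\<forall>\<^sub>F \<nu> in at \<mu>. False" using that by eventually_elim simp
      then show False by simp
    qed
    then show ?thesis by blast
  qed
  moreover have "connected (- {0::complex})" by (rule connected_punctured_universe) simp
  ultimately have "?U \<inter> - {0} = {} \<or> ?V \<inter> - {0} = {}"
    by (intro connectedD open_eventually_at) auto
  moreover have "complex_of_real (K + 1) \<in> ?U"
  proof -
    have "open {\<nu>. K < cmod \<nu>}" by (intro open_Collect_less continuous_intros)
    moreover have "complex_of_real (K + 1) \<in> {\<nu>. K < cmod \<nu>}"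
      using K(1) by (simp only: norm_of_real mem_Collect_eq)
    moreover have "P \<nu>" if "\<nu> \<in> {\<nu>. K < cmod \<nu>}" for \<nu>
      using shift_bijective_large[OF S _ _ N, of K \<nu>] that K by (simp add: P_def mult.commute)
    ultimately have "\<forall>\<^sub>F \<nu> in at (complex_of_real (K + 1)). P \<nu>"
      unfolding eventually_at_topological by blast
    then show ?thesis by simp
  qed
  moreover have "complex_of_real (K + 1) \<noteq> 0" using K(1) by (simp add: complex_eq_iff)
  ultimately have "?V \<inter> - {0} = {}" by blast
  then have "\<mu> \<in> ?U" using \<open>-{0} \<subseteq> ?U \<union> ?V\<close> \<mu> by blast
  then show ?thesis by (simp add: P_def)
qed

text \<open>The pair of \<open>K\<close> at \<open>\<mu>\<close> is the generic pair of
  \<open>N\<close> near \<open>\<mu>\<close>, which is zero by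
  \<open>riesz_eventually_bijective\<close>. The splitting takes the place of the spectral
  projection at an isolated point of the spectrum.\<close>

lemma riesz_split:
  assumes S: "bounded_clinear S" and N: "csubspace N" "closed N" "S ` N \<subseteq> N" and r: "riesz_on N S" and \<mu>: "\<mu> \<noteq> 0"
  obtains K F where "direct_sum N K F" "closed K" "S ` K \<subseteq> K" "S ` F \<subseteq> F" "qdim F {0} \<noteq> \<infinity>"
    "closed (shift S \<mu> ` K)" "nullity K (shift S \<mu>) = 0" "deficiency K (shift S \<mu>) = 0"
proof -
  obtain K F where KF: "direct_sum N K F" "closed K" "S ` K \<subseteq> K" "S ` F \<subseteq> F" "qdim F {0} \<noteq> \<infinity>"
    "closed (shift S \<mu> ` K)"
    "\<forall>\<^sub>F \<nu> in at \<mu>. nullity N (shift S \<nu>) = nullity K (shift S \<mu>) \<and>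
      deficiency N (shift S \<nu>) = deficiency K (shift S \<mu>)" by (rule riesz_local[OF assms])
  have "\<forall>\<^sub>F \<nu> in at \<mu>. nullity K (shift S \<mu>) = 0 \<and> deficiency K (shift S \<mu>) = 0"
    using KF(7) riesz_eventually_bijective[OF assms] by eventually_elim simp
  then have "nullity K (shift S \<mu>) = 0 \<and> deficiency K (shift S \<mu>) = 0" by simp
  then show ?thesis using that KF by blast
qed

subsection \<open>The spectra as sets determined by nullity and deficiency\<close>

lemma bounded_below_on_iff:
  assumes S: "bounded_clinear S" and M: "csubspace M" "closed M"
  shows "bounded_below_on M S \<longleftrightarrow> closed (S ` M) \<and> nullity M S = 0"
proof
  assume "bounded_below_on M S"
  then obtain c where c: "c > 0" "\<And>x. x \<in> M \<Longrightarrow> c * norm x \<le> norm (S x)" by (auto simp: bounded_below_on_def)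
  have "closed (S ` M)"
    by (rule closed_range_of_bounded_preimages[OF bounded_clinear_bl[OF S] csubspace_imp_subspace[OF M(1)] M(2), of "1 / c"])
      (use c in \<open>auto simp: field_simps\<close>)
  moreover have "kerM M S \<subseteq> {0}"
  proof
    fix x assume "x \<in> kerM M S"
    then have "c * norm x \<le> 0" using c(2)[of x] by (simp add: kerM_def)
    then show "x \<in> {0}" using c(1) by (simp add: mult_le_0_iff)
  qed
  ultimately show "closed (S ` M) \<and> nullity M S = 0" by (simp add: nullity_eq_0_iff)
next
  assume *: "closed (S ` M) \<and> nullity M S = 0"
  then obtain C where C: "C > 0" "\<And>y. y \<in> S ` M \<Longrightarrow> \<exists>x\<in>M. S x = y \<and> norm x \<le> C * norm y"
    using open_mapping_closed_range[OF bounded_clinear_bl[OF S] csubspace_imp_subspace[OF M(1)] M(2)] by blast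
  have "(1 / C) * norm x \<le> norm (S x)" if x: "x \<in> M" for x
  proof -
    obtain z where z: "z \<in> M" "S z = S x" "norm z \<le> C * norm (S x)" using C(2) x by blast
    have "x - z \<in> kerM M S" using x z csubspace_diff[OF M(1)] by (simp add: kerM_def bounded_clinear_simps[OF S])
    then have "x = z" using * by (auto simp: nullity_eq_0_iff)
    then show ?thesis using z C(1) by (simp add: field_simps)
  qed
  then show "bounded_below_on M S" unfolding bounded_below_on_def using C(1) by (intro exI[of _ "1 / C"]) auto
qed

lemma surjective_on_iff:
  assumes "bounded_clinear S" "csubspace M" "S ` M \<subseteq> M"
  shows "surjective_on M S \<longleftrightarrow> deficiency M S = 0"
  using assms by (auto simp: surjective_on_def deficiency_eq_0_iff)

lemma inj_on_iff_nullity: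
  assumes S: "bounded_clinear S" and M: "csubspace M"
  shows "inj_on S M \<longleftrightarrow> nullity M S = 0"
proof
  assume "inj_on S M"
  then show "nullity M S = 0"
    unfolding nullity_eq_0_iff kerM_def inj_on_def using csubspace_0[OF M] bounded_clinear_simps(3)[OF S] by force
next
  assume *: "nullity M S = 0"
  show "inj_on S M"
  proof (rule inj_onI)
    fix x y assume "x \<in> M" "y \<in> M" "S x = S y"
    then have "x - y \<in> kerM M S" using csubspace_diff[OF M] by (simp add: kerM_def bounded_clinear_simps[OF S])
    then show "x = y" using * by (auto simp: nullity_eq_0_iff)
  qed
qed

lemma invertible_on_iff:
  assumes "bounded_clinear S" "csubspace M" "S ` M \<subseteq> M"
  shows "invertible_on M S \<longleftrightarrow> nullity M S = 0 \<and> deficiency M S = 0"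
  using inj_on_iff_nullity[OF assms(1,2)] surjective_on_iff[OF assms]
  by (simp add: invertible_on_def surjective_on_def)

lemma enat_cdim_ccodim:
  assumes S: "bounded_clinear S" and M: "csubspace M" "S ` M \<subseteq> M"
    and fin: "nullity M S \<noteq> \<infinity>" "deficiency M S \<noteq> \<infinity>"
  shows "enat (cdim (kerM M S)) = nullity M S" "enat (ccodim M (S ` M)) = deficiency M S"
proof -
  obtain n m where nm: "nullity M S = enat n" "deficiency M S = enat m" using fin by auto
  then show "enat (cdim (kerM M S)) = nullity M S" "enat (ccodim M (S ` M)) = deficiency M S"
    using cdim_eq[OF csubspace_kernel[OF S M(1)]] ccodim_eq[OF M(1) csubspace_range[OF S M(1)] M(2)]
    by (simp_all add: nullity_def deficiency_def)
qed

text \<open>\<open>cdim\<close> and \<open>ccodim\<close> are meaningful only for finite dimensions,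
  which the definition guards by an implication. In \<open>enat\<close> an infinite deficiency
  satisfies the inequality by itself, in accordance with the index
  \<open>-\<infinity>\<close>.\<close>

lemma weyl_plus_on_iff:
  assumes S: "bounded_clinear S" and M: "csubspace M" "S ` M \<subseteq> M"
  shows "weyl_plus_on M S \<longleftrightarrow> closed (S ` M) \<and> nullity M S \<noteq> \<infinity> \<and> nullity M S \<le> deficiency M S"
proof (cases "nullity M S = \<infinity> \<or> deficiency M S = \<infinity>")
  case True
  then show ?thesis
    using upper_semi_fredholm_on_iff[OF S M(1)] cfincodim_iff[OF M(1) csubspace_range[OF S M(1)] M(2)]
    by (auto simp: weyl_plus_on_def deficiency_def)
next
  case False
  then show ?thesis
    using upper_semi_fredholm_on_iff[OF S M(1)] cfincodim_iff[OF M(1) csubspace_range[OF S M(1)] M(2)]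
      enat_cdim_ccodim[OF S M, symmetric]
    by (auto simp: weyl_plus_on_def deficiency_def[symmetric])
qed

lemma weyl_minus_on_iff:
  assumes S: "bounded_clinear S" and M: "csubspace M" "S ` M \<subseteq> M"
  shows "weyl_minus_on M S \<longleftrightarrow> deficiency M S \<noteq> \<infinity> \<and> deficiency M S \<le> nullity M S"
proof (cases "nullity M S = \<infinity> \<or> deficiency M S = \<infinity>")
  case True
  then show ?thesis
    using lower_semi_fredholm_on_iff[OF S M] cfindim_iff[OF csubspace_kernel[OF S M(1)]]
    by (auto simp: weyl_minus_on_def nullity_def)
next
  case False
  then show ?thesis
    using lower_semi_fredholm_on_iff[OF S M] cfindim_iff[OF csubspace_kernel[OF S M(1)]]
      enat_cdim_ccodim[OF S M, symmetric]
    by (auto simp: weyl_minus_on_def nullity_def[symmetric])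
qed

lemma weyl_on_iff:
  assumes S: "bounded_clinear S" and M: "csubspace M" "S ` M \<subseteq> M"
  shows "weyl_on M S \<longleftrightarrow> closed (S ` M) \<and> nullity M S \<noteq> \<infinity> \<and> nullity M S = deficiency M S"
proof (cases "nullity M S = \<infinity> \<or> deficiency M S = \<infinity>")
  case True
  then show ?thesis using fredholm_on_iff[OF S M] by (auto simp: weyl_on_def)
next
  case False
  then show ?thesis
    using fredholm_on_iff[OF S M] enat_cdim_ccodim[OF S M, symmetric] by (auto simp: weyl_on_def)
qed

section \<open>Spectra given by conditions on nullity and deficiency\<close>

definition decomposition :: "('a::complex_banach \<Rightarrow> 'a) \<Rightarrow> complex \<Rightarrow> 'a set \<Rightarrow> 'a set \<Rightarrow> bool" where
  "decomposition T \<mu> M N \<longleftrightarrow> direct_sum UNIV M N \<and> closed M \<and> closed N \<and>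
     shift T \<mu> ` M \<subseteq> M \<and> shift T \<mu> ` N \<subseteq> N \<and> riesz_on N (shift T \<mu>)"

text \<open>Closed range is demanded explicitly because a condition on the nullity alone does not
  imply it; under finite deficiency it is automatic.\<close>

definition dim_spectrum :: "(enat \<Rightarrow> enat \<Rightarrow> bool) \<Rightarrow> ('a::complex_banach \<Rightarrow> 'a) \<Rightarrow> complex set" where
  "dim_spectrum P T = {\<mu>. \<not> (\<exists>M N. decomposition T \<mu> M N \<and> closed (shift T \<mu> ` M) \<and>
     P (nullity M (shift T \<mu>)) (deficiency M (shift T \<mu>)))}"

lemma sigma_gDR_cls_decomposition:
  "sigma_gDR_cls cls T = {\<mu>. \<not> (\<exists>M N. decomposition T \<mu> M N \<and> cls M (shift T \<mu>))}"
proof -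
  have UNIV_iff: "(\<forall>x. \<exists>m\<in>M. \<exists>n\<in>N. x = m + n) \<longleftrightarrow> UNIV = ssum M N" for M N :: "'a set"
    unfolding ssum_def by blast
  show ?thesis unfolding sigma_gDR_cls_def decomposition_def direct_sum_def UNIV_iff by blast
qed

lemma sigma_gDR_cls_eq_dim_spectrum:
  assumes T: "bounded_clinear T"
    and cls: "\<And>M S. bounded_clinear S \<Longrightarrow> csubspace M \<Longrightarrow> closed M \<Longrightarrow> S ` M \<subseteq> M \<Longrightarrow>
      cls M S \<longleftrightarrow> closed (S ` M) \<and> P (nullity M S) (deficiency M S)"
  shows "sigma_gDR_cls cls T = dim_spectrum P T"
proof -
  have "cls M (shift T \<mu>) \<longleftrightarrow> closed (shift T \<mu> ` M) \<and> P (nullity M (shift T \<mu>)) (deficiency M (shift T \<mu>))"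
    if "decomposition T \<mu> M N" for M N \<mu>
    using that by (intro cls bounded_clinear_shift T) (auto simp: decomposition_def direct_sum_def)
  then show ?thesis unfolding sigma_gDR_cls_decomposition dim_spectrum_def by blast
qed

text \<open>The first clause makes the operator semi-Fredholm in dimension, so that
  \<open>Kato_decomposition\<close> applies. The second lets \<open>P\<close> survive the removal of
  a finite-dimensional invariant summand, which contributes the same finite \<open>c\<close> to both
  numbers.\<close>

definition admissible :: "(enat \<Rightarrow> enat \<Rightarrow> bool) \<Rightarrow> bool" where
  "admissible P \<longleftrightarrow> (\<forall>a b. P a b \<longrightarrow> a \<noteq> \<infinity> \<or> b \<noteq> \<infinity>) \<and>
     (\<forall>a b c. c \<noteq> \<infinity> \<longrightarrow> P (a + c) (b + c) \<longrightarrow> P a b)"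

text \<open>The finite-dimensional part \<open>F\<close> of the Kato decomposition of
  \<open>M\<close> is handed over to \<open>N\<close>, and the sum is still Riesz. The nullity and
  deficiency of \<open>F\<close> are equal and finite, so admissibility carries \<open>P\<close>
  over to \<open>K\<close>.\<close>

lemma decomposition_kato_refine:
  assumes T: "bounded_clinear T" and P: "admissible P" and d: "decomposition T \<mu> M N"
    and cl: "closed (shift T \<mu> ` M)" and PM: "P (nullity M (shift T \<mu>)) (deficiency M (shift T \<mu>))"
  obtains K R where "decomposition T \<mu> K R" "kato_on K (shift T \<mu>)"
    "P (nullity K (shift T \<mu>)) (deficiency K (shift T \<mu>))"
proof -
  let ?S = "shift T \<mu>"
  have S: "bounded_clinear ?S" by (rule bounded_clinear_shift[OF T])
  have MN: "direct_sum UNIV M N" "closed M" "closed N" "?S ` M \<subseteq> M" "?S ` N \<subseteq> N" "riesz_on N ?S"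
    using d by (auto simp: decomposition_def)
  have M: "csubspace M" and N: "csubspace N" using MN(1) by (auto simp: direct_sum_def)
  have "nullity M ?S \<noteq> \<infinity> \<or> deficiency M ?S \<noteq> \<infinity>" using P PM unfolding admissible_def by blast
  then obtain n where n: "nullity M ?S = enat n \<or> deficiency M ?S = enat n" by auto
  obtain K F where KF: "direct_sum M K F" "closed K" "?S ` K \<subseteq> K" "?S ` F \<subseteq> F" "qdim F {0} \<noteq> \<infinity>" "kato_on K ?S"
    using Kato_decomposition[OF S M MN(2,4) cl n] by blast
  have F: "csubspace F" using KF(1) by (simp add: direct_sum_def)
  note ds = direct_sum_assoc[OF MN(1) KF(1)]
  have clF: "closed F" by (rule closed_qdim_finite[OF F KF(5)])
  have clR: "closed (ssum F N)"
    using closed_ssum_qdim_finite[OF N MN(3) F KF(5)] by (simp add: ssum_commute)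
  have "riesz_on (ssum F N) ?S"
    by (rule riesz_on_direct_sum[OF S ds(2) clF MN(3) clR KF(4) MN(5) riesz_on_finite_dim[OF S F KF(4,5)] MN(6)])
  then have "decomposition T \<mu> K (ssum F N)"
    unfolding decomposition_def using ds(1) KF(2,3) clR direct_sum_invariant[OF S ds(2) KF(4) MN(5)] by blast
  moreover have "P (nullity K ?S) (deficiency K ?S)"
  proof -
    note rn = rank_nullity_deficiency[OF S F KF(4,5)]
    have "P (nullity K ?S + nullity F ?S) (deficiency K ?S + nullity F ?S)"
      using PM direct_sum_nullity[OF S KF(1,3,4)] direct_sum_deficiency[OF S KF(1,3,4)] rn(1) by simp
    then show ?thesis using P rn(2) unfolding admissible_def by blast
  qed
  ultimately show ?thesis using that KF(6) by blast
qed

lemma sigma_gKR_subset_dim_spectrum: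
  assumes "bounded_clinear T" "admissible P"
  shows "sigma_gKR T \<subseteq> dim_spectrum P T"
proof
  fix \<mu> assume \<mu>: "\<mu> \<in> sigma_gKR T"
  show "\<mu> \<in> dim_spectrum P T"
  proof (rule ccontr)
    assume "\<mu> \<notin> dim_spectrum P T"
    then obtain M N where "decomposition T \<mu> M N" "closed (shift T \<mu> ` M)"
      "P (nullity M (shift T \<mu>)) (deficiency M (shift T \<mu>))" by (auto simp: dim_spectrum_def)
    then obtain K R where "decomposition T \<mu> K R" "kato_on K (shift T \<mu>)"
      by (rule decomposition_kato_refine[OF assms])
    then show False using \<mu> by (auto simp: sigma_gKR_def sigma_gDR_cls_decomposition)
  qed
qed

lemma riesz_shift_eventually_bijective:
  assumes T: "bounded_clinear T" and d: "decomposition T \<mu> K R" and ne: "\<nu> \<noteq> \<mu>"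
  shows "\<forall>\<^sub>F \<kappa> in at \<nu>. nullity R (shift T \<kappa>) = 0 \<and> deficiency R (shift T \<kappa>) = 0"
proof -
  let ?S = "shift T \<mu>"
  have R: "csubspace R" "closed R" "?S ` R \<subseteq> R" "riesz_on R ?S"
    using d by (auto simp: decomposition_def direct_sum_def)
  have "\<forall>\<^sub>F l in at (\<nu> - \<mu>). nullity R (shift ?S l) = 0 \<and> deficiency R (shift ?S l) = 0"
    using ne by (intro riesz_eventually_bijective[OF bounded_clinear_shift[OF T] R]) simp
  then have "\<forall>\<^sub>F l in at (\<nu> - \<mu>). nullity R (shift T (\<mu> + l)) = 0 \<and> deficiency R (shift T (\<mu> + l)) = 0"
    by (simp only: shift_shift)
  then show ?thesis
    using eventually_filtermap[of _ "\<lambda>l. \<mu> + l" "at (\<nu> - \<mu>)"] filtermap_at_shift[of "- \<mu>" "\<nu> - \<mu>"]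
    by (simp add: add.commute)
qed

text \<open>Points where \<open>shift T \<kappa>\<close> fails to be bijective on \<open>R\<close>
  may accumulate at \<open>\<mu>\<close>, but not at any \<open>\<nu> \<noteq> \<mu>\<close>; hence
  the two-stage limit. Its left-hand sides do not mention the decomposition, which makes the pairs
  of different decompositions comparable.\<close>

lemma eventually_dims_of_decomposition:
  assumes T: "bounded_clinear T" and d: "decomposition T \<mu> K R" and kato: "kato_on K (shift T \<mu>)"
  shows "\<forall>\<^sub>F \<nu> in at \<mu>. \<forall>\<^sub>F \<kappa> in at \<nu>. nullity UNIV (shift T \<kappa>) = nullity K (shift T \<mu>) \<and>
    deficiency UNIV (shift T \<kappa>) = deficiency K (shift T \<mu>)"
proof -
  let ?S = "shift T \<mu>"
  have S: "bounded_clinear (shift T \<nu>)" for \<nu> by (rule bounded_clinear_shift[OF T])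
  have KR: "direct_sum UNIV K R" "closed K" "?S ` K \<subseteq> K" "?S ` R \<subseteq> R" using d by (auto simp: decomposition_def)
  have K: "csubspace K" and R: "csubspace R" using KR(1) by (auto simp: direct_sum_def)
  define near where "near \<kappa> \<longleftrightarrow> nullity K (shift T \<kappa>) = nullity K ?S \<and> deficiency K (shift T \<kappa>) = deficiency K ?S" for \<kappa>
  have "\<forall>\<^sub>F \<nu> in nhds \<mu>. near \<nu>"
    using kato_eventually_stable[OF T K KR(2,3) kato] unfolding near_def by eventually_elim simp
  then have "\<forall>\<^sub>F \<nu> in nhds \<mu>. \<forall>\<^sub>F \<kappa> in nhds \<nu>. near \<kappa>" by (simp only: eventually_eventually)
  then have "\<forall>\<^sub>F \<nu> in at \<mu>. \<nu> \<noteq> \<mu> \<and> (\<forall>\<^sub>F \<kappa> in nhds \<nu>. near \<kappa>)"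
    by (auto simp: eventually_at_filter elim: eventually_mono)
  then show ?thesis
  proof eventually_elim
    case (elim \<nu>)
    then have near_\<nu>: "\<forall>\<^sub>F \<kappa> in at \<nu>. near \<kappa>" by (auto simp: eventually_at_filter elim: eventually_mono)
    have "\<forall>\<^sub>F \<kappa> in at \<nu>. nullity R (shift T \<kappa>) = 0 \<and> deficiency R (shift T \<kappa>) = 0"
      using riesz_shift_eventually_bijective[OF T d] elim by blast
    with near_\<nu> show ?case
    proof eventually_elim
      case (elim \<kappa>)
      have i: "shift T \<kappa> ` K \<subseteq> K" "shift T \<kappa> ` R \<subseteq> R"
        using KR(3,4) shift_invariant_iff[OF K, of T] shift_invariant_iff[OF R, of T] by simp_all
      show ?case using elim direct_sum_nullity[OF S KR(1) i] direct_sum_deficiency[OF S KR(1) i] by (simp add: near_def)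
    qed
  qed
qed

text \<open>For \<open>\<nu> \<noteq> \<mu>\<close> near \<open>\<mu>\<close>,
  \<open>riesz_split\<close> divides \<open>R\<close> into a part \<open>B\<close> on which
  \<open>shift T \<nu>\<close> is bijective and a finite-dimensional \<open>F\<close>. Joining
  \<open>B\<close> to \<open>K\<close> leaves the pair unchanged, and \<open>F\<close> alone is the
  new Riesz summand.\<close>

lemma eventually_notin_dim_spectrum:
  assumes T: "bounded_clinear T" and d: "decomposition T \<mu> K R" and kato: "kato_on K (shift T \<mu>)"
    and P: "P (nullity K (shift T \<mu>)) (deficiency K (shift T \<mu>))"
  shows "\<forall>\<^sub>F \<nu> in nhds \<mu>. \<nu> \<notin> dim_spectrum P T"
proof -
  let ?S = "shift T \<mu>"
  have S: "bounded_clinear (shift T \<nu>)" for \<nu> by (rule bounded_clinear_shift[OF T])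
  have KR: "direct_sum UNIV K R" "closed K" "closed R" "?S ` K \<subseteq> K" "?S ` R \<subseteq> R" "riesz_on R ?S"
    using d by (auto simp: decomposition_def)
  have K: "csubspace K" and R: "csubspace R" using KR(1) by (auto simp: direct_sum_def)
  have notin: "\<nu> \<notin> dim_spectrum P T"
    if KS: "closed (shift T \<nu> ` K)" "nullity K (shift T \<nu>) = nullity K ?S" "deficiency K (shift T \<nu>) = deficiency K ?S" for \<nu>
  proof (cases "\<nu> = \<mu>")
    case True
    then show ?thesis using d kato P by (auto simp: dim_spectrum_def kato_on_def)
  next
    case False
    define l where "l = \<nu> - \<mu>"
    have l: "l \<noteq> 0" "\<mu> + l = \<nu>" using False by (auto simp: l_def)
    let ?S' = "shift T \<nu>"
    have SS: "shift ?S l = ?S'" unfolding shift_shift l(2) ..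
    obtain B F where BF: "direct_sum R B F" "closed B" "?S ` B \<subseteq> B" "?S ` F \<subseteq> F" "qdim F {0} \<noteq> \<infinity>"
      "closed (shift ?S l ` B)" "nullity B (shift ?S l) = 0" "deficiency B (shift ?S l) = 0"
      by (rule riesz_split[OF S[of \<mu>] R KR(3,5,6) l(1)])
    note BF' = BF(6-8)[unfolded SS]
    have B: "csubspace B" and F: "csubspace F" using BF(1) by (auto simp: direct_sum_def)
    have i: "?S' ` K \<subseteq> K" "?S' ` B \<subseteq> B" "?S' ` F \<subseteq> F"
      using KR(4) BF(3,4) shift_invariant_iff[OF K, of T] shift_invariant_iff[OF B, of T] shift_invariant_iff[OF F, of T]
      by simp_all
    note ds = direct_sum_assoc[OF direct_sum_commute[OF KR(1)] direct_sum_commute[OF BF(1)]]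
    have clBK: "closed (ssum B K)"
    proof (rule closed_ssum_subspaces[OF R KR(3) K KR(2)])
      show "R \<inter> K = {0}" "closed (ssum R K)"
        using direct_sum_commute[OF KR(1)] unfolding direct_sum_def by (blast, metis closed_UNIV)
      show "B \<subseteq> R" using direct_sum_subset[OF BF(1)] by simp
    qed (use B BF(2) K KR(2) in auto)
    have "decomposition T \<nu> (ssum B K) F"
      unfolding decomposition_def
      using direct_sum_commute[OF ds(1)] clBK closed_qdim_finite[OF F BF(5)] i(3)
        direct_sum_invariant[OF S ds(2) i(2,1)] riesz_on_finite_dim[OF S F i(3) BF(5)] by blast
    moreover have "closed (?S' ` ssum B K)"
      by (rule direct_sum_closed_parts[OF S ds(2) BF(2) KR(2) clBK i(2,1) BF'(1) KS(1)])
    moreover have "P (nullity (ssum B K) ?S') (deficiency (ssum B K) ?S')"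
      using P direct_sum_nullity[OF S ds(2) i(2,1)] direct_sum_deficiency[OF S ds(2) i(2,1)] BF'(2,3) KS(2,3) by simp
    ultimately show ?thesis by (auto simp: dim_spectrum_def)
  qed
  show ?thesis by (rule eventually_mono[OF kato_eventually_stable[OF T K KR(2,4) kato]]) (use notin in blast)
qed

text \<open>Near a frontier point \<open>\<mu>\<close> outside \<open>sigma_gKR T\<close> there is
  some \<open>\<mu>'\<close> outside the spectrum. Both lie in an open set with one and the same
  generic pair, so the Kato part at \<open>\<mu>\<close> satisfies \<open>P\<close> because the one
  at \<open>\<mu>'\<close> does; then a whole neighbourhood of \<open>\<mu>\<close> avoids the
  spectrum.\<close>

theorem frontier_dim_spectrum_subset_sigma_gKR:
  assumes T: "bounded_clinear T" and P: "admissible P"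
  shows "frontier (dim_spectrum P T) \<subseteq> sigma_gKR T"
proof
  fix \<mu> assume \<mu>: "\<mu> \<in> frontier (dim_spectrum P T)"
  show "\<mu> \<in> sigma_gKR T"
  proof (rule ccontr)
    assume "\<mu> \<notin> sigma_gKR T"
    then obtain K R where KR: "decomposition T \<mu> K R" "kato_on K (shift T \<mu>)"
      by (auto simp: sigma_gKR_def sigma_gDR_cls_decomposition)
    define Q where "Q a b \<nu> \<longleftrightarrow> (\<forall>\<^sub>F \<kappa> in at \<nu>. nullity UNIV (shift T \<kappa>) = a \<and> deficiency UNIV (shift T \<kappa>) = b)" for a b \<nu>
    let ?a = "nullity K (shift T \<mu>)" and ?b = "deficiency K (shift T \<mu>)"
    let ?U = "{\<mu>. \<forall>\<^sub>F \<nu> in at \<mu>. Q ?a ?b \<nu>}"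
    have "open ?U" by (rule open_eventually_at)
    moreover have "\<mu> \<in> ?U" using eventually_dims_of_decomposition[OF T KR] by (simp add: Q_def)
    moreover have "\<mu> \<in> closure (- dim_spectrum P T)"
      using \<mu> by (simp add: frontier_closures)
    ultimately obtain \<mu>' where \<mu>': "\<mu>' \<notin> dim_spectrum P T" "\<mu>' \<in> ?U"
      using open_Int_closure_eq_empty[of ?U "- dim_spectrum P T"] by blast
    then obtain M N where "decomposition T \<mu>' M N" "closed (shift T \<mu>' ` M)"
      "P (nullity M (shift T \<mu>')) (deficiency M (shift T \<mu>'))" by (auto simp: dim_spectrum_def)
    then obtain K' R' where KR': "decomposition T \<mu>' K' R'" "kato_on K' (shift T \<mu>')"
      "P (nullity K' (shift T \<mu>')) (deficiency K' (shift T \<mu>'))"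
      by (rule decomposition_kato_refine[OF assms])
    let ?a' = "nullity K' (shift T \<mu>')" and ?b' = "deficiency K' (shift T \<mu>')"
    have "\<forall>\<^sub>F \<nu> in at \<mu>'. Q ?a' ?b' \<nu>"
      using eventually_dims_of_decomposition[OF T KR'(1,2)] by (simp add: Q_def)
    moreover have "\<forall>\<^sub>F \<nu> in at \<mu>'. Q ?a ?b \<nu>" using \<mu>'(2) by simp
    \<comment> \<open>Both values describe the same generic pair, and punctured neighbourhoods in
      the plane are nonempty, so the values agree.\<close>
    ultimately have "\<forall>\<^sub>F \<nu> in at \<mu>'. ?a = ?a' \<and> ?b = ?b'"
    proof eventually_elim
      case (elim \<nu>)
      then have "\<forall>\<^sub>F \<kappa> in at \<nu>. ?a = ?a' \<and> ?b = ?b'" unfolding Q_def by eventually_elim simp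
      then show ?case by simp
    qed
    then have "P ?a ?b" using KR'(3) by simp
    then have "\<forall>\<^sub>F \<nu> in nhds \<mu>. \<nu> \<notin> dim_spectrum P T" by (rule eventually_notin_dim_spectrum[OF T KR])
    then obtain V where "open V" "\<mu> \<in> V" "V \<inter> dim_spectrum P T = {}" by (auto simp: eventually_nhds)
    then show False using \<mu> open_Int_closure_eq_empty[of V "dim_spectrum P T"] unfolding frontier_def by blast
  qed
qed

section \<open>Boundedness, connected hulls and frontiers\<close>

lemma bounded_sigma_gDR:
  assumes T: "bounded_clinear T" shows "bounded (sigma_gDR T)"
proof -
  obtain K where K: "K > 0" "\<And>x. norm (T x) \<le> norm x * K"
    using bounded_linear.pos_bounded[OF bounded_clinear_bl[OF T]] by blast
  have "cmod \<mu> \<le> K" if \<mu>: "\<mu> \<in> sigma_gDR T" for \<mu>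
  proof (rule ccontr)
    assume "\<not> cmod \<mu> \<le> K"
    then have "nullity UNIV (shift T \<mu>) = 0" "deficiency UNIV (shift T \<mu>) = 0"
      using shift_bijective_large[OF T _ _ csubspace_UNIV closed_UNIV, of K \<mu>] K by (simp_all add: mult.commute)
    then have "invertible_on UNIV (shift T \<mu>)"
      using invertible_on_iff[OF bounded_clinear_shift[OF T] csubspace_UNIV, of \<mu>] by simp
    moreover have "decomposition T \<mu> UNIV {0}"
    proof -
      have "shift T \<mu> ` {0} \<subseteq> {0}" by (simp add: bounded_clinear_simps[OF T])
      moreover have "qdim {0::'a} {0} \<noteq> \<infinity>" using qdim_eq_0_iff[OF csubspace_zero, of "{0}"] by (auto simp: zero_enat_def)
      ultimately show ?thesis
        using riesz_on_finite_dim[OF bounded_clinear_shift[OF T] csubspace_zero]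
        by (simp add: decomposition_def direct_sum_def csubspace_UNIV csubspace_zero ssum_zero)
    qed
    ultimately show False using \<mu> by (auto simp: sigma_gDR_def sigma_gDR_cls_decomposition)
  qed
  then show ?thesis by (auto simp: bounded_iff)
qed

text \<open>An unbounded component of \<open>- K\<close> is connected, misses the frontier of
  \<open>H\<close> and is not contained in the bounded \<open>H\<close>, so it misses
  \<open>H\<close> altogether. Hence \<open>- K\<close> and \<open>- H\<close> have the same
  unbounded components.\<close>

lemma connected_hull_eqI:
  assumes sub: "K \<subseteq> H" and fr: "frontier H \<subseteq> K" and bd: "bounded H"
  shows "connected_hull K = connected_hull H"
proof -
  have unb: "C \<subseteq> - H" if C: "C \<in> components (- K)" "\<not> bounded C" for C
  proof -
    have "connected C" "C \<subseteq> - K"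
      using in_components_connected[OF C(1)] in_components_subset[OF C(1)] by simp_all
    moreover have "C - H \<noteq> {}" using C(2) bd bounded_subset by blast
    ultimately show ?thesis using connected_Int_frontier[of C H] fr by blast
  qed
  have restrict: "C \<in> components B" if "C \<in> components A" "C \<subseteq> B" "B \<subseteq> A" for A B C :: "complex set"
    using that unfolding in_components_maximal by (meson order_trans)
  have "{C \<in> components (- K). \<not> bounded C} = {C \<in> components (- H). \<not> bounded C}"
  proof (intro set_eqI iffI; elim CollectE conjE; intro CollectI conjI)
    fix C assume C: "C \<in> components (- K)" "\<not> bounded C"
    then show "C \<in> components (- H)" using restrict unb sub by blast
  next
    fix C assume C: "C \<in> components (- H)" "\<not> bounded C"
    have "C \<noteq> {}" "connected C" "C \<subseteq> - K"
      using in_components_nonempty[OF C(1)] in_components_connected[OF C(1)] in_components_subset[OF C(1)] sub by auto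
    then obtain D where D: "D \<in> components (- K)" "C \<subseteq> D"
      using exists_component_superset[of C "- K"] by blast
    then have "D \<in> components (- H)" using restrict unb sub C(2) bounded_subset by blast
    then have "D = C" using C(1) D(2) \<open>C \<noteq> {}\<close> components_nonoverlap[of D "- H" C] by blast
    with D(1) show "C \<in> components (- K)" by simp
  qed
  then show ?thesis by (simp add: connected_hull_def)
qed

text \<open>A frontier point of \<open>H\<close> lies in \<open>K\<close> but not in the interior of
  \<open>H\<close>, let alone in that of \<open>K\<close>.\<close>

lemma frontier_subset_frontier:
  assumes "frontier H \<subseteq> K" "K \<subseteq> H" shows "frontier H \<subseteq> frontier K"
  using assms interior_mono[OF assms(2)] closure_subset[of K] unfolding frontier_def by blast

theorem theorem3p17:
  fixes T :: "'a::complex_banach \<Rightarrow> 'a"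
  assumes "\<not> cfindim (UNIV :: 'a set)"
    and "bounded_clinear T"
  shows
    "frontier (sigma_gDR T) \<subseteq> frontier (sigma_gDR_cls bounded_below_on T) \<and>
     frontier (sigma_gDR_cls bounded_below_on T) \<subseteq> frontier (sigma_gDR_cls weyl_plus_on T) \<and>
     frontier (sigma_gDR_cls weyl_plus_on T) \<subseteq> frontier (sigma_gDR_cls upper_semi_fredholm_on T) \<and>
     frontier (sigma_gDR_cls upper_semi_fredholm_on T) \<subseteq> frontier (sigma_gKR T) \<and>

     frontier (sigma_gDR T) \<subseteq> frontier (sigma_gDR_cls weyl_on T) \<and>
     frontier (sigma_gDR_cls weyl_on T) \<subseteq> frontier (sigma_gDR_cls fredholm_on T) \<and>
     frontier (sigma_gDR_cls fredholm_on T) \<subseteq> frontier (sigma_gKR T) \<and>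

     frontier (sigma_gDR T) \<subseteq> frontier (sigma_gDR_cls surjective_on T) \<and>
     frontier (sigma_gDR_cls surjective_on T) \<subseteq> frontier (sigma_gDR_cls weyl_minus_on T) \<and>
     frontier (sigma_gDR_cls weyl_minus_on T) \<subseteq> frontier (sigma_gDR_cls lower_semi_fredholm_on T) \<and>
     frontier (sigma_gDR_cls lower_semi_fredholm_on T) \<subseteq> frontier (sigma_gKR T) \<and>

     frontier (sigma_gDR_cls fredholm_on T) \<subseteq> frontier (sigma_gDR_cls upper_semi_fredholm_on T) \<and>
     frontier (sigma_gDR_cls fredholm_on T) \<subseteq> frontier (sigma_gDR_cls lower_semi_fredholm_on T) \<and>
     frontier (sigma_gDR_cls weyl_on T) \<subseteq> frontier (sigma_gDR_cls weyl_plus_on T) \<and>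
     frontier (sigma_gDR_cls weyl_on T) \<subseteq> frontier (sigma_gDR_cls weyl_minus_on T) \<and>

     connected_hull (sigma_gKR T) = connected_hull (sigma_gDR_cls upper_semi_fredholm_on T) \<and>
     connected_hull (sigma_gDR_cls upper_semi_fredholm_on T) = connected_hull (sigma_gDR_cls weyl_plus_on T) \<and>
     connected_hull (sigma_gDR_cls weyl_plus_on T) = connected_hull (sigma_gDR_cls bounded_below_on T) \<and>
     connected_hull (sigma_gDR_cls bounded_below_on T) = connected_hull (sigma_gDR_cls lower_semi_fredholm_on T) \<and>
     connected_hull (sigma_gDR_cls lower_semi_fredholm_on T) = connected_hull (sigma_gDR_cls weyl_minus_on T) \<and>
     connected_hull (sigma_gDR_cls weyl_minus_on T) = connected_hull (sigma_gDR_cls surjective_on T) \<and>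
     connected_hull (sigma_gDR_cls surjective_on T) = connected_hull (sigma_gDR_cls fredholm_on T) \<and>
     connected_hull (sigma_gDR_cls fredholm_on T) = connected_hull (sigma_gDR_cls weyl_on T) \<and>
     connected_hull (sigma_gDR_cls weyl_on T) = connected_hull (sigma_gDR T)"
proof -
  note T = assms(2)
  \<comment> \<open>Classes stated through the deficiency do not mention closed range; this supplies
    it, so that they too have the form required by \<open>dim_spectrum\<close>.\<close>
  have closed_range: "closed (S ` M)"
    if "bounded_clinear S" "csubspace M" "closed M" "S ` M \<subseteq> M" "deficiency M S \<noteq> \<infinity>" for S :: "'a \<Rightarrow> 'a" and M
    using closed_range_of_finite_codim that by (simp add: deficiency_def)
  let ?inv = "\<lambda>a b :: enat. a = 0 \<and> b = 0" and ?M = "\<lambda>a b :: enat. a = 0" and ?Q = "\<lambda>a b :: enat. b = 0"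
    and ?Fp = "\<lambda>a b :: enat. a \<noteq> \<infinity>" and ?Fm = "\<lambda>a b :: enat. b \<noteq> \<infinity>" and ?F = "\<lambda>a b :: enat. a \<noteq> \<infinity> \<and> b \<noteq> \<infinity>"
    and ?Wp = "\<lambda>a b :: enat. a \<noteq> \<infinity> \<and> a \<le> b" and ?Wm = "\<lambda>a b :: enat. b \<noteq> \<infinity> \<and> b \<le> a"
    and ?W = "\<lambda>a b :: enat. a \<noteq> \<infinity> \<and> a = b"
  note eqI = sigma_gDR_cls_eq_dim_spectrum[OF T]
  have eq1: "sigma_gDR T = dim_spectrum ?inv T" unfolding sigma_gDR_def
    by (rule eqI) (metis invertible_on_iff closed_range i0_ne_infinity)
  have eq2: "sigma_gDR_cls bounded_below_on T = dim_spectrum ?M T"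
    by (rule eqI) (metis bounded_below_on_iff closed_range i0_ne_infinity)
  have eq3: "sigma_gDR_cls surjective_on T = dim_spectrum ?Q T"
    by (rule eqI) (metis surjective_on_iff closed_range i0_ne_infinity)
  have eq4: "sigma_gDR_cls upper_semi_fredholm_on T = dim_spectrum ?Fp T"
    by (rule eqI) (metis upper_semi_fredholm_on_iff closed_range i0_ne_infinity)
  have eq5: "sigma_gDR_cls lower_semi_fredholm_on T = dim_spectrum ?Fm T"
    by (rule eqI) (metis lower_semi_fredholm_on_iff closed_range i0_ne_infinity)
  have eq6: "sigma_gDR_cls fredholm_on T = dim_spectrum ?F T"
    by (rule eqI) (metis fredholm_on_iff closed_range i0_ne_infinity)
  have eq7: "sigma_gDR_cls weyl_plus_on T = dim_spectrum ?Wp T"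
    by (rule eqI) (metis weyl_plus_on_iff closed_range i0_ne_infinity)
  have eq8: "sigma_gDR_cls weyl_minus_on T = dim_spectrum ?Wm T"
    by (rule eqI) (metis weyl_minus_on_iff closed_range i0_ne_infinity)
  have eq9: "sigma_gDR_cls weyl_on T = dim_spectrum ?W T"
    by (rule eqI) (metis weyl_on_iff closed_range i0_ne_infinity)
  note eqs = eq1 eq2 eq3 eq4 eq5 eq6 eq7 eq8 eq9
  have zero_fin: "\<exists>i. enat i = 0" by (simp add: zero_enat_def)
  \<comment> \<open>The Weyl conditions compare the two numbers, so their admissibility amounts to
    cancelling a finite \<open>c\<close>.\<close>
  have add_le: "a \<le> b" if "a + c \<le> b + c" "c \<noteq> \<infinity>" for a b c :: enat
    using that by (cases a; cases b; cases c) auto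
  have adm: "admissible ?inv" "admissible ?M" "admissible ?Q" "admissible ?Fp" "admissible ?Fm" "admissible ?F"
    "admissible ?Wp" "admissible ?Wm" "admissible ?W"
    unfolding admissible_def using add_le by (auto simp: plus_eq_infty_iff_enat intro: antisym)
  \<comment> \<open>A weaker condition gives a smaller spectrum, and the frontier of the larger one
    lies in \<open>sigma_gKR T\<close>, hence in the smaller one.\<close>
  have fr: "frontier (dim_spectrum P T) \<subseteq> frontier (dim_spectrum Q T)"
    if "admissible P" "admissible Q" "\<And>a b. P a b \<Longrightarrow> Q a b" for P Q
  proof (rule frontier_subset_frontier)
    show "frontier (dim_spectrum P T) \<subseteq> dim_spectrum Q T"
      using frontier_dim_spectrum_subset_sigma_gKR[OF T that(1)] sigma_gKR_subset_dim_spectrum[OF T that(2)] by blast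
    show "dim_spectrum Q T \<subseteq> dim_spectrum P T" unfolding dim_spectrum_def using that(3) by blast
  qed
  have frK: "frontier (dim_spectrum P T) \<subseteq> frontier (sigma_gKR T)" if "admissible P" for P
    using frontier_subset_frontier[OF frontier_dim_spectrum_subset_sigma_gKR[OF T that] sigma_gKR_subset_dim_spectrum[OF T that]] .
  \<comment> \<open>A condition implied by invertibility has its spectrum inside
    \<open>sigma_gDR T\<close>, which provides the boundedness that
    \<open>connected_hull_eqI\<close> needs.\<close>
  have hull: "connected_hull (dim_spectrum P T) = connected_hull (sigma_gKR T)"
    if "admissible P" "\<And>a b. ?inv a b \<Longrightarrow> P a b" for P
  proof -
    have "dim_spectrum P T \<subseteq> sigma_gDR T" unfolding eq1 dim_spectrum_def using that(2) by blast
    then have "bounded (dim_spectrum P T)" using bounded_sigma_gDR[OF T] bounded_subset by blast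
    then show ?thesis
      using connected_hull_eqI[OF sigma_gKR_subset_dim_spectrum[OF T that(1)] frontier_dim_spectrum_subset_sigma_gKR[OF T that(1)]]
      by simp
  qed
  have hulls: "connected_hull (dim_spectrum P T) = connected_hull (dim_spectrum Q T)"
    if "admissible P" "admissible Q" "\<And>a b. ?inv a b \<Longrightarrow> P a b" "\<And>a b. ?inv a b \<Longrightarrow> Q a b" for P Q
    using hull[OF that(1,3)] hull[OF that(2,4)] by simp
  show ?thesis
    unfolding eqs using adm by (intro conjI fr frK hulls hull[symmetric]) (auto simp: zero_fin)
qed

end
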